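(* Let $X$ be a complete Lipschitz vector field on an open set $\Omega\subset\mathbb{R}^n$. Let $T^X_t f=f\circ\gamma^X_t$, $t\in\mathbb{R}$, be the induced $c_0$ one parameter group on the Banach space $L^1(\Omega)$ and let $Z:\operatorname{Dom}(Z)\to L^1(\Omega)$ be its infinitesimal generator. Let $f,g\in L^1(\Omega)$ be given. Then the following conditions are equivalent: (i) $g=Xf$, that is, $g$ is the distributional derivative of $f$ with respect to $X$; (ii) $g=L_Xf$, that is, $g$ is the Lie derivative of $f$ with respect to $X$; (iii) $f\in\operatorname{Dom}(Z)$ and $Zf=g$.
   Context: A Lipschitz vector field $X=(a_1,\dots,a_n):\Omega\to\mathbb{R}^n$ is complete if for every $x\in\Omega$ the solution $t\mapsto\gamma^X_t(x)\in\Omega$ of $\dot\gamma(t)=X(\gamma(t))$, $\gamma(0)=x$, is defined for all $t\in\mathbb{R}$. The infinitesimal generator $Z$ of $T^X_t$ is $Z(f)=\lim_{t\to0^+}t^{-1}(T^X_tf-f)$ (limit in the norm of $L^1(\Omega)$), with $\operatorname{Dom}(Z)$ the set of $f\in L^1(\Omega)$ for which the limit exists. It is a fact that $(t,f)\mapsto f\circ\gamma_t^X$ is a jointly continuous one parameter group on $L^1(\Omega)$. Distributional derivative: $g=Xf$ means that for each $u\in C_0^\infty(\Omega)$ $$\int_\Omega g\,u\,dx=-\int_\Omega f\,Xu\,dx-\int_\Omega f\,u\,\operatorname{div}X\,dx,$$ where $Xu=\sum_i a_i\,\partial u/\partial x_i$ and $\operatorname{div}X=\sum_i\partial a_i/\partial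 x_i$ (defined a.e. by Rademacher's theorem). Lie derivative: $g=L_Xf$ means that $f(\gamma^X_t(x))-f(x)=\int_0^tg(\gamma^X_s(x))\,ds$ for almost all $(t,x)\in\,]0,+\infty[\,\times\Omega$ (Lebesgue measure in $\mathbb{R}^{n+1}$). *)

theory Defs
  imports "HOL-Analysis.Analysis"
begin

text \<open>
  Elements of \<open>L\<^sup>1(\<Omega>)\<close> are represented by functions that are integrable with respect to
  \<^term>\<open>lebesgue_on \<Omega>\<close>; equality in \<open>L\<^sup>1(\<Omega>)\<close> is equality almost everywhere. Vector fields
  and functions on \<open>\<Omega>\<close> are total functions on the ambient space, whose values outside
  \<open>\<Omega>\<close> play no role.
\<close>

subsection \<open>Flow of a vector field\<close>

definition integral_curve ::
  "(real^'n \<Rightarrow> real^'n) \<Rightarrow> (real^'n) set \<Rightarrow> real^'n \<Rightarrow> (real \<Rightarrow> real^'n) \<Rightarrow> bool" where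
  "integral_curve X \<Omega> x c \<longleftrightarrow>
     c 0 = x \<and> (\<forall>t. c t \<in> \<Omega> \<and> (c has_vector_derivative X (c t)) (at t))"

definition complete_vector_field :: "(real^'n \<Rightarrow> real^'n) \<Rightarrow> (real^'n) set \<Rightarrow> bool" where
  "complete_vector_field X \<Omega> \<longleftrightarrow> (\<forall>x\<in>\<Omega>. \<exists>c. integral_curve X \<Omega> x c)"

text \<open>
  For a complete Lipschitz vector field and \<open>x \<in> \<Omega>\<close> the integral curve through \<open>x\<close>
  exists and is unique, so the description below is proper.
\<close>

definition flow ::
  "(real^'n \<Rightarrow> real^'n) \<Rightarrow> (real^'n) set \<Rightarrow> real \<Rightarrow> real^'n \<Rightarrow> real^'n" where
  "flow X \<Omega> t x = (THE c. integral_curve X \<Omega> x c) t"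

definition flow_group ::
  "(real^'n \<Rightarrow> real^'n) \<Rightarrow> (real^'n) set \<Rightarrow> real \<Rightarrow> (real^'n \<Rightarrow> real) \<Rightarrow> (real^'n \<Rightarrow> real)" where
  "flow_group X \<Omega> t f = f \<circ> flow X \<Omega> t"

subsection \<open>Infinitesimal generator on \<open>L\<^sup>1(\<Omega>)\<close>\<close>

text \<open>
  The norm is the extended nonnegative integral, so that a difference quotient outside
  \<open>L\<^sup>1(\<Omega>)\<close> cannot have norm zero by the convention on non-integrable functions.
\<close>

definition has_generator_value ::
  "(real^'n) set \<Rightarrow> (real \<Rightarrow> (real^'n \<Rightarrow> real) \<Rightarrow> (real^'n \<Rightarrow> real)) \<Rightarrow>
   (real^'n \<Rightarrow> real) \<Rightarrow> (real^'n \<Rightarrow> real) \<Rightarrow> bool" where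
  "has_generator_value \<Omega> T f h \<longleftrightarrow> integrable (lebesgue_on \<Omega>) h \<and>
     ((\<lambda>t. \<integral>\<^sup>+x. ennreal \<bar>(T t f x - f x) / t - h x\<bar> \<partial>lebesgue_on \<Omega>) \<longlongrightarrow> 0) (at_right 0)"

definition generator_domain ::
  "(real^'n) set \<Rightarrow> (real \<Rightarrow> (real^'n \<Rightarrow> real) \<Rightarrow> (real^'n \<Rightarrow> real)) \<Rightarrow> (real^'n \<Rightarrow> real) set" where
  "generator_domain \<Omega> T =
     {f. integrable (lebesgue_on \<Omega>) f \<and> (\<exists>h. has_generator_value \<Omega> T f h)}"

text \<open>A representative of the \<open>L\<^sup>1\<close> limit, which is determined almost everywhere.\<close>

definition generator ::
  "(real^'n) set \<Rightarrow> (real \<Rightarrow> (real^'n \<Rightarrow> real) \<Rightarrow> (real^'n \<Rightarrow> real)) \<Rightarrow>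
   (real^'n \<Rightarrow> real) \<Rightarrow> (real^'n \<Rightarrow> real)" where
  "generator \<Omega> T f = (SOME h. has_generator_value \<Omega> T f h)"

subsection \<open>Distributional derivative along a vector field\<close>

definition partial_deriv :: "'n \<Rightarrow> (real^'n \<Rightarrow> real) \<Rightarrow> real^'n \<Rightarrow> real" where
  "partial_deriv i u x = deriv (\<lambda>h. u (x + h *\<^sub>R axis i 1)) 0"

primrec C_k :: "nat \<Rightarrow> (real^'n \<Rightarrow> real) \<Rightarrow> bool" where
  "C_k 0 u \<longleftrightarrow> continuous_on UNIV u"
| "C_k (Suc k) u \<longleftrightarrow> (\<forall>x. u differentiable (at x)) \<and> (\<forall>i. C_k k (partial_deriv i u))"

text \<open>Functions in \<open>C\<^sub>0\<^sup>\<infinity>(\<Omega>)\<close>, extended by zero to the whole space.\<close>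

definition test_function :: "(real^'n) set \<Rightarrow> (real^'n \<Rightarrow> real) \<Rightarrow> bool" where
  "test_function \<Omega> u \<longleftrightarrow> (\<forall>k. C_k k u) \<and>
     compact (closure {x. u x \<noteq> 0}) \<and> closure {x. u x \<noteq> 0} \<subseteq> \<Omega>"

definition apply_field :: "(real^'n \<Rightarrow> real^'n) \<Rightarrow> (real^'n \<Rightarrow> real) \<Rightarrow> real^'n \<Rightarrow> real" where
  "apply_field X u x = (\<Sum>i\<in>UNIV. X x $ i * partial_deriv i u x)"

text \<open>
  For Lipschitz \<open>X\<close> on open \<open>\<Omega>\<close> the partial derivatives exist at almost every point of \<open>\<Omega>\<close>;
  the arbitrary value on the exceptional null set does not affect integrals.
\<close>

definition divergence :: "(real^'n \<Rightarrow> real^'n) \<Rightarrow> real^'n \<Rightarrow> real" where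
  "divergence X x = (\<Sum>i\<in>UNIV. partial_deriv i (\<lambda>y. X y $ i) x)"

definition is_distributional_derivative ::
  "(real^'n \<Rightarrow> real^'n) \<Rightarrow> (real^'n) set \<Rightarrow> (real^'n \<Rightarrow> real) \<Rightarrow> (real^'n \<Rightarrow> real) \<Rightarrow> bool" where
  "is_distributional_derivative X \<Omega> f g \<longleftrightarrow>
     (\<forall>u. test_function \<Omega> u \<longrightarrow>
        (LINT x|lebesgue_on \<Omega>. g x * u x) =
          - (LINT x|lebesgue_on \<Omega>. f x * apply_field X u x)
          - (LINT x|lebesgue_on \<Omega>. f x * u x * divergence X x))"

subsection \<open>Lie derivative along a vector field\<close>

definition is_Lie_derivative ::
  "(real^'n \<Rightarrow> real^'n) \<Rightarrow> (real^'n) set \<Rightarrow> (real^'n \<Rightarrow> real) \<Rightarrow> (real^'n \<Rightarrow> real) \<Rightarrow> bool" where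
  "is_Lie_derivative X \<Omega> f g \<longleftrightarrow>
     (AE (t, x) in lebesgue_on ({0<..} \<times> \<Omega>).
        integrable (lebesgue_on {0..t}) (\<lambda>s. g (flow X \<Omega> s x)) \<and>
        f (flow X \<Omega> t x) - f x = (LINT s|lebesgue_on {0..t}. g (flow X \<Omega> s x)))"

end

(*
  Everything is compared with the integrated identity
  f (Phi t x) - f x = int_0^t g (Phi s x) ds for all t >= 0 and almost all x.
  It is equivalent to (ii) by Fubini's theorem and to (iii) by the usual semigroup argument, since
  composition with the Lipschitz flow is a strongly continuous group on L^1.
  If g = Xf weakly, mollify f: by Friedrichs' commutator lemma the classical derivative of the
  mollification along X converges to g in L^1_loc, and the identity passes to the limit.
  Conversely, let w = - Xu - u div X for a test function u. For a Lipschitz function v with compact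
  support, v o Phi_t is again of this kind, and t |-> int (v o Phi_t) u has derivative
  int (v o Phi_t) w by Rademacher's theorem and integration by parts; density of these v in L^1
  gives int (f o Phi_t - f) u = t int f w + o(t) for all f in L^1, hence int g u = int f w.
*)

theory Submission
  imports Defs
begin

section \<open>Lipschitz functions: differentiability and integration by parts\<close>

text \<open>The flow of a Lipschitz field is only Lipschitz in x, so differentiating in time after a
  change of variables would bring in the time derivative of a Jacobian that exists merely almost
  everywhere. The only fact used about \<open>Phi t\<close> as a map that transports measure is that
  it enlarges Lebesgue measure at most by the factor \<open>growth t\<close>, a covering estimate.
  It bounds composition with the flow on L^1, gives strong continuity, and makes composition respect
  equality almost everywhere. In the step from (iii) to (i) the test function therefore stays where
  it is: the flow acts on a Lipschitz function v, and the derivative of v along X is moved onto u.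
  Smooth v would not do, because smoothness may be lost under the flow while Lipschitz continuity
  with compact support is kept. The same covering estimate, on the real line, yields
  differentiability almost everywhere of Lipschitz functions. To keep all integrals over the whole
  space, f and g are replaced by Borel functions that vanish off \<Omega>, the flow is extended by
  the identity and the components of X by Lipschitz functions.\<close>

text \<open>Vitali's theorem selects countably many disjoint balls of the given kind that cover S up
  to a null set. They are kept inside an open set of measure close to that of S, so summing the
  local bounds loses only an arbitrarily small amount. The balls need only contain x and not be
  centred there: for difference quotients x is an endpoint of the covering interval.\<close>

lemma Vitali_image_emeasure_le:
  fixes F :: "'a::euclidean_space \<Rightarrow> 'b::euclidean_space"
  assumes S: "S \<in> sets lebesgue" and FS: "F ` S \<in> sets lebesgue" and p: "0 \<le> p"
    and null: "\<And>N. negligible N \<Longrightarrow> N \<subseteq> S \<Longrightarrow> negligible (F ` N)"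
    and small: "\<And>x d. x \<in> S \<Longrightarrow> 0 < d \<Longrightarrow> \<exists>c r V. 0 < r \<and> r < d \<and> x \<in> cball c r \<and> V \<in> sets lebesgue \<and>
       F ` (S \<inter> cball c r) \<subseteq> V \<and> emeasure lebesgue V \<le> ennreal p * emeasure lebesgue (cball c r)"
  shows "emeasure lebesgue (F ` S) \<le> ennreal p * emeasure lebesgue S"
proof -
  have bound: "emeasure lebesgue (F ` S) \<le> ennreal p * (emeasure lebesgue S + ennreal \<epsilon>)" if \<epsilon>: "0 < \<epsilon>" for \<epsilon>
  proof -
    obtain U where U: "open U" "S \<subseteq> U" "U - S \<in> lmeasurable" "emeasure lebesgue (U - S) < ennreal \<epsilon>"
      using sets_lebesgue_outer_open[OF S \<epsilon>] by metis
    define good where "good = (\<lambda>(i::'a\<times>real) V. V \<in> sets lebesgue \<and>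
       F ` (S \<inter> cball (fst i) (snd i)) \<subseteq> V \<and> emeasure lebesgue V \<le> ennreal p * emeasure lebesgue (cball (fst i) (snd i)))"
    define K where "K = {i. 0 < snd i \<and> cball (fst i) (snd i) \<subseteq> U \<and> (\<exists>V. good i V)}"
    obtain C where C: "countable C" "C \<subseteq> K"
       "pairwise (\<lambda>i j. disjnt (cball (fst i) (snd i)) (cball (fst j) (snd j))) C"
       "negligible (S - (\<Union>i \<in> C. cball (fst i) (snd i)))"
    proof (rule Vitali_covering_theorem_cballs[of K snd S fst])
      show "0 < snd i" if "i \<in> K" for i using that by (auto simp: K_def)
      fix x d :: _ assume x: "x \<in> S" and d: "(0::real) < d"
      obtain e where e: "e > 0" "cball x e \<subseteq> U" using U(1,2) x open_contains_cball by blast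
      \<comment> \<open>A ball of radius below \<open>e/2\<close> that contains x lies in
        \<open>cball x e\<close>, wherever its centre is.\<close>
      obtain c r V where cr: "0 < r" "r < min d (e/2)" "x \<in> cball c r" "V \<in> sets lebesgue"
        "F ` (S \<inter> cball c r) \<subseteq> V" "emeasure lebesgue V \<le> ennreal p * emeasure lebesgue (cball c r)"
        using small[OF x, of "min d (e/2)"] d e by auto
      have "cball c r \<subseteq> cball x e"
      proof
        fix y assume "y \<in> cball c r"
        then have "dist x y \<le> dist c x + dist c y" by (metis dist_triangle3)
        then show "y \<in> cball x e" using \<open>y \<in> cball c r\<close> cr by auto
      qed
      then have "(c, r) \<in> K" using cr e by (auto simp: K_def good_def)
      then show "\<exists>i. i \<in> K \<and> x \<in> cball (fst i) (snd i) \<and> snd i < d"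
        using cr by (intro exI[of _ "(c,r)"]) auto
    qed
    have "\<forall>i\<in>C. \<exists>V. good i V" using C(2) by (auto simp: K_def)
    then obtain V where V: "\<And>i. i \<in> C \<Longrightarrow> good i (V i)" by metis
    \<comment> \<open>C may be finite, so the balls are indexed by the image of
      \<open>to_nat_on\<close> and the sequence is padded with empty sets.\<close>
    define I where "I = to_nat_on C ` C"
    define A where "A n = (if n \<in> I then V (from_nat_into C n) else {})" for n
    define B where "B n = (if n \<in> I then cball (fst (from_nat_into C n)) (snd (from_nat_into C n)) else {})" for n
    have fn: "from_nat_into C n \<in> C" if "n \<in> I" for n
      using that C(1) by (auto simp: I_def)
    have inj: "n = m" if "n \<in> I" "m \<in> I" "from_nat_into C n = from_nat_into C m" for n m
      using that C(1) by (auto simp: I_def)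
    have A_sets[measurable]: "A n \<in> sets lebesgue" for n
      using V[OF fn] by (auto simp: A_def good_def)
    have B_sets: "B n \<in> sets lebesgue" for n by (auto simp: B_def)
    have B_disj: "disjoint_family B"
      unfolding disjoint_family_on_def
    proof (intro ballI impI)
      fix m n :: nat assume "m \<noteq> n"
      then show "B m \<inter> B n = {}"
        using C(3) fn[of m] fn[of n] inj[of m n] unfolding pairwise_def disjnt_def B_def by auto
    qed
    have AB: "emeasure lebesgue (A n) \<le> ennreal p * emeasure lebesgue (B n)" for n
      using V[OF fn[of n]] unfolding good_def A_def B_def
      by (cases "n \<in> I") (simp_all del: emeasure_completion)
    have UB: "(\<Union>n. B n) \<subseteq> U" using C(2) fn by (auto simp: B_def K_def split: if_splits)
    have UA: "F ` S \<subseteq> (\<Union>n. A n) \<union> F ` (S - (\<Union>i \<in> C. cball (fst i) (snd i)))"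
    proof
      fix y assume "y \<in> F ` S"
      then obtain x where x: "x \<in> S" "y = F x" by auto
      show "y \<in> (\<Union>n. A n) \<union> F ` (S - (\<Union>i \<in> C. cball (fst i) (snd i)))"
      proof (cases "x \<in> (\<Union>i \<in> C. cball (fst i) (snd i))")
        case True
        then obtain i where i: "i \<in> C" "x \<in> cball (fst i) (snd i)" by blast
        then have "y \<in> V i" using V[OF i(1)] x by (auto simp: good_def)
        moreover have "V i = A (to_nat_on C i)" using i C(1) by (auto simp: A_def I_def)
        ultimately show ?thesis by blast
      next
        case False
        then show ?thesis using x by auto
      qed
    qed
    have neg: "F ` (S - (\<Union>i \<in> C. cball (fst i) (snd i))) \<in> null_sets lebesgue"
      using null[OF C(4)] by (auto simp: negligible_iff_null_sets)
    have "emeasure lebesgue (F ` S) \<le> emeasure lebesgue ((\<Union>n. A n) \<union> F ` (S - (\<Union>i \<in> C. cball (fst i) (snd i))))"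
      using UA neg by (intro emeasure_mono) auto
    also have "\<dots> = emeasure lebesgue (\<Union>n. A n)"
      using neg by (intro emeasure_Un_null_set) auto
    also have "\<dots> \<le> (\<Sum>n. emeasure lebesgue (A n))"
      by (intro emeasure_subadditive_countably) auto
    also have "\<dots> \<le> (\<Sum>n. ennreal p * emeasure lebesgue (B n))"
      by (intro suminf_le AB) auto
    also have "\<dots> = ennreal p * (\<Sum>n. emeasure lebesgue (B n))" by (rule ennreal_suminf_cmult)
    also have "(\<Sum>n. emeasure lebesgue (B n)) = emeasure lebesgue (\<Union>n. B n)"
      using B_sets B_disj by (intro suminf_emeasure) auto
    also have "\<dots> \<le> emeasure lebesgue U" using UB U(1) by (intro emeasure_mono) auto
    also have "emeasure lebesgue U = emeasure lebesgue (S \<union> (U - S))" using U(2) by (simp add: Un_absorb1)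
    also have "\<dots> \<le> emeasure lebesgue S + emeasure lebesgue (U - S)"
      using S U(3) by (intro emeasure_subadditive) auto
    also have "\<dots> \<le> emeasure lebesgue S + ennreal \<epsilon>" using U(4) by (intro add_left_mono) auto
    finally show ?thesis by (auto simp: mult_left_mono)
  qed
  show ?thesis
  proof (cases "emeasure lebesgue S = \<infinity>")
    case True
    show ?thesis
    proof (cases "p = 0")
      case True
      then show ?thesis using bound[of 1] by simp
    next
      case False
      then show ?thesis using True p by (simp add: ennreal_mult_eq_top_iff ennreal_mult_top)
    qed
  next
    case False
    then obtain s where s: "emeasure lebesgue S = ennreal s" "0 \<le> s" by (metis ennreal_cases infinity_ennreal_def)
    have "emeasure lebesgue (F ` S) \<le> ennreal (p * s) + ennreal \<epsilon>" if \<epsilon>: "0 < \<epsilon>" for \<epsilon>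
    proof -
      \<comment> \<open>Dividing by \<open>p + 1\<close> instead of p covers the case p = 0.\<close>
      have "emeasure lebesgue (F ` S) \<le> ennreal p * (emeasure lebesgue S + ennreal (\<epsilon>/(p+1)))"
        using \<epsilon> p by (intro bound) auto
      also have "\<dots> = ennreal (p * (s + \<epsilon>/(p+1)))"
        unfolding s(1) ennreal_mult'[OF p] using p s(2) \<epsilon> by (subst ennreal_plus) auto
      also have "p * (s + \<epsilon>/(p+1)) = p * s + p * (\<epsilon>/(p+1))" by (rule distrib_left)
      also have "\<dots> \<le> ennreal (p * s + \<epsilon>)" using p \<epsilon> by (intro ennreal_leI add_left_mono) (auto simp: field_simps)
      finally show ?thesis using p s \<epsilon> by (simp add: ennreal_plus)
    qed
    then have "emeasure lebesgue (F ` S) \<le> ennreal (p * s)"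
      by (rule ennreal_le_epsilon)
    then show ?thesis using p s by (simp add: ennreal_mult')
  qed
qed

section \<open>Differentiability almost everywhere of Lipschitz functions of one variable\<close>

text \<open>
  Strict inequalities between slopes make this set a countable intersection of open sets.
\<close>

definition slope_gap :: "('a::real_normed_vector \<Rightarrow> real) \<Rightarrow> 'a \<Rightarrow> real \<Rightarrow> real \<Rightarrow> 'a set" where
  "slope_gap v e p q = {x. \<forall>k::nat. (\<exists>h. h \<noteq> 0 \<and> \<bar>h\<bar> < 1 / Suc k \<and> (v (x + h *\<^sub>R e) - v x) / h < p) \<and>
     (\<exists>h. h \<noteq> 0 \<and> \<bar>h\<bar> < 1 / Suc k \<and> q < (v (x + h *\<^sub>R e) - v x) / h)}"

text \<open>When the slopes in direction e are bounded, this is exactly the set where the derivative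
  along e fails to exist: lower and upper derivative then leave room for two rationals. The union is
  countable, which keeps the set Borel and reduces its nullity to that of each
  \<open>slope_gap\<close>.\<close>

definition non_diff :: "('a::real_normed_vector \<Rightarrow> real) \<Rightarrow> 'a \<Rightarrow> 'a set" where
  "non_diff v e = (\<Union>p\<in>\<rat>. \<Union>q\<in>\<rat> \<inter> {p<..}. slope_gap v e p q)"

lemma slope_gap_borel:
  assumes "continuous_on UNIV v"
  shows "slope_gap v e p q \<in> sets borel"
proof -
  have cont: "continuous_on UNIV (\<lambda>x. (v (x + h *\<^sub>R e) - v x) / h)" if "h \<noteq> 0" for h
    using that by (intro continuous_intros continuous_on_compose2[OF assms]) auto
  have "slope_gap v e p q = (\<Inter>k::nat. (\<Union>h\<in>{h. h \<noteq> 0 \<and> \<bar>h\<bar> < 1 / Suc k}. {x. (v (x + h *\<^sub>R e) - v x) / h < p}) \<inter>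
     (\<Union>h\<in>{h. h \<noteq> 0 \<and> \<bar>h\<bar> < 1 / Suc k}. {x. q < (v (x + h *\<^sub>R e) - v x) / h}))"
    unfolding slope_gap_def by auto
  also have "\<dots> \<in> sets borel"
    by (intro sets.countable_INT' image_subsetI sets.Int borel_open open_UN ballI open_Collect_less continuous_on_const cont) auto
  finally show ?thesis .
qed

lemma non_diff_borel:
  assumes "continuous_on UNIV v"
  shows "non_diff v e \<in> sets borel"
  unfolding non_diff_def
  by (intro sets.countable_UN' image_subsetI slope_gap_borel assms countable_rat countable_Int1)

lemma ereal_between_obtain:
  assumes "ereal a \<le> l" "l \<le> ereal b"
  obtains r where "l = ereal r"
  using assms by (cases l) auto

text \<open>Outside \<open>non_diff\<close> the lower and upper limit of the difference quotient
  agree, since two rationals strictly between them would put x into a slope gap. The bound L makes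
  the common limit finite.\<close>

lemma not_non_diff_imp:
  assumes bd: "\<And>h. h \<noteq> 0 \<Longrightarrow> \<bar>(v (x + h *\<^sub>R e) - v x) / h\<bar> \<le> (L::real)" and x: "x \<notin> non_diff v e"
  shows "\<exists>l. ((\<lambda>h. v (x + h *\<^sub>R e)) has_field_derivative l) (at 0)"
proof -
  define s where "s h = (v (x + h *\<^sub>R e) - v x) / h" for h
  have freq: "\<exists>h. h \<noteq> 0 \<and> \<bar>h\<bar> < 1 / Suc k \<and> Q h" if "\<exists>\<^sub>F h in at 0. Q h" for Q :: "real \<Rightarrow> bool" and k :: nat
  proof -
    have "\<forall>\<^sub>F h::real in at 0. h \<noteq> 0 \<and> \<bar>h\<bar> < 1 / Suc k"
      unfolding eventually_at by (intro exI[of _ "1 / Suc k"]) auto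
    from frequently_eventually_frequently[OF that this] show ?thesis
      by (auto dest!: frequently_ex)
  qed
  have bnd: "\<forall>\<^sub>F h in at 0. -L \<le> s h \<and> s h \<le> L"
    unfolding eventually_at s_def
    using bd[unfolded abs_le_iff] by (intro exI[of _ 1]) (fastforce simp: minus_le_iff)
  let ?l = "Liminf (at 0) (\<lambda>h. ereal (s h))" and ?u = "Limsup (at 0) (\<lambda>h. ereal (s h))"
  have le: "?l \<le> ?u" by (intro Liminf_le_Limsup) auto
  have "\<not> ?l < ?u"
  proof
    assume "?l < ?u"
    then obtain a where a: "?l < ereal a" "ereal a < ?u" by (metis ereal_dense2)
    then obtain b where b: "ereal a < ereal b" "ereal b < ?u" by (metis ereal_dense2)
    obtain p where p: "p \<in> \<rat>" "a < p" "p < b" using Rats_dense_in_real[of a b] b by auto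
    obtain q where q: "q \<in> \<rat>" "p < q" "q < b" using Rats_dense_in_real[of p b] p by auto
    have "\<exists>\<^sub>F h in at 0. s h < p"
    proof (rule ccontr)
      assume "\<not> ?thesis"
      then have "\<forall>\<^sub>F h in at 0. ereal p \<le> ereal (s h)" by (auto simp: frequently_def not_less)
      then have "ereal p \<le> ?l" by (rule Liminf_bounded)
      then show False using a p by (metis dual_order.strict_trans ereal_less(1) leD less_ereal.simps(1))
    qed
    moreover have "\<exists>\<^sub>F h in at 0. q < s h"
    proof (rule ccontr)
      assume "\<not> ?thesis"
      then have "\<forall>\<^sub>F h in at 0. ereal (s h) \<le> ereal q" by (auto simp: frequently_def not_less)
      then have "?u \<le> ereal q" by (rule Limsup_bounded)
      then show False using b q by (metis dual_order.strict_trans ereal_less(1) leD less_ereal.simps(1))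
    qed
    ultimately have "x \<in> slope_gap v e p q" using freq unfolding slope_gap_def s_def by blast
    then show False using x p q by (auto simp: non_diff_def)
  qed
  then have eq: "?l = ?u" using le by simp
  have "ereal (-L) \<le> ?l" using bnd by (intro Liminf_bounded) (auto elim: eventually_mono)
  moreover have "?u \<le> ereal L" using bnd by (intro Limsup_bounded) (auto elim: eventually_mono)
  ultimately have "ereal (-L) \<le> ?l" "?l \<le> ereal L" using eq by auto
  then obtain l where l: "?l = ereal l" by (rule ereal_between_obtain)
  have "((\<lambda>h. ereal (s h)) \<longlongrightarrow> ereal l) (at 0)"
    using l eq by (intro Liminf_eq_Limsup) auto
  then have "(s \<longlongrightarrow> l) (at 0)" by simp
  then have "((\<lambda>h. v (x + h *\<^sub>R e)) has_field_derivative l) (at 0)"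
    by (simp add: has_field_derivative_iff s_def[abs_def])
  then show ?thesis ..
qed


lemma negligible_lipschitz_image:
  fixes F :: "'a::euclidean_space \<Rightarrow> 'b::euclidean_space"
  assumes "DIM('a) \<le> DIM('b)" "negligible N" "L-lipschitz_on N F"
  shows "negligible (F ` N)"
proof (rule negligible_locally_Lipschitz_image[OF assms(1,2)])
  fix x assume "x \<in> N"
  then show "\<exists>T B. open T \<and> x \<in> T \<and> (\<forall>y\<in>N \<inter> T. norm (F y - F x) \<le> B * norm (y - x))"
    using lipschitz_onD[OF assms(3)] by (intro exI[of _ UNIV] exI[of _ L]) (auto simp: dist_norm)
qed

text \<open>
  Adding a multiple of the identity turns \<open>f\<close> into a bi-Lipschitz homeomorphism \<open>F\<close>. On the set
  where \<open>F\<close> has lower derivative below \<open>P\<close> and upper derivative above \<open>Q > P\<close>, the covering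
  estimate applied to \<open>F\<close> and to its inverse gives \<open>Q \<bar>E\<bar> \<le> \<bar>F E\<bar> \<le> P \<bar>E\<bar>\<close>.
\<close>

lemma slope_gap_null:
  fixes f :: "real \<Rightarrow> real"
  assumes f: "L-lipschitz_on UNIV f" and pq: "p < q"
  shows "slope_gap f 1 p q \<in> null_sets lborel"
proof -
  \<comment> \<open>After adding slope \<open>L + 1\<close>, all slopes of F lie between 1 and
    \<open>2 * L + 1\<close>. So F has a 1-Lipschitz inverse, and the slopes p and q turn into P and
    Q.\<close>
  define F where "F x = f x + (L + 1) * x" for x
  define M where "M = 2 * L + 1"
  define P Q where "P = p + L + 1" and "Q = q + L + 1"
  have L: "0 \<le> L" using f by (rule lipschitz_on_nonneg)
  have F_lo: "y - x \<le> F y - F x" and F_hi: "F y - F x \<le> M * (y - x)" if "x \<le> y" for x y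
  proof -
    have "\<bar>f y - f x\<bar> \<le> L * (y - x)" using lipschitz_onD[OF f, of y x] that by (simp add: dist_real_def)
    then show "y - x \<le> F y - F x" "F y - F x \<le> M * (y - x)" by (auto simp: F_def M_def algebra_simps)
  qed
  have F_less: "F x < F y" if "x < y" for x y using F_lo[of x y] that by simp
  have F_lip: "M-lipschitz_on UNIV F"
  proof (rule lipschitz_onI)
    show "dist (F x) (F y) \<le> M * dist x y" for x y
      using F_lo[of x y] F_hi[of x y] F_lo[of y x] F_hi[of y x] by (cases "x \<le> y") (auto simp: dist_real_def)
  qed (use L in \<open>simp add: M_def\<close>)
  have cF: "continuous_on UNIV F" using F_lip by (rule lipschitz_on_continuous_on)
  have surj: "\<exists>x. F x = y" for y
  proof -
    define b where "b = \<bar>y\<bar> + \<bar>F 0\<bar>"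
    have "F (-b) \<le> y" "y \<le> F b" using F_lo[of "-b" 0] F_lo[of 0 b] unfolding b_def by linarith+
    then show ?thesis using IVT'[of F "-b" y b] continuous_on_subset[OF cF] by (auto simp: b_def)
  qed
  then obtain G where FG: "\<And>y. F (G y) = y" by metis
  have GF: "G (F x) = x" for x using FG[of "F x"] F_less[of "G (F x)" x] F_less[of x "G (F x)"] by (cases "G (F x)" x rule: linorder_cases) auto
  have G_lo: "0 \<le> G z - G y" and G_hi: "G z - G y \<le> z - y" if "y \<le> z" for y z
  proof -
    have *: "G y \<le> G z" using that F_less[of "G z" "G y"] FG[of y] FG[of z] by linarith
    then show "0 \<le> G z - G y" by simp
    show "G z - G y \<le> z - y" using F_lo[OF *] FG[of y] FG[of z] by linarith
  qed
  have G_lip: "1-lipschitz_on UNIV G"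
  proof (rule lipschitz_onI)
    show "dist (G x) (G y) \<le> 1 * dist x y" for x y
      using G_lo[of x y] G_hi[of x y] G_lo[of y x] G_hi[of y x] by (cases "x \<le> y") (auto simp: dist_real_def)
  qed simp
  have cG: "continuous_on UNIV G" using G_lip by (rule lipschitz_on_continuous_on)
  have slope: "(F (x + h) - F x) / h = (f (x + h *\<^sub>R 1) - f x) / h + (L + 1)" if "h \<noteq> 0" for x h
    using that by (simp add: F_def field_simps)
  \<comment> \<open>The cut to a bounded interval makes the measure of E finite, so that it can be
    cancelled at the end.\<close>
  have main: "emeasure lebesgue E = 0" if E: "E = slope_gap f 1 p q \<inter> {-k<..<k}" for E k
  proof (cases "E = {}")
    case False
    have Eb: "E \<in> sets borel" unfolding E
      by (intro sets.Int slope_gap_borel lipschitz_on_continuous_on[OF f]) auto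
    have FE: "F ` E = G -` E"
    proof (rule set_eqI)
      show "y \<in> F ` E \<longleftrightarrow> y \<in> G -` E" for y
        using FG[of y] GF by (auto simp: image_iff intro!: bexI[of _ "G y"])
    qed
    have FEb: "F ` E \<in> sets borel" unfolding FE
      using measurable_sets[OF borel_measurable_continuous_onI[OF cG] Eb] by simp
    have ex: "\<exists>h. h \<noteq> 0 \<and> \<bar>h\<bar> < d \<and> (F (x + h) - F x) / h < P"
             "\<exists>h. h \<noteq> 0 \<and> \<bar>h\<bar> < d \<and> Q < (F (x + h) - F x) / h" if "x \<in> E" "0 < d" for x d
    proof -
      obtain n where n: "1 / Suc n < d" using \<open>0 < d\<close> nat_approx_posE by auto
      obtain h where "h \<noteq> 0" "\<bar>h\<bar> < 1 / Suc n" "(f (x + h *\<^sub>R 1) - f x) / h < p"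
        using \<open>x \<in> E\<close> unfolding E slope_gap_def by blast
      with n slope show "\<exists>h. h \<noteq> 0 \<and> \<bar>h\<bar> < d \<and> (F (x + h) - F x) / h < P"
        unfolding P_def by (intro exI[of _ h]) auto
      obtain h where "h \<noteq> 0" "\<bar>h\<bar> < 1 / Suc n" "q < (f (x + h *\<^sub>R 1) - f x) / h"
        using \<open>x \<in> E\<close> unfolding E slope_gap_def by blast
      with n slope show "\<exists>h. h \<noteq> 0 \<and> \<bar>h\<bar> < d \<and> Q < (F (x + h) - F x) / h"
        unfolding Q_def by (intro exI[of _ h]) auto
    qed
    \<comment> \<open>A point of E has a difference quotient of F below P, while all such quotients
      are at least 1. This makes P and Q positive, as the two covering estimates require.\<close>
    have P1: "1 < P"
    proof -
      obtain x where "x \<in> E" using False by auto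
      from ex(1)[OF this, of 1] obtain h where h: "h \<noteq> 0" "(F (x + h) - F x) / h < P" by auto
      have "1 \<le> (F (x + h) - F x) / h"
        using F_lo[of x "x+h"] F_lo[of "x+h" x] h(1) by (cases "h > 0") (auto simp: field_simps)
      then show ?thesis using h by simp
    qed
    have PQ: "P < Q" using pq by (simp add: P_def Q_def)
    \<comment> \<open>An increment h of either sign becomes an interval with endpoint x, and the
      difference quotient becomes the ratio of the length of its image to its own length.\<close>
    have ends: "\<exists>a b. a < b \<and> b - a = \<bar>h\<bar> \<and> x \<in> {a..b} \<and> F b - F a = (F (x + h) - F x) / h * \<bar>h\<bar>" if "h \<noteq> 0" for x h
      using that by (intro exI[of _ "min x (x+h)"] exI[of _ "max x (x+h)"]) (auto simp: min_def max_def field_simps)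
    have 1: "emeasure lebesgue (F ` E) \<le> ennreal P * emeasure lebesgue E"
    proof (rule Vitali_image_emeasure_le)
      show "E \<in> sets lebesgue" "F ` E \<in> sets lebesgue" using Eb FEb by auto
      show "0 \<le> P" using P1 by simp
      show "negligible (F ` N)" if "negligible N" "N \<subseteq> E" for N
        using that lipschitz_on_subset[OF F_lip] by (intro negligible_lipschitz_image[where L=M]) auto
      fix x d assume x: "x \<in> E" and d: "(0::real) < d"
      obtain h where h: "h \<noteq> 0" "\<bar>h\<bar> < d" "(F (x + h) - F x) / h < P" using ex(1)[OF x d] by auto
      obtain a b where ab: "a < b" "b - a = \<bar>h\<bar>" "x \<in> {a..b}" "F b - F a = (F (x + h) - F x) / h * \<bar>h\<bar>"
        using ends[OF h(1)] by blast
      have cb: "cball ((a+b)/2) ((b-a)/2) = {a..b}" by (simp add: cball_eq_atLeastAtMost field_simps)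
      have "F b - F a \<le> P * (b - a)"
        unfolding ab(2,4) using h(3) by (intro mult_right_mono) auto
      moreover have "F ` {a..b} \<subseteq> {F a..F b}" using F_less by (auto simp: less_eq_real_def)
      moreover have "F a < F b" using F_less ab by auto
      ultimately have "0 < (b-a)/2 \<and> (b-a)/2 < d \<and> x \<in> cball ((a+b)/2) ((b-a)/2) \<and> {F a..F b} \<in> sets lebesgue \<and>
         F ` (E \<inter> cball ((a+b)/2) ((b-a)/2)) \<subseteq> {F a..F b} \<and>
         emeasure lebesgue {F a..F b} \<le> ennreal P * emeasure lebesgue (cball ((a+b)/2) ((b-a)/2))"
        unfolding cb using ab h P1 by (auto simp flip: ennreal_mult' intro!: ennreal_leI)
      then show "\<exists>c r V. 0 < r \<and> r < d \<and> x \<in> cball c r \<and> V \<in> sets lebesgue \<and>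
         F ` (E \<inter> cball c r) \<subseteq> V \<and> emeasure lebesgue V \<le> ennreal P * emeasure lebesgue (cball c r)" by blast
    qed
    have GE: "G ` (F ` E) = E" using GF by (simp add: image_image)
    have 2: "emeasure lebesgue (G ` (F ` E)) \<le> ennreal (1/Q) * emeasure lebesgue (F ` E)"
    proof (rule Vitali_image_emeasure_le)
      show "F ` E \<in> sets lebesgue" "G ` F ` E \<in> sets lebesgue" unfolding GE using Eb FEb by auto
      show "0 \<le> 1/Q" using P1 PQ by simp
      show "negligible (G ` N)" if "negligible N" "N \<subseteq> F ` E" for N
        using that lipschitz_on_subset[OF G_lip] by (intro negligible_lipschitz_image[where L=1]) auto
      fix y d assume y: "y \<in> F ` E" and d: "(0::real) < d"
      then obtain x where x: "x \<in> E" "y = F x" by auto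
      have M: "M > 0" using L by (simp add: M_def)
      \<comment> \<open>The balls now live in the image of F, so the step in x is reduced by the
        Lipschitz constant M.\<close>
      obtain h where h: "h \<noteq> 0" "\<bar>h\<bar> < d / M" "Q < (F (x + h) - F x) / h" using ex(2)[OF x(1), of "d/M"] d M by auto
      obtain a b where ab: "a < b" "b - a = \<bar>h\<bar>" "x \<in> {a..b}" "F b - F a = (F (x + h) - F x) / h * \<bar>h\<bar>"
        using ends[OF h(1)] by blast
      have cb: "cball ((F a+F b)/2) ((F b-F a)/2) = {F a..F b}" by (simp add: cball_eq_atLeastAtMost field_simps)
      have "Q * (b - a) \<le> F b - F a"
        unfolding ab(2,4) using h(3) by (intro mult_right_mono) auto
      then have "b - a \<le> (1/Q) * (F b - F a)" using P1 PQ by (simp add: field_simps)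
      moreover have "G ` {F a..F b} \<subseteq> {a..b}"
      proof
        fix u assume "u \<in> G ` {F a..F b}"
        then obtain z where z: "F a \<le> z" "z \<le> F b" "u = G z" by auto
        then show "u \<in> {a..b}" using G_lo[OF z(1)] G_lo[OF z(2)] GF[of a] GF[of b] by simp
      qed
      moreover have "F a < F b" using F_less ab by auto
      moreover have "F b - F a < d"
      proof -
        have "F b - F a \<le> M * \<bar>h\<bar>" using F_hi[of a b] ab by simp
        also have "\<dots> < d" using h M by (simp add: field_simps)
        finally show ?thesis .
      qed
      moreover have "y \<in> {F a..F b}" using x ab F_less by (auto simp: less_eq_real_def)
      ultimately have "0 < (F b-F a)/2 \<and> (F b-F a)/2 < d \<and> y \<in> cball ((F a+F b)/2) ((F b-F a)/2) \<and> {a..b} \<in> sets lebesgue \<and>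
         G ` (F ` E \<inter> cball ((F a+F b)/2) ((F b-F a)/2)) \<subseteq> {a..b} \<and>
         emeasure lebesgue {a..b} \<le> ennreal (1/Q) * emeasure lebesgue (cball ((F a+F b)/2) ((F b-F a)/2))"
        unfolding cb using ab h P1 PQ by (auto simp flip: ennreal_mult' intro!: ennreal_leI)
      then show "\<exists>c r V. 0 < r \<and> r < d \<and> y \<in> cball c r \<and> V \<in> sets lebesgue \<and>
         G ` (F ` E \<inter> cball c r) \<subseteq> V \<and> emeasure lebesgue V \<le> ennreal (1/Q) * emeasure lebesgue (cball c r)" by blast
    qed
    have "emeasure lebesgue E \<le> emeasure lebesgue {-k<..<k}" using E by (intro emeasure_mono) auto
    also have "\<dots> = emeasure lborel {-k<..<k}" by simp
    also have "\<dots> < \<infinity>" by (intro emeasure_bounded_finite) auto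
    finally obtain m where m: "emeasure lebesgue E = ennreal m" "0 \<le> m" by (metis ennreal_cases infinity_ennreal_def less_irrefl)
    have "emeasure lebesgue E \<le> ennreal (1/Q) * (ennreal P * emeasure lebesgue E)"
      using 1 2 unfolding GE by (meson mult_left_mono order_trans zero_le)
    then have "m \<le> 1/Q * (P * m)" using m P1 PQ by (simp flip: ennreal_mult')
    then have "Q * m \<le> P * m" using P1 PQ by (simp add: field_simps)
    then have "\<not> 0 < m" using PQ mult_strict_right_mono[OF PQ, of m] by linarith
    then have "m = 0" using m(2) by simp
    then show ?thesis using m by simp
  qed simp
  have "slope_gap f 1 p q \<inter> {-real k<..<real k} \<in> null_sets lborel" for k :: nat
  proof -
    have "slope_gap f 1 p q \<inter> {-real k<..<real k} \<in> sets lborel"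
      by (auto intro!: sets.Int slope_gap_borel lipschitz_on_continuous_on[OF f])
    moreover from this have "slope_gap f 1 p q \<inter> {-real k<..<real k} \<in> null_sets lebesgue"
      using main[OF refl, of "real k"] by (intro null_setsI) auto
    ultimately show ?thesis by (simp add: null_sets_completion_iff)
  qed
  then have "(\<Union>k::nat. slope_gap f 1 p q \<inter> {-real k<..<real k}) \<in> null_sets lborel" by (rule null_sets_UN)
  moreover have "(\<Union>k::nat. slope_gap f 1 p q \<inter> {-real k<..<real k}) = slope_gap f 1 p q"
  proof -
    have "\<exists>k::nat. -real k < x \<and> x < real k" for x
      using reals_Archimedean2[of "\<bar>x\<bar>"] by (metis abs_less_iff minus_less_iff)
    then show ?thesis by auto
  qed
  ultimately show ?thesis by simp
qed


lemma non_diff_real_null: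
  fixes f :: "real \<Rightarrow> real"
  assumes "L-lipschitz_on UNIV f"
  shows "non_diff f 1 \<in> null_sets lborel"
  unfolding non_diff_def
  by (intro null_sets_UN' slope_gap_null[OF assms] countable_rat countable_Int1) auto

section \<open>From lines to the whole space\<close>

lemma nn_integral_lborel_shift:
  fixes c :: "'a::euclidean_space"
  assumes [measurable]: "h \<in> borel_measurable borel"
  shows "(\<integral>\<^sup>+x. h (x + c) \<partial>lborel) = (\<integral>\<^sup>+x. h x \<partial>lborel)"
proof -
  have "(\<integral>\<^sup>+x. h x \<partial>lborel) = (\<integral>\<^sup>+x. h x \<partial>distr lborel borel ((+) c))" by (simp only: lborel_distr_plus)
  also have "\<dots> = (\<integral>\<^sup>+x. h (c + x) \<partial>lborel)" by (intro nn_integral_distr) auto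
  finally show ?thesis by (simp add: add.commute)
qed

lemma integral_lborel_shift:
  fixes c :: "'a::euclidean_space" and h :: "'a \<Rightarrow> real"
  assumes [measurable]: "h \<in> borel_measurable borel"
  shows "(LINT x|lborel. h (x + c)) = (LINT x|lborel. h x)"
proof -
  have "(LINT x|lborel. h x) = (LINT x|distr lborel borel ((+) c). h x)" by (simp only: lborel_distr_plus)
  also have "\<dots> = (LINT x|lborel. h (c + x))" by (intro integral_distr) auto
  finally show ?thesis by (simp add: add.commute)
qed

lemma integrable_lborel_shift:
  fixes c :: "'a::euclidean_space" and h :: "'a \<Rightarrow> real"
  assumes "integrable lborel h"
  shows "integrable lborel (\<lambda>x. h (x + c))"
proof -
  have [measurable]: "h \<in> borel_measurable borel" using assms by (simp add: integrable_iff_bounded)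
  have "integrable (distr lborel borel ((+) c)) h" using assms by (simp only: lborel_distr_plus)
  then have "integrable lborel (\<lambda>x. h (c + x))" by (subst (asm) integrable_distr_eq) auto
  then show ?thesis by (simp add: add.commute)
qed

text \<open>Averaging the measure of the translates of N by t e over t in [0, 1] does not change it.
  Exchanging the integrals turns the average into an integral over x of measures on the lines
  through x, all of them zero. This avoids coordinates adapted to e.\<close>

lemma null_set_by_lines:
  fixes N :: "'a::euclidean_space set"
  assumes N[measurable]: "N \<in> sets borel" and lines: "\<And>x. {t::real. x + t *\<^sub>R e \<in> N} \<in> null_sets lborel"
  shows "N \<in> null_sets lborel"
proof -
  have "emeasure lborel N = (\<integral>\<^sup>+t. emeasure lborel N * indicator {0..1::real} t \<partial>lborel)"
    by (simp add: nn_integral_cmult)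
  also have "\<dots> = (\<integral>\<^sup>+t. (\<integral>\<^sup>+x. indicator N (x + t *\<^sub>R e) * indicator {0..1::real} t \<partial>lborel) \<partial>lborel)"
    by (intro nn_integral_cong) (simp add: nn_integral_multc nn_integral_lborel_shift)
  also have "\<dots> = (\<integral>\<^sup>+x. (\<integral>\<^sup>+t. indicator N (x + t *\<^sub>R e) * indicator {0..1::real} t \<partial>lborel) \<partial>lborel)"
    by (rule lborel_pair.Fubini') measurable
  also have "\<dots> = (\<integral>\<^sup>+(x::'a). 0 \<partial>lborel)"
  proof (intro nn_integral_cong)
    fix x
    have "(\<integral>\<^sup>+t. indicator N (x + t *\<^sub>R e) * indicator {0..1::real} t \<partial>lborel)
        \<le> (\<integral>\<^sup>+t. indicator {t. x + t *\<^sub>R e \<in> N} t \<partial>lborel)"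
      by (intro nn_integral_mono) (auto simp: indicator_def)
    also have "\<dots> = 0" using lines[of x] by (subst nn_integral_indicator) auto
    finally show "(\<integral>\<^sup>+t. indicator N (x + t *\<^sub>R e) * indicator {0..1::real} t \<partial>lborel) = 0" by simp
  qed
  finally show ?thesis by auto
qed

text \<open>On each line in direction e the function v restricts to a Lipschitz function of one
  variable, whose exceptional set is the trace of \<open>non_diff v e\<close> on that line.\<close>

lemma non_diff_null:
  fixes v :: "'a::euclidean_space \<Rightarrow> real"
  assumes v: "L-lipschitz_on UNIV v"
  shows "non_diff v e \<in> null_sets lborel"
proof (rule null_set_by_lines)
  show "non_diff v e \<in> sets borel" by (intro non_diff_borel lipschitz_on_continuous_on[OF v])
  fix x :: 'a
  have "(L * norm e)-lipschitz_on UNIV (\<lambda>t. v (x + t *\<^sub>R e))"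
  proof (rule lipschitz_onI)
    fix s t :: real
    have "dist (v (x + s *\<^sub>R e)) (v (x + t *\<^sub>R e)) \<le> L * dist (x + s *\<^sub>R e) (x + t *\<^sub>R e)"
      by (intro lipschitz_onD[OF v]) auto
    then show "dist (v (x + s *\<^sub>R e)) (v (x + t *\<^sub>R e)) \<le> L * norm e * dist s t"
      by (simp add: dist_norm flip: scaleR_left_diff_distrib) (simp add: mult_ac)
  qed (use lipschitz_on_nonneg[OF v] in simp)
  then have "non_diff (\<lambda>t. v (x + t *\<^sub>R e)) 1 \<in> null_sets lborel" by (rule non_diff_real_null)
  moreover have "non_diff (\<lambda>t. v (x + t *\<^sub>R e)) 1 = {t. x + t *\<^sub>R e \<in> non_diff v e}"
    by (auto simp: non_diff_def slope_gap_def scaleR_add_left add.assoc)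
  ultimately show "{t. x + t *\<^sub>R e \<in> non_diff v e} \<in> null_sets lborel" by simp
qed

section \<open>Directional derivatives and integration by parts\<close>

definition dir_deriv :: "('a::real_normed_vector \<Rightarrow> real) \<Rightarrow> 'a \<Rightarrow> 'a \<Rightarrow> real" where
  "dir_deriv v e x = deriv (\<lambda>h. v (x + h *\<^sub>R e)) 0"

lemma lipschitz_quotient_le:
  assumes v: "L-lipschitz_on UNIV (v :: 'a::real_normed_vector \<Rightarrow> real)"
  shows "\<bar>(v (x + h *\<^sub>R e) - v x) / h\<bar> \<le> L * norm e"
proof (cases "h = 0")
  case False
  have "\<bar>v (x + h *\<^sub>R e) - v x\<bar> \<le> L * (\<bar>h\<bar> * norm e)"
    using lipschitz_onD[OF v, of "x + h *\<^sub>R e" x] by (simp add: dist_norm)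
  then show ?thesis using False by (simp add: field_simps)
qed (use lipschitz_on_nonneg[OF v] in simp)

lemma dir_deriv_works:
  assumes v: "L-lipschitz_on UNIV v" and x: "x \<notin> non_diff v e"
  shows "((\<lambda>h. v (x + h *\<^sub>R e)) has_field_derivative dir_deriv v e x) (at 0)"
    and "((\<lambda>h. (v (x + h *\<^sub>R e) - v x) / h) \<longlongrightarrow> dir_deriv v e x) (at 0)"
    and "\<bar>dir_deriv v e x\<bar> \<le> L * norm e"
proof -
  obtain l where l: "((\<lambda>h. v (x + h *\<^sub>R e)) has_field_derivative l) (at 0)"
    using not_non_diff_imp[OF lipschitz_quotient_le[OF v] x] by blast
  then have eq: "dir_deriv v e x = l" unfolding dir_deriv_def by (rule DERIV_imp_deriv)
  show 1: "((\<lambda>h. v (x + h *\<^sub>R e)) has_field_derivative dir_deriv v e x) (at 0)" using l eq by simp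
  then show 2: "((\<lambda>h. (v (x + h *\<^sub>R e) - v x) / h) \<longlongrightarrow> dir_deriv v e x) (at 0)"
    by (simp add: has_field_derivative_iff)
  show "\<bar>dir_deriv v e x\<bar> \<le> L * norm e"
    by (rule tendsto_upperbound[OF tendsto_rabs[OF 2]]) (rule always_eventually allI lipschitz_quotient_le[OF v] at_neq_bot)+
qed

lemma AE_not_non_diff:
  fixes v :: "'a::euclidean_space \<Rightarrow> real"
  assumes v: "L-lipschitz_on UNIV v"
  shows "AE x in lborel. x \<notin> non_diff v e"
  using AE_not_in[OF non_diff_null[OF v]] .

text \<open>For p < q a derivative l satisfies p < l or l < q, and then the same inequality holds
  for all small difference quotients, against the recurrence of slopes on the other side. It serves
  to fix the value of \<open>dir_deriv\<close> on the exceptional set.\<close>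

lemma non_diff_imp_not_deriv:
  assumes "x \<in> non_diff v e"
  shows "\<not> ((\<lambda>h. v (x + h *\<^sub>R e)) has_field_derivative l) (at 0)"
proof
  assume "((\<lambda>h. v (x + h *\<^sub>R e)) has_field_derivative l) (at 0)"
  then have lim: "((\<lambda>h. (v (x + h *\<^sub>R e) - v x) / h) \<longlongrightarrow> l) (at 0)" by (simp add: has_field_derivative_iff)
  obtain p q where pq: "p < q" "x \<in> slope_gap v e p q" using assms by (auto simp: non_diff_def)
  have near: "\<exists>k::nat. \<forall>h. h \<noteq> 0 \<and> \<bar>h\<bar> < 1 / Suc k \<longrightarrow> Q h" if "eventually Q (at 0)" for Q :: "real \<Rightarrow> bool"
  proof -
    have "\<exists>d>0. \<forall>h. h \<noteq> 0 \<and> \<bar>h\<bar> < d \<longrightarrow> Q h"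
      using that unfolding eventually_at by (simp add: dist_real_def)
    then obtain d where d: "d > 0" "\<forall>h. h \<noteq> 0 \<and> \<bar>h\<bar> < d \<longrightarrow> Q h" by blast
    obtain k where "1 / Suc k < d" using d(1) nat_approx_posE by auto
    then show ?thesis using d(2) by (intro exI[of _ k]) (auto intro: less_trans)
  qed
  show False
  proof (cases "p < l")
    case True
    obtain k :: nat where k: "\<And>h. h \<noteq> 0 \<Longrightarrow> \<bar>h\<bar> < 1 / Suc k \<Longrightarrow> p < (v (x + h *\<^sub>R e) - v x) / h"
      using near[OF order_tendstoD(1)[OF lim True]] by blast
    obtain h where "h \<noteq> 0" "\<bar>h\<bar> < 1 / Suc k" "(v (x + h *\<^sub>R e) - v x) / h < p"
      using pq(2) unfolding slope_gap_def by blast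
    with k[of h] show False by linarith
  next
    case False
    then have "l < q" using pq by simp
    obtain k :: nat where k: "\<And>h. h \<noteq> 0 \<Longrightarrow> \<bar>h\<bar> < 1 / Suc k \<Longrightarrow> (v (x + h *\<^sub>R e) - v x) / h < q"
      using near[OF order_tendstoD(2)[OF lim \<open>l < q\<close>]] by blast
    obtain h where "h \<noteq> 0" "\<bar>h\<bar> < 1 / Suc k" "q < (v (x + h *\<^sub>R e) - v x) / h"
      using pq(2) unfolding slope_gap_def by blast
    with k[of h] show False by linarith
  qed
qed

text \<open>Off \<open>non_diff v e\<close> the derivative is a limit of difference quotients. On
  that set \<open>deriv\<close> is a choice from the empty predicate, hence one and the same value
  everywhere, namely \<open>SOME D. False\<close>. So the function is Borel on the whole space and
  not just up to a null set.\<close>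

lemma borel_measurable_dir_deriv:
  fixes v :: "'a::euclidean_space \<Rightarrow> real"
  assumes v: "L-lipschitz_on UNIV v"
  shows "dir_deriv v e \<in> borel_measurable borel"
proof -
  have N[measurable]: "non_diff v e \<in> sets borel" by (intro non_diff_borel lipschitz_on_continuous_on[OF v])
  have [measurable]: "v \<in> borel_measurable borel"
    by (intro borel_measurable_continuous_onI lipschitz_on_continuous_on[OF v])
  define q where "q n x = (if x \<in> non_diff v e then (SOME D. False) else (v (x + (1 / Suc n) *\<^sub>R e) - v x) / (1 / Suc n))" for n x
  show ?thesis
  proof (rule borel_measurable_LIMSEQ_real)
    show "q n \<in> borel_measurable borel" for n unfolding q_def by measurable
    fix x
    show "(\<lambda>n. q n x) \<longlonglongrightarrow> dir_deriv v e x"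
    proof (cases "x \<in> non_diff v e")
      case True
      then have "dir_deriv v e x = (SOME D. False)"
        unfolding dir_deriv_def deriv_def using non_diff_imp_not_deriv[OF True] by simp
      then show ?thesis using True by (simp add: q_def)
    next
      case False
      have "filterlim (\<lambda>n. 1 / real (Suc n)) (at 0) sequentially"
        by (rule filterlim_atI) (use lim_inverse_n' LIMSEQ_Suc[of "\<lambda>n. 1 / real n" 0] in \<open>auto intro!: LIMSEQ_Suc\<close>)
      from filterlim_compose[OF dir_deriv_works(2)[OF v False] this] False
      show ?thesis by (simp add: q_def)
    qed
  qed
qed

lemma integrable_continuous_compact_support:
  fixes U :: "'a::euclidean_space \<Rightarrow> real"
  assumes "continuous_on UNIV U" "compact S" "\<And>x. x \<notin> S \<Longrightarrow> U x = 0"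
  shows "integrable lborel U"
proof -
  have "integrable lborel (\<lambda>x. indicator S x *\<^sub>R U x)"
    using assms by (intro borel_integrable_compact) (auto intro: continuous_on_subset)
  moreover have "(\<lambda>x. indicator S x *\<^sub>R U x) = U" using assms(3) by (auto simp: indicator_def fun_eq_iff)
  ultimately show ?thesis by simp
qed

text \<open>Discrete integration by parts: both difference quotients converge boundedly almost everywhere.\<close>

lemma lipschitz_integral_by_parts:
  fixes Y U :: "'a::euclidean_space \<Rightarrow> real"
  assumes Y: "L-lipschitz_on UNIV Y" and U: "K-lipschitz_on UNIV U"
    and S: "compact S" "\<And>x. x \<notin> S \<Longrightarrow> U x = 0"
  shows "integrable lborel (\<lambda>x. Y x * dir_deriv U e x)"
    and "integrable lborel (\<lambda>x. U x * dir_deriv Y e x)"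
    and "(LINT x|lborel. Y x * dir_deriv U e x) = - (LINT x|lborel. U x * dir_deriv Y e x)"
proof -
  have cY: "continuous_on UNIV Y" and cU: "continuous_on UNIV U"
    using Y U by (auto intro: lipschitz_on_continuous_on)
  have [measurable]: "Y \<in> borel_measurable borel" "U \<in> borel_measurable borel"
    using cY cU by (auto intro: borel_measurable_continuous_onI)
  note [measurable] = borel_measurable_dir_deriv[OF Y] borel_measurable_dir_deriv[OF U]
  define d where "d n = 1 / real (Suc n)" for n
  have d: "0 < d n" "d n \<le> 1" for n by (auto simp: d_def)
  have "d \<longlonglongrightarrow> 0" unfolding d_def using LIMSEQ_Suc[OF lim_inverse_n'] .
  then have d0: "filterlim d (at 0) sequentially" using d by (intro filterlim_atI) (auto simp: less_imp_neq[OF d(1), symmetric])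
  have "(\<lambda>n. - d n) \<longlonglongrightarrow> 0" using tendsto_minus[OF \<open>d \<longlonglongrightarrow> 0\<close>] by simp
  then have d0': "filterlim (\<lambda>n. - d n) (at 0) sequentially" using d by (intro filterlim_atI) (auto simp: less_imp_neq[OF d(1), symmetric])
  \<comment> \<open>The steps in A and B are opposite: translation by \<open>d n\<close> times e
    carries the shifted product \<open>U (x - d n e) * Y x\<close> of B into that of A, and the
    unshifted products cancel.\<close>
  define A where "A n x = U x * ((Y (x + d n *\<^sub>R e) - Y x) / d n)" for n x
  define B where "B n x = Y x * ((U (x + (- d n) *\<^sub>R e) - U x) / (- d n))" for n x
  have [measurable]: "A n \<in> borel_measurable borel" "B n \<in> borel_measurable borel" for n
    unfolding A_def B_def by measurable
  have intU: "integrable lborel U" by (rule integrable_continuous_compact_support[OF cU S])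
  have wA: "integrable lborel (\<lambda>x. \<bar>U x\<bar> * (L * norm e))" using intU by auto
  have bA: "norm (A n x) \<le> \<bar>U x\<bar> * (L * norm e)" for n x
    unfolding A_def real_norm_def abs_mult by (intro mult_left_mono lipschitz_quotient_le[OF Y]) auto
  have limA: "AE x in lborel. (\<lambda>n. A n x) \<longlonglongrightarrow> U x * dir_deriv Y e x"
    using AE_not_non_diff[OF Y, of e]
    unfolding A_def
    by eventually_elim (intro tendsto_mult tendsto_const filterlim_compose[OF dir_deriv_works(2)[OF Y] d0])
  \<comment> \<open>All quotients of U in B vanish off the set swept out by S along the segment from
    0 to e. Y may be unbounded on the whole space but is bounded on this compact set.\<close>
  define S' where "S' = (\<lambda>(x, t). x + t *\<^sub>R e) ` (S \<times> {0..1::real})"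
  have S': "compact S'" unfolding S'_def
    by (intro compact_continuous_image compact_Times S compact_Icc) (auto simp: case_prod_unfold intro!: continuous_intros)
  have wB: "integrable lborel (\<lambda>x. (K * norm e) * (indicator S' x *\<^sub>R \<bar>Y x\<bar>))"
    by (intro integrable_mult_right borel_integrable_compact S' continuous_intros continuous_on_subset[OF cY]) auto
  have bB: "norm (B n x) \<le> (K * norm e) * (indicator S' x *\<^sub>R \<bar>Y x\<bar>)" for n x
  proof (cases "x \<in> S'")
    case True
    have "norm (B n x) \<le> \<bar>Y x\<bar> * (K * norm e)"
      unfolding B_def real_norm_def abs_mult by (intro mult_left_mono lipschitz_quotient_le[OF U]) auto
    then show ?thesis using True by (simp add: mult_ac)
  next
    case False
    have "x \<in> S'" if "x \<in> S"
      using that unfolding S'_def by (intro image_eqI[of _ _ "(x, 0)"]) auto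
    then have "x \<notin> S" using False by blast
    moreover have "x - d n *\<^sub>R e \<notin> S"
    proof
      assume "x - d n *\<^sub>R e \<in> S"
      then have "x \<in> S'" using d[of n] unfolding S'_def by (intro image_eqI[of _ _ "(x - d n *\<^sub>R e, d n)"]) auto
      then show False using False by simp
    qed
    ultimately show ?thesis using S(2) lipschitz_on_nonneg[OF U] by (simp add: B_def indicator_def)
  qed
  have limB: "AE x in lborel. (\<lambda>n. B n x) \<longlonglongrightarrow> Y x * dir_deriv U e x"
    using AE_not_non_diff[OF U, of e] unfolding B_def
    by eventually_elim (intro tendsto_mult tendsto_const filterlim_compose[OF dir_deriv_works(2)[OF U] d0'])
  have intA: "integrable lborel (A n)" for n
    by (rule Bochner_Integration.integrable_bound[OF wA]) (auto intro!: AE_I2 order_trans[OF bA[unfolded real_norm_def]])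
  have intB: "integrable lborel (B n)" for n
    by (rule Bochner_Integration.integrable_bound[OF wB])
       (auto intro!: AE_I2 order_trans[OF bB[unfolded real_norm_def real_scaleR_def]])
  have AB: "(LINT x|lborel. A n x) = - (LINT x|lborel. B n x)" for n
  proof -
    define P where "P x = U (x - d n *\<^sub>R e) * Y x / d n" for x
    define R where "R x = U x * Y x / d n" for x
    have iR: "integrable lborel R"
      by (rule integrable_continuous_compact_support[OF _ S(1)])
         (auto simp: R_def S(2) intro!: continuous_intros cU cY less_imp_neq[OF d(1), symmetric])
    have cP: "continuous_on UNIV P" unfolding P_def
      by (intro continuous_intros cY continuous_on_compose2[OF cU]) (auto simp: less_imp_neq[OF d(1), symmetric])
    have iP: "integrable lborel P"
    proof (rule integrable_continuous_compact_support[OF cP])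
      show "compact ((\<lambda>x. x + d n *\<^sub>R e) ` S)" by (intro compact_continuous_image continuous_intros S)
      show "P x = 0" if "x \<notin> (\<lambda>x. x + d n *\<^sub>R e) ` S" for x
      proof -
        have "x - d n *\<^sub>R e \<notin> S"
          using that by (metis diff_add_cancel imageI)
        then show ?thesis using S(2) by (simp add: P_def)
      qed
    qed
    have [measurable]: "P \<in> borel_measurable borel" using cP by (rule borel_measurable_continuous_onI)
    have "A n = (\<lambda>x. P (x + d n *\<^sub>R e) - R x)" by (auto simp: A_def P_def R_def algebra_simps diff_divide_distrib)
    moreover have "B n = (\<lambda>x. R x - P x)" using d[of n] by (auto simp: B_def P_def R_def field_simps)
    ultimately show ?thesis using iP iR integrable_lborel_shift[OF iP] by (simp add: integral_lborel_shift)
  qed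
  note A = integrable_dominated_convergence[OF _ _ wA limA] integral_dominated_convergence[OF _ _ wA limA]
  note B = integrable_dominated_convergence[OF _ _ wB limB] integral_dominated_convergence[OF _ _ wB limB]
  show "integrable lborel (\<lambda>x. U x * dir_deriv Y e x)" using bA by (intro A(1)) auto
  show "integrable lborel (\<lambda>x. Y x * dir_deriv U e x)" using bB by (intro B(1)) auto
  have "(\<lambda>n. LINT x|lborel. A n x) \<longlonglongrightarrow> (LINT x|lborel. U x * dir_deriv Y e x)" using bA by (intro A(2)) auto
  moreover have "(\<lambda>n. LINT x|lborel. B n x) \<longlonglongrightarrow> (LINT x|lborel. Y x * dir_deriv U e x)" using bB by (intro B(2)) auto
  then have "(\<lambda>n. LINT x|lborel. A n x) \<longlonglongrightarrow> - (LINT x|lborel. Y x * dir_deriv U e x)"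
    unfolding AB by (rule tendsto_minus)
  ultimately show "(LINT x|lborel. Y x * dir_deriv U e x) = - (LINT x|lborel. U x * dir_deriv Y e x)"
    using LIMSEQ_unique by fastforce
qed

section \<open>Density in the space of integrable functions\<close>

text \<open>Extended values allow triangle inequalities and limits to be stated without
  integrability conditions, in accordance with the norm in the definition of the generator.\<close>

definition L1norm :: "('a::euclidean_space \<Rightarrow> real) \<Rightarrow> ennreal" where
  "L1norm h = (\<integral>\<^sup>+x. ennreal \<bar>h x\<bar> \<partial>lborel)"

lemma L1norm_finite_iff:
  assumes "h \<in> borel_measurable borel"
  shows "integrable lborel h \<longleftrightarrow> L1norm h < \<infinity>"
  using assms by (simp add: integrable_iff_bounded L1norm_def)

lemma L1norm_add_le:
  assumes [measurable]: "f \<in> borel_measurable borel" "g \<in> borel_measurable borel"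
  shows "L1norm (\<lambda>x. f x + g x) \<le> L1norm f + L1norm g"
proof -
  have "L1norm (\<lambda>x. f x + g x) \<le> (\<integral>\<^sup>+x. ennreal \<bar>f x\<bar> + ennreal \<bar>g x\<bar> \<partial>lborel)"
    unfolding L1norm_def by (intro nn_integral_mono) (auto simp flip: ennreal_plus intro!: ennreal_leI)
  also have "\<dots> = L1norm f + L1norm g" unfolding L1norm_def by (intro nn_integral_add) auto
  finally show ?thesis .
qed

lemma L1norm_minus_commute: "L1norm (\<lambda>x. f x - g x) = L1norm (\<lambda>x. g x - f x)"
  unfolding L1norm_def by (simp add: abs_minus_commute)

lemma L1norm_triangle:
  assumes "f \<in> borel_measurable borel" "g \<in> borel_measurable borel" "h \<in> borel_measurable borel"
  shows "L1norm (\<lambda>x. f x - h x) \<le> L1norm (\<lambda>x. f x - g x) + L1norm (\<lambda>x. g x - h x)"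
  using L1norm_add_le[of "\<lambda>x. f x - g x" "\<lambda>x. g x - h x"] assms by simp

lemma L1norm_cmult: "h \<in> borel_measurable borel \<Longrightarrow> L1norm (\<lambda>x. c * h x) = ennreal \<bar>c\<bar> * L1norm h"
  unfolding L1norm_def by (simp add: abs_mult ennreal_mult nn_integral_cmult)

lemma L1norm_mono:
  assumes "\<And>x. \<bar>f x\<bar> \<le> \<bar>g x\<bar>"
  shows "L1norm f \<le> L1norm g"
  unfolding L1norm_def using assms by (intro nn_integral_mono ennreal_leI) auto

lemma L1norm_shift:
  assumes "h \<in> borel_measurable borel"
  shows "L1norm (\<lambda>x. h (x + c)) = L1norm h"
  unfolding L1norm_def using nn_integral_lborel_shift[of "\<lambda>x. ennreal \<bar>h x\<bar>" c] assms by simp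

section \<open>Approximation by Lipschitz functions of compact support\<close>

text \<open>Extension by zero is built in: Lipschitz on the whole space, zero off a compact subset
  of \<Omega>. The class is dense in L^1, contains the test functions and is invariant under the
  flow.\<close>

definition lip_compact :: "'a::euclidean_space set \<Rightarrow> ('a \<Rightarrow> real) \<Rightarrow> bool" where
  "lip_compact \<Omega> v \<longleftrightarrow> (\<exists>L. L-lipschitz_on UNIV v) \<and> (\<exists>S. compact S \<and> S \<subseteq> \<Omega> \<and> (\<forall>x. x \<notin> S \<longrightarrow> v x = 0))"

lemma lip_compact_continuous: "lip_compact \<Omega> v \<Longrightarrow> continuous_on UNIV v"
  by (auto simp: lip_compact_def intro: lipschitz_on_continuous_on)

lemma lip_compact_measurable: "lip_compact \<Omega> v \<Longrightarrow> v \<in> borel_measurable borel"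
  by (intro borel_measurable_continuous_onI lip_compact_continuous)

lemma lip_compact_integrable:
  assumes "lip_compact \<Omega> v"
  shows "integrable lborel v"
  using assms integrable_continuous_compact_support[OF lip_compact_continuous[OF assms]]
  unfolding lip_compact_def by blast

lemma lip_compact_zero: "lip_compact \<Omega> (\<lambda>x. 0)"
  unfolding lip_compact_def by (intro conjI exI[of _ 0] exI[of _ "{}"]) (auto intro!: lipschitz_onI)

lemma lip_compact_cmult:
  assumes "lip_compact \<Omega> v" shows "lip_compact \<Omega> (\<lambda>x. c * v x)"
proof -
  obtain L S where "L-lipschitz_on UNIV v" "compact S" "S \<subseteq> \<Omega>" "\<forall>x. x \<notin> S \<longrightarrow> v x = 0"
    using assms unfolding lip_compact_def by blast
  then show ?thesis unfolding lip_compact_def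
    by (intro conjI exI[of _ "\<bar>c\<bar> * L"] exI[of _ S]) (auto intro: lipschitz_on_cmult_real)
qed

lemma lip_compact_add:
  assumes "lip_compact \<Omega> v" "lip_compact \<Omega> w" shows "lip_compact \<Omega> (\<lambda>x. v x + w x)"
proof -
  obtain L S where 1: "L-lipschitz_on UNIV v" "compact S" "S \<subseteq> \<Omega>" "\<forall>x. x \<notin> S \<longrightarrow> v x = 0"
    using assms unfolding lip_compact_def by blast
  obtain L' S' where 2: "L'-lipschitz_on UNIV w" "compact S'" "S' \<subseteq> \<Omega>" "\<forall>x. x \<notin> S' \<longrightarrow> w x = 0"
    using assms unfolding lip_compact_def by blast
  show ?thesis unfolding lip_compact_def
    using 1 2 by (intro conjI exI[of _ "L + L'"] exI[of _ "S \<union> S'"]) (auto intro: lipschitz_on_add)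
qed

text \<open>Regularity of Lebesgue measure gives a compact K in A and an open U around K, each with
  an error of at most \<open>e/2\<close>. A cut-off of the distance to K is 1 on K and 0 off U, so
  it differs from the indicator only on \<open>A - K\<close> and \<open>U - K\<close>.\<close>

lemma lip_compact_near_indicator:
  fixes A \<Omega> :: "'a::euclidean_space set"
  assumes \<Omega>: "open \<Omega>" and A: "A \<in> sets borel" "A \<subseteq> \<Omega>" and fin: "emeasure lborel A < \<infinity>" and e: "0 < (e::real)"
  shows "\<exists>v. lip_compact \<Omega> v \<and> L1norm (\<lambda>x. indicator A x - v x) \<le> ennreal e"
proof -
  \<comment> \<open>Lebesgue measure restricted to A is finite, as inner regularity by compact sets
    requires.\<close>
  let ?M = "density lborel (indicator A)"
  have M: "emeasure ?M B = emeasure lborel (A \<inter> B)" if "B \<in> sets borel" for B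
    using that A by (simp add: emeasure_density flip: indicator_inter_arith)
  have "emeasure ?M A = (SUP K \<in> {K. K \<subseteq> A \<and> compact K}. emeasure ?M K)"
    using A fin M[of UNIV] by (intro inner_regular) auto
  moreover have "{K. K \<subseteq> A \<and> compact K} \<noteq> {}" by blast
  moreover have "emeasure ?M A \<noteq> \<infinity>" using fin M[of A] A by auto
  ultimately obtain K where K: "K \<subseteq> A" "compact K" "emeasure ?M A < emeasure ?M K + ennreal (e/2)"
    using SUP_approx_ennreal[of "e/2" "{K. K \<subseteq> A \<and> compact K}" "emeasure ?M A" "emeasure ?M"] e by auto
  have Kb: "K \<in> sets borel" using K by (simp add: borel_compact)
  have "emeasure lborel A < emeasure lborel K + ennreal (e/2)"
    using K M[of A] M[of K] A Kb by (simp add: Int_absorb1)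
  moreover have Kfin: "emeasure lborel K < \<infinity>" using K(2) by (rule emeasure_compact_finite)
  ultimately have AK: "emeasure lborel (A - K) \<le> ennreal (e/2)"
    using A Kb K(1) by (subst emeasure_Diff) (auto simp: ennreal_minus_le_iff)
  obtain U0 where U0: "open U0" "K \<subseteq> U0" "U0 - K \<in> lmeasurable" "emeasure lebesgue (U0 - K) < ennreal (e/2)"
    using sets_lebesgue_outer_open[of K "e/2"] Kb e by auto
  define U where "U = U0 \<inter> \<Omega>"
  have U: "open U" "K \<subseteq> U" "U \<subseteq> \<Omega>" using U0 \<Omega> K(1) A by (auto simp: U_def)
  have UK: "emeasure lborel (U - K) \<le> ennreal (e/2)"
  proof -
    have "emeasure lborel (U - K) \<le> emeasure lborel (U0 - K)" using U0 Kb by (intro emeasure_mono) (auto simp: U_def)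
    also have "\<dots> = emeasure lebesgue (U0 - K)" using U0(1) Kb by simp
    finally show ?thesis using U0(4) by simp
  qed
  show ?thesis
  proof (cases "K = {}")
    \<comment> \<open>\<open>infdist\<close> to the empty set is 0 by convention, so the formula for
      v below would give the constant 1; here the zero function is close enough.\<close>
    case True
    have "L1norm (\<lambda>x. indicator A x - 0) = emeasure lborel A"
      unfolding L1norm_def using A by (simp add: ennreal_indicator flip: nn_integral_indicator)
    also have "\<dots> \<le> ennreal e" using AK True e by (simp add: order_trans[OF _ ennreal_leI[of "e/2" e]])
    finally show ?thesis using lip_compact_zero[of \<Omega>] by (intro exI[of _ "\<lambda>_. 0"]) auto
  next
    case False
    obtain d where d: "d > 0" "(\<Union>x\<in>K. cball x d) \<subseteq> U"
      using compact_subset_open_imp_cball_epsilon_subset[OF K(2) U(1,2)] by metis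
    define v where "v x = max 0 (1 - infdist x K / d)" for x
    define S where "S = {x + y | x y. x \<in> K \<and> y \<in> cball 0 d}"
    have S: "compact S" unfolding S_def by (intro compact_sums K compact_cball)
    have SU: "S \<subseteq> U"
    proof
      fix z assume "z \<in> S"
      then obtain x y where "x \<in> K" "norm y \<le> d" "z = x + y" by (auto simp: S_def)
      then have "z \<in> (\<Union>x\<in>K. cball x d)" by (auto simp: dist_norm intro!: bexI[of _ x])
      then show "z \<in> U" using d(2) by blast
    qed
    have v0: "v x = 0" if "x \<notin> S" for x
    proof -
      obtain y where y: "y \<in> K" "infdist x K = dist x y"
        using infdist_attains_inf[OF compact_imp_closed[OF K(2)] False] by metis
      have "\<not> dist x y \<le> d"
      proof
        assume "dist x y \<le> d"
        then have "x = y + (x - y)" "x - y \<in> cball 0 d" by (auto simp: dist_norm norm_minus_commute)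
        then have "x \<in> S" unfolding S_def using y(1) by blast
        then show False using that by simp
      qed
      then show ?thesis using y d(1) by (simp add: v_def)
    qed
    have "(1/d)-lipschitz_on UNIV v"
    proof (rule lipschitz_onI)
      fix x y
      have "\<bar>v x - v y\<bar> \<le> \<bar>infdist x K / d - infdist y K / d\<bar>" unfolding v_def by (auto simp: max_def)
      also have "\<dots> = \<bar>infdist x K - infdist y K\<bar> / d" using d(1) by (simp flip: diff_divide_distrib)
      also have "\<dots> \<le> dist x y / d" using d(1) infdist_triangle_abs by (intro divide_right_mono) auto
      finally show "dist (v x) (v y) \<le> 1/d * dist x y" by (simp add: dist_real_def)
    qed (use d in auto)
    then have lc: "lip_compact \<Omega> v" unfolding lip_compact_def using S SU U(3) v0 by blast
    have v1: "0 \<le> v x \<and> v x \<le> 1" for x unfolding v_def using d(1) infdist_nonneg[of x K] by auto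
    have vK: "v x = 1" if "x \<in> K" for x using that by (simp add: v_def)
    have "L1norm (\<lambda>x. indicator A x - v x) \<le> (\<integral>\<^sup>+x. indicator (A - K) x + indicator (U - K) x \<partial>lborel)"
      unfolding L1norm_def
    proof (intro nn_integral_mono)
      fix x
      have vU: "x \<notin> U \<Longrightarrow> v x = 0" using v0[of x] SU by blast
      have "\<bar>indicator A x - v x\<bar> \<le> indicator (A - K) x + indicator (U - K) x"
        using v1[of x] vK[of x] vU K(1)
        by (cases "x \<in> K"; cases "x \<in> A"; cases "x \<in> U") (auto simp: indicator_def)
      then have "ennreal \<bar>indicator A x - v x\<bar> \<le> ennreal (indicator (A - K) x + indicator (U - K) x)" by (rule ennreal_leI)
      then show "ennreal \<bar>indicator A x - v x\<bar> \<le> indicator (A - K) x + indicator (U - K) x"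
        by (simp add: ennreal_indicator)
    qed
    also have "\<dots> = emeasure lborel (A - K) + emeasure lborel (U - K)"
      using A Kb borel_open[OF U(1)] by (subst nn_integral_add) auto
    also have "\<dots> \<le> ennreal (e/2) + ennreal (e/2)" using AK UK by (intro add_mono)
    also have "\<dots> = ennreal e" using e by (simp flip: ennreal_plus)
    finally show ?thesis using lc by blast
  qed
qed

text \<open>Induction over integrable functions. The functions met in the induction need not vanish
  off \<Omega>, so the claim that is proved inductively carries the factor
  \<open>indicator \<Omega>\<close>.\<close>

lemma lip_compact_dense:
  fixes f :: "'a::euclidean_space \<Rightarrow> real"
  assumes \<Omega>: "open \<Omega>" and f: "integrable lborel f" and f0: "\<And>x. x \<notin> \<Omega> \<Longrightarrow> f x = 0" and e: "0 < (e::real)"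
  shows "\<exists>v. lip_compact \<Omega> v \<and> L1norm (\<lambda>x. f x - v x) \<le> ennreal e"
proof -
  have [measurable]: "\<Omega> \<in> sets borel" using \<Omega> by simp
  let ?P = "\<lambda>f. \<forall>e>0. \<exists>v. lip_compact \<Omega> v \<and> L1norm (\<lambda>x. indicator \<Omega> x * f x - v x) \<le> ennreal e"
  from f have "?P f"
  proof (induction rule: integrable_induct)
    case (base A c)
    show ?case
    proof (intro allI impI)
      fix e :: real assume e: "e > 0"
      define e' where "e' = e / (\<bar>c\<bar> + 1)"
      have e': "e' > 0" using e by (simp add: e'_def)
      have "emeasure lborel (A \<inter> \<Omega>) \<le> emeasure lborel A" using base by (intro emeasure_mono) auto
      then have "emeasure lborel (A \<inter> \<Omega>) < \<infinity>" using base(2) by (rule le_less_trans)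
      then obtain v where v: "lip_compact \<Omega> v" "L1norm (\<lambda>x. indicator (A \<inter> \<Omega>) x - v x) \<le> ennreal e'"
        using lip_compact_near_indicator[OF \<Omega>, of "A \<inter> \<Omega>" e'] base(1) e' by auto
      note [measurable] = lip_compact_measurable[OF v(1)] base(1)[simplified]
      have "L1norm (\<lambda>x. indicator \<Omega> x * (indicator A x *\<^sub>R c) - c * v x) = L1norm (\<lambda>x. c * (indicator (A \<inter> \<Omega>) x - v x))"
        by (intro arg_cong[where f=L1norm]) (auto simp: indicator_def fun_eq_iff right_diff_distrib)
      also have "\<dots> = ennreal \<bar>c\<bar> * L1norm (\<lambda>x. indicator (A \<inter> \<Omega>) x - v x)"
        by (intro L1norm_cmult) auto
      also have "\<dots> \<le> ennreal \<bar>c\<bar> * ennreal e'" by (intro mult_left_mono v) auto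
      also have "\<dots> = ennreal (\<bar>c\<bar> * e')" using e' by (simp add: ennreal_mult)
      also have "\<dots> \<le> ennreal e" using e by (intro ennreal_leI) (auto simp: e'_def field_simps)
      finally show "\<exists>v. lip_compact \<Omega> v \<and> L1norm (\<lambda>x. indicator \<Omega> x * (indicator A x *\<^sub>R c) - v x) \<le> ennreal e"
        using lip_compact_cmult[OF v(1), of c] by blast
    qed
  next
    case (add f g)
    show ?case
    proof (intro allI impI)
      fix e :: real assume e: "e > 0"
      note [measurable] = add.hyps(1,2)[THEN borel_measurable_integrable, simplified]
      obtain v where v: "lip_compact \<Omega> v" "L1norm (\<lambda>x. indicator \<Omega> x * f x - v x) \<le> ennreal (e/2)"
        using add.IH(1) e by (meson half_gt_zero)
      obtain w where w: "lip_compact \<Omega> w" "L1norm (\<lambda>x. indicator \<Omega> x * g x - w x) \<le> ennreal (e/2)"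
        using add.IH(2) e by (meson half_gt_zero)
      note [measurable] = v(1)[THEN lip_compact_measurable] w(1)[THEN lip_compact_measurable]
      have "L1norm (\<lambda>x. indicator \<Omega> x * (f x + g x) - (v x + w x)) =
        L1norm (\<lambda>x. (indicator \<Omega> x * f x - v x) + (indicator \<Omega> x * g x - w x))"
        by (intro arg_cong[where f=L1norm]) (auto simp: fun_eq_iff algebra_simps)
      also have "\<dots> \<le> L1norm (\<lambda>x. indicator \<Omega> x * f x - v x) + L1norm (\<lambda>x. indicator \<Omega> x * g x - w x)"
        by (intro L1norm_add_le) measurable
      also have "\<dots> \<le> ennreal (e/2) + ennreal (e/2)" by (intro add_mono v w)
      also have "\<dots> = ennreal e" using e by (simp flip: ennreal_plus)
      finally show "\<exists>v. lip_compact \<Omega> v \<and> L1norm (\<lambda>x. indicator \<Omega> x * (f x + g x) - v x) \<le> ennreal e"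
        using lip_compact_add[OF v(1) w(1)] by blast
    qed
  next
    case (lim f s)
    show ?case
    proof (intro allI impI)
      fix e :: real assume e: "e > 0"
      note [measurable] = lim.hyps(1,4)[THEN borel_measurable_integrable, simplified]
      have "(\<lambda>i. \<integral>\<^sup>+x. ennreal (norm (f x - s i x)) \<partial>lborel) \<longlonglongrightarrow> 0"
      proof (rule nn_integral_dominated_convergence_norm[where w="\<lambda>x. 2 * norm (f x)"])
        show "(\<integral>\<^sup>+x. ennreal (2 * norm (f x)) \<partial>lborel) < \<infinity>"
          using nn_integral_eq_integral[OF integrable_mult_right[OF integrable_norm[OF lim.hyps(4)], of 2]] by simp
      qed (use lim.hyps(2,3) in auto)
      then obtain i where i: "L1norm (\<lambda>x. f x - s i x) < ennreal (e/2)"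
        using order_tendstoD(2)[of _ 0 sequentially "ennreal (e/2)"] e by (auto simp: L1norm_def eventually_sequentially)
      obtain v where v: "lip_compact \<Omega> v" "L1norm (\<lambda>x. indicator \<Omega> x * s i x - v x) \<le> ennreal (e/2)"
        using lim.IH[of i] e by (meson half_gt_zero)
      note [measurable] = v(1)[THEN lip_compact_measurable]
      have "L1norm (\<lambda>x. indicator \<Omega> x * f x - v x) \<le>
        L1norm (\<lambda>x. indicator \<Omega> x * f x - indicator \<Omega> x * s i x) + L1norm (\<lambda>x. indicator \<Omega> x * s i x - v x)"
        by (intro L1norm_triangle) measurable
      also have "\<dots> \<le> ennreal (e/2) + ennreal (e/2)"
        using i by (intro add_mono v order_trans[OF L1norm_mono less_imp_le]) (auto simp: indicator_def)
      also have "\<dots> = ennreal e" using e by (simp flip: ennreal_plus)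
      finally show "\<exists>v. lip_compact \<Omega> v \<and> L1norm (\<lambda>x. indicator \<Omega> x * f x - v x) \<le> ennreal e"
        using v(1) by blast
    qed
  qed
  moreover have "indicator \<Omega> x * f x = f x" for x using f0[of x] by (cases "x \<in> \<Omega>") auto
  ultimately show ?thesis using e by simp
qed

text \<open>For a Lipschitz v with compact support, a shift by w changes values by at most a
  multiple of |w|, on a fixed compact set as long as |w| is at most 1. Density transfers this to f,
  because shifting preserves the L^1 norm of f - v.\<close>

lemma L1norm_shift_continuous:
  fixes f :: "'a::euclidean_space \<Rightarrow> real"
  assumes f: "integrable lborel f" and e: "0 < (e::real)"
  shows "\<exists>\<delta>>0. \<forall>w. norm w \<le> \<delta> \<longrightarrow> L1norm (\<lambda>x. f (x + w) - f x) \<le> ennreal e"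
proof -
  obtain v where v: "lip_compact UNIV v" "L1norm (\<lambda>x. f x - v x) \<le> ennreal (e/3)"
    using lip_compact_dense[OF open_UNIV f, of "e/3"] e by auto
  obtain L S where L: "L-lipschitz_on UNIV v" and S: "compact S" "\<forall>x. x \<notin> S \<longrightarrow> v x = 0"
    using v(1) unfolding lip_compact_def by blast
  note [measurable] = lip_compact_measurable[OF v(1)] borel_measurable_integrable[OF f, simplified]
  define S' where "S' = {x + y |x y. x \<in> S \<and> y \<in> cball (0::'a) 1}"
  have cS': "compact S'" unfolding S'_def by (intro compact_sums S compact_cball)
  have [measurable]: "S' \<in> sets borel" using cS' by (simp add: borel_compact)
  define m where "m = measure lborel S'"
  have m: "emeasure lborel S' = ennreal m" "0 \<le> m"
    using emeasure_compact_finite[OF cS'] unfolding m_def by (auto simp: emeasure_eq_ennreal_measure)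
  have L0: "0 \<le> L" using L by (rule lipschitz_on_nonneg)
  define \<delta> where "\<delta> = min 1 (e / (3 * (L * m + 1)))"
  have \<delta>: "\<delta> > 0" using e L0 m by (auto simp: \<delta>_def intro!: divide_pos_pos add_nonneg_pos)
  show ?thesis
  proof (intro exI[of _ \<delta>] conjI allI impI \<delta>)
    fix w :: 'a assume w: "norm w \<le> \<delta>"
    have A: "L1norm (\<lambda>x. v (x + w) - v x) \<le> ennreal (e/3)"
    proof -
      have "\<bar>v (x + w) - v x\<bar> \<le> (L * norm w) * indicator S' x" for x
      proof (cases "x \<in> S'")
        case True
        then show ?thesis using lipschitz_onD[OF L, of "x+w" x] by (simp add: dist_norm)
      next
        case False
        have "norm w \<le> 1" using w by (simp add: \<delta>_def)
        have "x \<notin> S" "x + w \<notin> S"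
        proof -
          show "x \<notin> S"
          proof
            assume "x \<in> S"
            moreover have "x = x + 0" "0 \<in> cball (0::'a) 1" by auto
            ultimately have "x \<in> S'" unfolding S'_def by blast
            then show False using False by simp
          qed
          show "x + w \<notin> S"
          proof
            assume "x + w \<in> S"
            moreover have "x = (x + w) + (- w)" "- w \<in> cball 0 1" using \<open>norm w \<le> 1\<close> by auto
            ultimately have "x \<in> S'" unfolding S'_def by blast
            then show False using False by simp
          qed
        qed
        then show ?thesis using S(2) False by simp
      qed
      then have "L1norm (\<lambda>x. v (x + w) - v x) \<le> (\<integral>\<^sup>+x. ennreal (L * norm w) * indicator S' x \<partial>lborel)"
        unfolding L1norm_def using L0
        by (intro nn_integral_mono) (auto simp flip: ennreal_mult' ennreal_indicator intro!: ennreal_leI)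
      also have "\<dots> = ennreal (L * norm w * m)" using m L0 by (simp add: nn_integral_cmult ennreal_mult')
      also have "\<dots> \<le> ennreal (e/3)"
      proof (rule ennreal_leI)
        have "L * norm w * m \<le> L * m * (e / (3 * (L * m + 1)))"
        proof -
          have "norm w \<le> e / (3 * (L * m + 1))" using w by (simp add: \<delta>_def)
          then have "(L * m) * norm w \<le> (L * m) * (e / (3 * (L * m + 1)))" using L0 m by (intro mult_left_mono) auto
          then show ?thesis by (simp add: mult_ac)
        qed
        also have "\<dots> \<le> (L * m + 1) * (e / (3 * (L * m + 1)))" using e L0 m by (intro mult_right_mono) auto
        also have "\<dots> = e / 3"
        proof -
          have "L * m + 1 > 0" using L0 m by (simp add: add_nonneg_pos)
          then show ?thesis by (simp add: field_simps)
        qed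
        finally show "L * norm w * m \<le> e/3" .
      qed
      finally show ?thesis .
    qed
    have "L1norm (\<lambda>x. f (x + w) - f x) \<le> L1norm (\<lambda>x. f (x + w) - v (x + w)) + L1norm (\<lambda>x. v (x + w) - f x)"
      by (intro L1norm_triangle) measurable
    also have "L1norm (\<lambda>x. v (x + w) - f x) \<le> L1norm (\<lambda>x. v (x + w) - v x) + L1norm (\<lambda>x. v x - f x)"
      by (intro L1norm_triangle) measurable
    also have "L1norm (\<lambda>x. f (x + w) - v (x + w)) = L1norm (\<lambda>x. f x - v x)"
      using L1norm_shift[of "\<lambda>x. f x - v x" w] by simp
    also have "L1norm (\<lambda>x. v x - f x) = L1norm (\<lambda>x. f x - v x)" by (rule L1norm_minus_commute)
    also have "L1norm (\<lambda>x. f x - v x) + (L1norm (\<lambda>x. v (x + w) - v x) + L1norm (\<lambda>x. f x - v x))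
      \<le> ennreal (e/3) + (ennreal (e/3) + ennreal (e/3))" by (intro add_mono v A)
    also have "\<dots> = ennreal e" using e by (simp flip: ennreal_plus)
    finally show "L1norm (\<lambda>x. f (x + w) - f x) \<le> ennreal e" by (simp add: add_left_mono)
  qed
qed

section \<open>Mollification\<close>

text \<open>For k = 0 this is the classical flat function. Its derivatives produce powers of
  \<open>inverse s\<close>; with the exponent k the linear span of the family is stable under
  differentiation.\<close>

definition flat_exp :: "nat \<Rightarrow> real \<Rightarrow> real" where
  "flat_exp k s = (if s \<le> 0 then 0 else exp (- inverse s) * inverse s ^ k)"

lemma flat_exp_has_derivative:
  "(flat_exp k has_field_derivative (flat_exp (k + 2) s - of_nat k * flat_exp (k + 1) s)) (at s)"
proof (cases s "0::real" rule: linorder_cases)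
  case less
  have "((\<lambda>_. 0) has_field_derivative (flat_exp (k + 2) s - of_nat k * flat_exp (k + 1) s)) (at s)"
    using less by (simp add: flat_exp_def)
  then show ?thesis
    by (rule has_field_derivative_transform_within_open[of _ _ _ "{..<0}"]) (use less in \<open>auto simp: flat_exp_def\<close>)
next
  case greater
  have "((\<lambda>s. exp (- inverse s)) has_field_derivative exp (- inverse s) * inverse s ^ 2) (at s)"
    using greater by (auto intro!: derivative_eq_intros simp: power2_eq_square)
  moreover have "(inverse has_field_derivative - (inverse s ^ 2)) (at s)"
    using greater by (auto intro!: derivative_eq_intros simp: power2_eq_square)
  ultimately have "((\<lambda>s. exp (- inverse s) * inverse s ^ k) has_field_derivative
      exp (- inverse s) * inverse s ^ 2 * inverse s ^ k +
      of_nat k * (- (inverse s ^ 2) * inverse s ^ (k - Suc 0)) * exp (- inverse s)) (at s)"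
    by (intro DERIV_mult DERIV_power)
  also have "exp (- inverse s) * inverse s ^ 2 * inverse s ^ k +
      of_nat k * (- (inverse s ^ 2) * inverse s ^ (k - Suc 0)) * exp (- inverse s) =
      flat_exp (k + 2) s - of_nat k * flat_exp (k + 1) s"
    using greater by (cases k) (simp_all add: flat_exp_def power2_eq_square algebra_simps)
  finally have "((\<lambda>s. exp (- inverse s) * inverse s ^ k) has_field_derivative
      (flat_exp (k + 2) s - of_nat k * flat_exp (k + 1) s)) (at s)" .
  then show ?thesis
    by (rule has_field_derivative_transform_within_open[of _ _ _ "{0<..}"]) (use greater in \<open>auto simp: flat_exp_def\<close>)
next
  case equal
  have "((\<lambda>h. flat_exp k h / h) \<longlongrightarrow> 0) (at_left 0)"
    by (rule tendsto_eventually) (auto simp: eventually_at_filter flat_exp_def)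
  \<comment> \<open>With y = 1/h the quotient is y^(k+1) / exp y, and the exponential wins.\<close>
  moreover have "((\<lambda>h. flat_exp k h / h) \<longlongrightarrow> 0) (at_right 0)"
  proof (rule Lim_transform_eventually)
    show "((\<lambda>h::real. inverse h ^ (k+1) / exp (inverse h)) \<longlongrightarrow> 0) (at_right 0)"
      by (rule filterlim_compose[OF tendsto_power_div_exp_0 filterlim_inverse_at_top_right])
    show "\<forall>\<^sub>F h in at_right 0. inverse h ^ (k+1) / exp (inverse h) = flat_exp k h / h"
      by (auto simp: eventually_at_filter flat_exp_def exp_minus field_simps)
  qed
  ultimately have "((\<lambda>h. flat_exp k h / h) \<longlongrightarrow> 0) (at 0)" by (simp add: filterlim_split_at)
  then show ?thesis using equal by (simp add: has_field_derivative_iff flat_exp_def)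
qed

text \<open>The point of this class is that it is closed under partial derivatives.\<close>

inductive smooth_expr :: "(real^'n \<Rightarrow> real) \<Rightarrow> bool" where
  const: "smooth_expr (\<lambda>x. c)"
| coord: "smooth_expr (\<lambda>x. x $ i)"
| add: "smooth_expr u \<Longrightarrow> smooth_expr v \<Longrightarrow> smooth_expr (\<lambda>x. u x + v x)"
| mult: "smooth_expr u \<Longrightarrow> smooth_expr v \<Longrightarrow> smooth_expr (\<lambda>x. u x * v x)"
| flat: "smooth_expr u \<Longrightarrow> smooth_expr (\<lambda>x. flat_exp k (u x))"

lemma smooth_expr_sum:
  "finite I \<Longrightarrow> (\<And>i. i \<in> I \<Longrightarrow> smooth_expr (f i)) \<Longrightarrow> smooth_expr (\<lambda>x. \<Sum>i\<in>I. f i x)"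
proof (induction I rule: finite_induct)
  case empty
  then show ?case using smooth_expr.const[of 0] by simp
next
  case (insert j I)
  then show ?case using smooth_expr.add[of "f j" "\<lambda>x. \<Sum>i\<in>I. f i x"] by simp
qed

lemma smooth_expr_has_partial:
  fixes u :: "real^'n \<Rightarrow> real"
  assumes "smooth_expr u"
  shows "\<exists>u'. smooth_expr u' \<and> (\<forall>x. ((\<lambda>h. u (x + h *\<^sub>R axis i 1)) has_field_derivative u' x) (at 0))"
  using assms
proof induction
  case (const c)
  then show ?case by (intro exI[of _ "\<lambda>_. 0"]) (auto intro: smooth_expr.const)
next
  case (coord j)
  have "((\<lambda>h. x $ j + h * (axis i 1 :: real^'n) $ j) has_field_derivative (axis i 1 :: real^'n) $ j) (at 0)" for x :: "real^'n"
    by (auto intro!: derivative_eq_intros)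
  then show ?case by (intro exI[of _ "\<lambda>_. (axis i 1 :: real^'n) $ j"]) (auto intro: smooth_expr.const)
next
  case (add u v)
  then obtain u' v' where "smooth_expr u'" "smooth_expr v'"
    "\<And>x. ((\<lambda>h. u (x + h *\<^sub>R axis i 1)) has_field_derivative u' x) (at 0)"
    "\<And>x. ((\<lambda>h. v (x + h *\<^sub>R axis i 1)) has_field_derivative v' x) (at 0)" by metis
  then show ?case
    by (intro exI[of _ "\<lambda>x. u' x + v' x"]) (auto intro: smooth_expr.intros DERIV_add)
next
  case (mult u v)
  then obtain u' v' where *: "smooth_expr u'" "smooth_expr v'"
    "\<And>x. ((\<lambda>h. u (x + h *\<^sub>R axis i 1)) has_field_derivative u' x) (at 0)"
    "\<And>x. ((\<lambda>h. v (x + h *\<^sub>R axis i 1)) has_field_derivative v' x) (at 0)" by metis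
  have "((\<lambda>h. u (x + h *\<^sub>R axis i 1) * v (x + h *\<^sub>R axis i 1)) has_field_derivative u' x * v x + v' x * u x) (at 0)" for x
    using DERIV_mult[OF *(3)[of x] *(4)[of x]] by simp
  then show ?case using *(1,2) mult(1,2)
    by (intro exI[of _ "\<lambda>x. u' x * v x + v' x * u x"]) (auto intro: smooth_expr.intros)
next
  case (flat u k)
  then obtain u' where *: "smooth_expr u'"
    "\<And>x. ((\<lambda>h. u (x + h *\<^sub>R axis i 1)) has_field_derivative u' x) (at 0)" by metis
  let ?w = "\<lambda>x. (flat_exp (k + 2) (u x) + (- of_nat k) * flat_exp (k + 1) (u x)) * u' x"
  have "((\<lambda>h. flat_exp k (u (x + h *\<^sub>R axis i 1))) has_field_derivative ?w x) (at 0)" for x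
    using DERIV_chain2[OF flat_exp_has_derivative *(2)[of x]] by simp
  moreover have "smooth_expr ?w" by (intro smooth_expr.intros flat *)
  ultimately show ?case by blast
qed

lemma smooth_expr_differentiable:
  fixes u :: "real^'n \<Rightarrow> real"
  assumes "smooth_expr u"
  shows "u differentiable (at x)"
  using assms
proof induction
  case (coord i)
  then show ?case by (auto intro: bounded_linear_imp_differentiable bounded_linear_vec_nth)
next
  case (flat u k)
  have "flat_exp k differentiable (at (u x))"
    using flat_exp_has_derivative[of k "u x"] by (auto simp: has_field_derivative_def differentiable_def)
  from differentiable_chain_at[OF flat(2) this] show ?case by (simp add: o_def)
qed auto

lemma smooth_expr_partial_deriv: "smooth_expr u \<Longrightarrow> smooth_expr (partial_deriv i u)"
proof -
  assume "smooth_expr u"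
  then obtain u' where u': "smooth_expr u'" "\<And>x. ((\<lambda>h. u (x + h *\<^sub>R axis i 1)) has_field_derivative u' x) (at 0)"
    using smooth_expr_has_partial by blast
  have "partial_deriv i u = u'" by (rule ext) (simp add: partial_deriv_def DERIV_imp_deriv[OF u'(2)])
  then show ?thesis using u'(1) by simp
qed

lemma smooth_expr_continuous: "smooth_expr u \<Longrightarrow> continuous_on UNIV u"
  by (simp add: continuous_on_eq_continuous_at differentiable_imp_continuous_within smooth_expr_differentiable)

lemma smooth_expr_C_k: "smooth_expr u \<Longrightarrow> C_k k u"
  by (induction k arbitrary: u) (auto intro: smooth_expr_continuous smooth_expr_differentiable smooth_expr_partial_deriv)

section \<open>Partial derivatives and Lipschitz bounds for smooth functions\<close>

lemma partial_deriv_eq_dir_deriv: "partial_deriv i u = dir_deriv u (axis i 1)"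
  by (simp add: partial_deriv_def dir_deriv_def fun_eq_iff)

lemma has_derivative_dir_deriv:
  assumes "(u has_derivative D) (at x)"
  shows "((\<lambda>h. u (x + h *\<^sub>R e)) has_field_derivative D e) (at 0)" and "dir_deriv u e x = D e"
proof -
  have "((\<lambda>h. u (x + h *\<^sub>R e)) has_derivative (\<lambda>h. D (h *\<^sub>R e))) (at 0)"
    by (rule has_derivative_compose[of "\<lambda>h. x + h *\<^sub>R e" "\<lambda>h. h *\<^sub>R e" 0 UNIV u D, simplified])
       (use assms in \<open>auto intro!: derivative_eq_intros\<close>)
  moreover have "(\<lambda>h. D (h *\<^sub>R e)) = (*) (D e)"
    using linear_cmul[OF has_derivative_linear[OF assms]] by (auto simp: fun_eq_iff)
  ultimately show 1: "((\<lambda>h. u (x + h *\<^sub>R e)) has_field_derivative D e) (at 0)" by (simp add: has_field_derivative_def)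
  then show "dir_deriv u e x = D e" unfolding dir_deriv_def by (rule DERIV_imp_deriv)
qed

lemma has_derivative_partial_derivs:
  fixes u :: "real^'n \<Rightarrow> real"
  assumes "u differentiable (at x)"
  shows "(u has_derivative (\<lambda>h. \<Sum>i\<in>UNIV. h $ i * partial_deriv i u x)) (at x)"
proof -
  obtain D where D: "(u has_derivative D) (at x)" using assms by (auto simp: differentiable_def)
  interpret D: linear D using D by (rule has_derivative_linear)
  have "D h = (\<Sum>i\<in>UNIV. h $ i * partial_deriv i u x)" for h
  proof -
    have "D h = D (\<Sum>i\<in>UNIV. h $ i *s axis i 1)" by (simp only: basis_expansion)
    also have "\<dots> = (\<Sum>i\<in>UNIV. h $ i * D (axis i 1))"
      by (simp add: D.sum scalar_mult_eq_scaleR D.scale)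
    finally show ?thesis by (simp add: partial_deriv_eq_dir_deriv has_derivative_dir_deriv(2)[OF D])
  qed
  then have "D = (\<lambda>h. \<Sum>i\<in>UNIV. h $ i * partial_deriv i u x)" by (rule ext)
  then show ?thesis using D by simp
qed

lemma dir_deriv_differentiable:
  fixes u :: "real^'n \<Rightarrow> real"
  assumes "u differentiable (at x)"
  shows "dir_deriv u e x = (\<Sum>i\<in>UNIV. e $ i * partial_deriv i u x)"
  by (rule has_derivative_dir_deriv(2)[OF has_derivative_partial_derivs[OF assms]])

lemma partial_deriv_zero_off:
  fixes u :: "real^'n \<Rightarrow> real"
  assumes S: "closed S" "\<And>x. x \<notin> S \<Longrightarrow> u x = 0" and x: "x \<notin> S"
  shows "partial_deriv i u x = 0"
proof -
  have op: "open ((\<lambda>h::real. x + h *\<^sub>R axis i 1) -` (- S))"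
    using S(1) by (intro continuous_open_vimage) (auto intro!: continuous_intros)
  have "((\<lambda>h. u (x + h *\<^sub>R axis i 1)) has_field_derivative 0) (at 0)"
    by (rule has_field_derivative_transform_within_open[OF DERIV_const op]) (use x S in auto)
  then show ?thesis unfolding partial_deriv_def by (rule DERIV_imp_deriv)
qed

lemma C1_compact_support_lipschitz:
  fixes u :: "real^'n \<Rightarrow> real"
  assumes C: "C_k 1 u" and S: "compact S" "\<And>x. x \<notin> S \<Longrightarrow> u x = 0"
  shows "\<exists>K. K-lipschitz_on UNIV u"
proof -
  have d: "u differentiable (at x)" and c: "continuous_on UNIV (partial_deriv i u)" for x i
    using C by auto
  have "\<exists>M. \<forall>x. \<bar>partial_deriv i u x\<bar> \<le> M" for i
  proof -
    have "bounded (partial_deriv i u ` S)"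
      by (intro compact_imp_bounded compact_continuous_image continuous_on_subset[OF c] S) auto
    then obtain M where M: "\<And>x. x \<in> S \<Longrightarrow> \<bar>partial_deriv i u x\<bar> \<le> M" by (auto simp: bounded_iff)
    have "\<bar>partial_deriv i u x\<bar> \<le> max M 0" for x
      using M[of x] partial_deriv_zero_off[where S=S and u=u and x=x and i=i, OF compact_imp_closed[OF S(1)] S(2)] by (cases "x \<in> S") auto
    then show ?thesis by blast
  qed
  then obtain M where M: "\<And>i x. \<bar>partial_deriv i u x\<bar> \<le> M i" by metis
  have M0: "0 \<le> M i" for i using M[of i 0] by linarith
  define K where "K = (\<Sum>i\<in>UNIV. M i)"
  have "K-lipschitz_on UNIV u"
  proof (rule bounded_derivative_imp_lipschitz)
    show "(u has_derivative (\<lambda>h. \<Sum>i\<in>UNIV. h $ i * partial_deriv i u x)) (at x within UNIV)" for x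
      using has_derivative_partial_derivs[OF d] by simp
    show "onorm (\<lambda>h::real^'n. \<Sum>i\<in>UNIV. h $ i * partial_deriv i u x) \<le> K" for x
    proof (rule onorm_le)
      fix h :: "real^'n"
      have "norm (\<Sum>i\<in>UNIV. h $ i * partial_deriv i u x) \<le> (\<Sum>i\<in>UNIV. norm h * M i)"
        using M M0 by (intro sum_norm_le) (auto simp: abs_mult intro!: mult_mono component_le_norm_cart)
      then show "norm (\<Sum>i\<in>UNIV. h $ i * partial_deriv i u x) \<le> K * norm h"
        by (simp add: K_def sum_distrib_left mult.commute)
    qed
    show "0 \<le> K" unfolding K_def using M0 by (intro sum_nonneg) auto
  qed auto
  then show ?thesis by blast
qed

section \<open>Integrals under reflection, scaling and convolution\<close>

lemma distr_lborel_reflect: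
  "distr lborel borel (\<lambda>y. x - y) = (lborel :: 'a::euclidean_space measure)"
proof -
  have "(lborel :: 'a measure) = density (distr lborel borel (\<lambda>y. x + (-1) *\<^sub>R y)) (\<lambda>_. ennreal (\<bar>-1\<bar>^DIM('a)))"
    by (rule lborel_affine) simp
  then show ?thesis by (simp add: density_1)
qed

lemma nn_integral_lborel_reflect:
  assumes [measurable]: "h \<in> borel_measurable borel"
  shows "(\<integral>\<^sup>+y. h (x - y) \<partial>lborel) = (\<integral>\<^sup>+y. h (y::'a::euclidean_space) \<partial>lborel)"
proof -
  have "(\<integral>\<^sup>+y. h y \<partial>lborel) = (\<integral>\<^sup>+y. h y \<partial>distr lborel borel (\<lambda>y. x - y))" by (simp only: distr_lborel_reflect)
  also have "\<dots> = (\<integral>\<^sup>+y. h (x - y) \<partial>lborel)" by (intro nn_integral_distr) auto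
  finally show ?thesis ..
qed

lemma nn_integral_lborel_scale:
  fixes h :: "'a::euclidean_space \<Rightarrow> ennreal"
  assumes [measurable]: "h \<in> borel_measurable borel" and c: "0 < c"
  shows "(\<integral>\<^sup>+x. h ((1/c) *\<^sub>R x) \<partial>lborel) = ennreal (c ^ DIM('a)) * (\<integral>\<^sup>+x. h x \<partial>lborel)"
proof -
  have "(\<integral>\<^sup>+x. h ((1/c) *\<^sub>R x) \<partial>lborel) =
      (\<integral>\<^sup>+x. h ((1/c) *\<^sub>R x) \<partial>density (distr lborel borel (\<lambda>y. 0 + c *\<^sub>R y)) (\<lambda>_. ennreal (\<bar>c\<bar>^DIM('a))))"
    using c by (subst lborel_affine[of c 0]) auto
  also have "\<dots> = (\<integral>\<^sup>+x. ennreal (c^DIM('a)) * h x \<partial>lborel)"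
    using c by (simp add: nn_integral_density nn_integral_distr)
  also have "\<dots> = ennreal (c ^ DIM('a)) * (\<integral>\<^sup>+x. h x \<partial>lborel)" by (intro nn_integral_cmult) auto
  finally show ?thesis .
qed

text \<open>A form of Young's inequality for increments: substituting y = x - w and exchanging the
  integrals leaves, for each w, the L^1 size of a shift of f with weight \<open>M w\<close>. It is
  applied to the mollifier, of mass 1, and to the commutator kernel, whose mass stays bounded as
  \<epsilon> tends to 0.\<close>

lemma nn_integral_kernel_le:
  fixes f :: "'a::euclidean_space \<Rightarrow> real" and M :: "'a \<Rightarrow> ennreal"
  assumes [measurable]: "f \<in> borel_measurable borel" "M \<in> borel_measurable borel"
    and M: "\<And>w. \<epsilon> < norm w \<Longrightarrow> M w = 0"
    and B: "\<And>w. norm w \<le> \<epsilon> \<Longrightarrow> L1norm (\<lambda>x. f (x + w) - f x) \<le> B"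
  shows "(\<integral>\<^sup>+x. (\<integral>\<^sup>+y. ennreal \<bar>f y - f x\<bar> * M (x - y) \<partial>lborel) \<partial>lborel) \<le> (\<integral>\<^sup>+w. M w \<partial>lborel) * B"
proof -
  have "(\<integral>\<^sup>+x. (\<integral>\<^sup>+y. ennreal \<bar>f y - f x\<bar> * M (x - y) \<partial>lborel) \<partial>lborel) =
        (\<integral>\<^sup>+x. (\<integral>\<^sup>+w. ennreal \<bar>f (x - w) - f x\<bar> * M w \<partial>lborel) \<partial>lborel)"
  proof (rule nn_integral_cong)
    fix x
    show "(\<integral>\<^sup>+y. ennreal \<bar>f y - f x\<bar> * M (x - y) \<partial>lborel) = (\<integral>\<^sup>+w. ennreal \<bar>f (x - w) - f x\<bar> * M w \<partial>lborel)"
      using nn_integral_lborel_reflect[of "\<lambda>w. ennreal \<bar>f (x - w) - f x\<bar> * M w" x] by simp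
  qed
  also have "\<dots> = (\<integral>\<^sup>+w. (\<integral>\<^sup>+x. ennreal \<bar>f (x - w) - f x\<bar> * M w \<partial>lborel) \<partial>lborel)"
    by (rule lborel_pair.Fubini') measurable
  also have "\<dots> \<le> (\<integral>\<^sup>+w. M w * B \<partial>lborel)"
  proof (intro nn_integral_mono)
    fix w
    have "(\<integral>\<^sup>+x. ennreal \<bar>f (x - w) - f x\<bar> * M w \<partial>lborel) = L1norm (\<lambda>x. f (x + (- w)) - f x) * M w"
      unfolding L1norm_def by (simp add: nn_integral_multc)
    also have "\<dots> \<le> M w * B"
    proof (cases "norm w \<le> \<epsilon>")
      case True
      then show ?thesis using B[of "-w"] by (simp add: mult.commute[of _ "M w"] mult_left_mono)
    next
      case False
      then show ?thesis using M[of w] by simp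
    qed
    finally show "(\<integral>\<^sup>+x. ennreal \<bar>f (x - w) - f x\<bar> * M w \<partial>lborel) \<le> M w * B" .
  qed
  also have "\<dots> = (\<integral>\<^sup>+w. M w \<partial>lborel) * B" by (intro nn_integral_multc) auto
  finally show ?thesis .
qed

section \<open>The mollifying kernel and its gradient\<close>

text \<open>The standard bump exp(-1 / (1 - |w|^2)) on the unit ball. The squared norm is a
  polynomial in the coordinates, so the function is a \<open>smooth_expr\<close>.\<close>

definition bump :: "real^'n \<Rightarrow> real" where
  "bump w = flat_exp 0 (1 - (norm w)\<^sup>2)"

text \<open>The affine argument is unfolded into coordinates at once, since the rules of
  \<open>smooth_expr\<close> do not include composition with affine maps. The instances used are the
  bump, the kernel, and the kernel at x - y as a function of y.\<close>

lemma bump_scaled_smooth: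
  "smooth_expr (\<lambda>y. c * bump (a *\<^sub>R (x + b *\<^sub>R y)) :: real)"
proof -
  have eq: "(\<lambda>y. c * bump (a *\<^sub>R (x + b *\<^sub>R y))) =
     (\<lambda>y. c * flat_exp 0 (1 + (-1) * (\<Sum>i\<in>UNIV. (a * (x $ i + b * y $ i)) * (a * (x $ i + b * y $ i)))))"
    unfolding bump_def power2_norm_eq_inner inner_vec_def by (simp add: fun_eq_iff)
  show ?thesis unfolding eq by (intro smooth_expr.intros smooth_expr_sum finite)
qed

lemma bump_smooth: "smooth_expr bump"
  using bump_scaled_smooth[of 1 1 0 1] by simp

lemma bump_nonneg: "0 \<le> bump w" by (simp add: bump_def flat_exp_def)

lemma bump_zero: "1 \<le> norm w \<Longrightarrow> bump w = 0"
  by (simp add: bump_def flat_exp_def power_mono[of 1 "norm w" 2, simplified])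

lemma bump_pos: "norm w < 1 \<Longrightarrow> 0 < bump w"
  using power_strict_mono[of "norm w" 1 2] by (simp add: bump_def flat_exp_def not_le)

lemma bump_measurable[measurable]: "bump \<in> borel_measurable borel"
  by (intro borel_measurable_continuous_onI smooth_expr_continuous bump_smooth)

definition bump_mass :: "'n::finite itself \<Rightarrow> real" where
  "bump_mass _ = (LINT w|lborel. bump (w :: real^'n))"

lemma bump_integrable: "integrable lborel (bump :: real^'n \<Rightarrow> real)"
  by (rule integrable_continuous_compact_support[of _ "cball 0 1"])
     (auto intro: bump_zero smooth_expr_continuous[OF bump_smooth])

lemma bump_mass_pos: "0 < bump_mass TYPE('n::finite)"
proof -
  have ge: "0 \<le> bump_mass TYPE('n)" unfolding bump_mass_def by (simp add: bump_nonneg integral_nonneg)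
  have "bump_mass TYPE('n) \<noteq> 0"
  proof
    assume "bump_mass TYPE('n) = 0"
    then have "AE w in lborel. bump (w :: real^'n) = 0"
      unfolding bump_mass_def
      using integral_nonneg_eq_0_iff_AE[OF bump_integrable[where 'n='n]] by (simp add: bump_nonneg)
    then have "AE w in lborel. (w :: real^'n) \<notin> ball 0 1"
      by eventually_elim (use bump_pos in force)
    then have "ball (0::real^'n) 1 \<in> null_sets lborel" by (simp add: AE_iff_null_sets)
    then show False using negligible_iff_null_sets open_not_negligible[of "ball (0::real^'n) 1"] null_sets_completionI by auto
  qed
  then show ?thesis using ge by simp
qed

text \<open>For positive \<epsilon> the standard mollifier: mass 1, zero at distance \<epsilon> or
  more from the origin.\<close>

definition kern :: "real \<Rightarrow> real^'n \<Rightarrow> real" where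
  "kern \<epsilon> w = 1 / (\<epsilon> ^ CARD('n) * bump_mass TYPE('n)) * bump ((1/\<epsilon>) *\<^sub>R w)"

lemma kern_smooth: "smooth_expr (kern \<epsilon> :: real^'n \<Rightarrow> real)"
  and kern_reflect_smooth: "smooth_expr (\<lambda>y. kern \<epsilon> (x - y :: real^'n))"
  using bump_scaled_smooth[of "1 / (\<epsilon> ^ CARD('n) * bump_mass TYPE('n))" "1/\<epsilon>" 0 1]
    bump_scaled_smooth[of "1 / (\<epsilon> ^ CARD('n) * bump_mass TYPE('n))" "1/\<epsilon>" x "-1"]
  by (simp_all add: kern_def[abs_def])

lemma kern_measurable[measurable]: "kern \<epsilon> \<in> borel_measurable borel"
  by (intro borel_measurable_continuous_onI smooth_expr_continuous kern_smooth)

lemma kern_nonneg: "0 < \<epsilon> \<Longrightarrow> 0 \<le> kern \<epsilon> (w :: real^'n)"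
  using bump_mass_pos[where 'n='n] by (simp add: kern_def bump_nonneg)

lemma kern_zero: "0 < \<epsilon> \<Longrightarrow> \<epsilon> \<le> norm w \<Longrightarrow> kern \<epsilon> w = 0"
  by (simp add: kern_def bump_zero)

lemma nn_integral_kern:
  assumes \<epsilon>: "0 < \<epsilon>"
  shows "(\<integral>\<^sup>+w. ennreal (kern \<epsilon> (w :: real^'n)) \<partial>lborel) = 1"
proof -
  let ?I = "bump_mass TYPE('n)"
  have I: "(\<integral>\<^sup>+w. ennreal (bump (w::real^'n)) \<partial>lborel) = ennreal ?I"
    unfolding bump_mass_def by (intro nn_integral_eq_integral bump_integrable) (simp add: bump_nonneg)
  have "(\<integral>\<^sup>+w. ennreal (kern \<epsilon> (w :: real^'n)) \<partial>lborel) =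
      (\<integral>\<^sup>+w. ennreal (1 / (\<epsilon> ^ CARD('n) * ?I)) * ennreal (bump ((1/\<epsilon>) *\<^sub>R (w :: real^'n))) \<partial>lborel)"
    unfolding kern_def using \<epsilon> bump_mass_pos[where 'n='n]
    by (intro nn_integral_cong ennreal_mult') auto
  also have "\<dots> = ennreal (1 / (\<epsilon> ^ CARD('n) * ?I)) * (ennreal (\<epsilon> ^ CARD('n)) * ennreal ?I)"
    using nn_integral_lborel_scale[of "\<lambda>w::real^'n. ennreal (bump w)" \<epsilon>] \<epsilon>
    by (simp add: nn_integral_cmult I)
  also have "\<dots> = 1"
    using \<epsilon> bump_mass_pos[where 'n='n] by (simp flip: ennreal_mult' ennreal_1)
  finally show ?thesis .
qed

lemma kern_integrable: "0 < \<epsilon> \<Longrightarrow> integrable lborel (kern \<epsilon> :: real^'n \<Rightarrow> real)"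
  using nn_integral_kern[of \<epsilon>, where 'n='n] by (simp add: integrable_iff_bounded kern_nonneg)

lemma integral_kern: "0 < \<epsilon> \<Longrightarrow> (LINT w|lborel. kern \<epsilon> (w :: real^'n)) = 1"
  using nn_integral_kern[of \<epsilon>, where 'n='n] by (subst integral_eq_nn_integral) (auto simp: kern_nonneg)

lemma partial_deriv_kern:
  fixes w :: "real^'n"
  shows "partial_deriv i (kern \<epsilon>) w = 1 / (\<epsilon> ^ CARD('n) * bump_mass TYPE('n)) * (1/\<epsilon>) * partial_deriv i bump ((1/\<epsilon>) *\<^sub>R w)"
proof -
  have "(bump has_derivative (\<lambda>h. \<Sum>j\<in>UNIV. h $ j * partial_deriv j bump ((1/\<epsilon>) *\<^sub>R w))) (at ((1/\<epsilon>) *\<^sub>R w))"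
    by (intro has_derivative_partial_derivs smooth_expr_differentiable bump_smooth)
  from has_derivative_dir_deriv(1)[OF this, of "(1/\<epsilon>) *\<^sub>R axis i 1"]
  have "((\<lambda>h. bump ((1/\<epsilon>) *\<^sub>R (w + h *\<^sub>R axis i 1))) has_field_derivative
     (\<Sum>j\<in>UNIV. ((1/\<epsilon>) *\<^sub>R axis i 1 :: real^'n) $ j * partial_deriv j bump ((1/\<epsilon>) *\<^sub>R w))) (at 0)"
    by (simp add: scaleR_add_right mult.commute)
  also have "(\<Sum>j\<in>UNIV. ((1/\<epsilon>) *\<^sub>R axis i 1 :: real^'n) $ j * partial_deriv j bump ((1/\<epsilon>) *\<^sub>R w)) =
     (1/\<epsilon>) * partial_deriv i bump ((1/\<epsilon>) *\<^sub>R w)"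
    by (simp add: axis_def if_distrib[of "\<lambda>x. x * _"] if_distrib[of "\<lambda>x. _ * x"] cong: if_cong)
  finally have *: "((\<lambda>h. bump ((1/\<epsilon>) *\<^sub>R (w + h *\<^sub>R axis i 1))) has_field_derivative
     (1/\<epsilon>) * partial_deriv i bump ((1/\<epsilon>) *\<^sub>R w)) (at 0)" .
  have "partial_deriv i (kern \<epsilon>) w =
     deriv (\<lambda>h. 1 / (\<epsilon> ^ CARD('n) * bump_mass TYPE('n)) * bump ((1/\<epsilon>) *\<^sub>R (w + h *\<^sub>R axis i 1))) 0"
    unfolding partial_deriv_def kern_def ..
  also have "\<dots> = 1 / (\<epsilon> ^ CARD('n) * bump_mass TYPE('n)) * ((1/\<epsilon>) * partial_deriv i bump ((1/\<epsilon>) *\<^sub>R w))"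
    by (rule DERIV_imp_deriv[OF DERIV_cmult[OF *]])
  finally show ?thesis by (simp only: mult.assoc)
qed

text \<open>By scaling, differentiation costs a factor 1/\<epsilon> and what remains is the integral
  for the bump itself, divided by its mass. The growth 1/\<epsilon> is just what the Lipschitz bound
  on the field compensates in the commutator.\<close>

lemma L1norm_partial_deriv_kern:
  "\<exists>C\<ge>0. \<forall>\<epsilon>>0. \<forall>i. L1norm (partial_deriv i (kern \<epsilon> :: real^'n \<Rightarrow> real)) \<le> ennreal (C / \<epsilon>)"
proof -
  let ?I = "bump_mass TYPE('n)"
  have sm: "smooth_expr (partial_deriv i bump :: real^'n \<Rightarrow> real)" for i by (intro smooth_expr_partial_deriv bump_smooth)
  have [measurable]: "(partial_deriv i bump :: real^'n \<Rightarrow> real) \<in> borel_measurable borel" for i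
    by (intro borel_measurable_continuous_onI smooth_expr_continuous sm)
  have "integrable lborel (partial_deriv i bump :: real^'n \<Rightarrow> real)" for i
    by (rule integrable_continuous_compact_support[of _ "cball 0 1"])
       (auto intro!: smooth_expr_continuous sm partial_deriv_zero_off[where S="cball 0 1"] bump_zero)
  then have "L1norm (partial_deriv i bump :: real^'n \<Rightarrow> real) < \<infinity>" for i by (simp add: L1norm_finite_iff)
  then have "\<forall>i. \<exists>c\<ge>0. L1norm (partial_deriv i bump :: real^'n \<Rightarrow> real) = ennreal c"
    by (metis ennreal_cases infinity_ennreal_def less_irrefl)
  then obtain c where c: "\<And>i. 0 \<le> c i" "\<And>i. L1norm (partial_deriv i bump :: real^'n \<Rightarrow> real) = ennreal (c i)" by metis
  define C where "C = (\<Sum>i\<in>UNIV. c i) / ?I"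
  have "L1norm (partial_deriv i (kern \<epsilon> :: real^'n \<Rightarrow> real)) \<le> ennreal (C / \<epsilon>)" if \<epsilon>: "0 < \<epsilon>" for \<epsilon> i
  proof -
    have "L1norm (partial_deriv i (kern \<epsilon> :: real^'n \<Rightarrow> real)) =
       ennreal (1 / (\<epsilon> ^ CARD('n) * ?I) * (1/\<epsilon>)) * L1norm (\<lambda>w::real^'n. partial_deriv i bump ((1/\<epsilon>) *\<^sub>R w))"
      unfolding partial_deriv_kern[abs_def]
      using \<epsilon> bump_mass_pos[where 'n='n] by (subst L1norm_cmult) auto
    also have "L1norm (\<lambda>w::real^'n. partial_deriv i bump ((1/\<epsilon>) *\<^sub>R w)) = ennreal (\<epsilon> ^ CARD('n)) * ennreal (c i)"
      unfolding L1norm_def using nn_integral_lborel_scale[of "\<lambda>w::real^'n. ennreal \<bar>partial_deriv i bump w\<bar>" \<epsilon>] \<epsilon> c(2)[of i]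
      by (simp add: L1norm_def)
    also have "ennreal (1 / (\<epsilon> ^ CARD('n) * ?I) * (1/\<epsilon>)) * (ennreal (\<epsilon> ^ CARD('n)) * ennreal (c i)) = ennreal (c i / ?I / \<epsilon>)"
      using \<epsilon> bump_mass_pos[where 'n='n] c(1)[of i] by (simp flip: ennreal_mult')
    also have "\<dots> \<le> ennreal (C / \<epsilon>)"
      unfolding C_def using \<epsilon> bump_mass_pos[where 'n='n] c(1)
      by (intro ennreal_leI divide_right_mono member_le_sum) auto
    finally show ?thesis .
  qed
  moreover have "0 \<le> C" unfolding C_def using bump_mass_pos[where 'n='n] c(1) by (intro divide_nonneg_nonneg sum_nonneg) auto
  ultimately show ?thesis by blast
qed

lemma kern_bounded: "\<exists>B. \<forall>w. \<bar>kern \<epsilon> (w :: real^'n)\<bar> \<le> B"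
proof -
  have "bump w \<le> 1" for w :: "real^'n" by (simp add: bump_def flat_exp_def)
  then have "\<bar>kern \<epsilon> (w :: real^'n)\<bar> \<le> \<bar>1 / (\<epsilon> ^ CARD('n) * bump_mass TYPE('n))\<bar> * 1" for w
    unfolding kern_def abs_mult by (intro mult_left_mono) (auto simp: bump_nonneg)
  then show ?thesis by blast
qed

lemma partial_deriv_kern_bounded: "\<exists>B. \<forall>w. \<bar>partial_deriv i (kern \<epsilon>) (w :: real^'n)\<bar> \<le> B" if "0 < \<epsilon>"
proof -
  have "bounded (partial_deriv i (kern \<epsilon>) ` cball (0::real^'n) \<epsilon>)"
    by (intro compact_imp_bounded compact_continuous_image continuous_on_subset[OF smooth_expr_continuous]
       smooth_expr_partial_deriv kern_smooth) auto
  then obtain B where "\<forall>w\<in>cball (0::real^'n) \<epsilon>. \<bar>partial_deriv i (kern \<epsilon>) w\<bar> \<le> B" by (auto simp: bounded_iff)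
  then have B: "\<bar>partial_deriv i (kern \<epsilon>) w\<bar> \<le> B" if "norm w \<le> \<epsilon>" for w :: "real^'n" using that by auto
  have "kern \<epsilon> w = 0" if "w \<notin> cball 0 \<epsilon>" for w :: "real^'n" using kern_zero[OF \<open>0 < \<epsilon>\<close>, of w] that by auto
  then have "\<bar>partial_deriv i (kern \<epsilon>) w\<bar> \<le> max B 0" for w :: "real^'n"
    using B[of w] partial_deriv_zero_off[where S="cball 0 \<epsilon>" and u="kern \<epsilon>" and x=w and i=i] by (cases "norm w \<le> \<epsilon>") auto
  then show ?thesis by blast
qed

section \<open>Convergence of mollifications in L^1\<close>

lemma integrable_mult_AE_bounded:
  fixes f k :: "'a::euclidean_space \<Rightarrow> real"
  assumes f: "integrable lborel f" and [measurable]: "k \<in> borel_measurable borel" and B: "AE x in lborel. \<bar>k x\<bar> \<le> B"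
  shows "integrable lborel (\<lambda>x. f x * k x)"
proof (rule Bochner_Integration.integrable_bound)
  show "integrable lborel (\<lambda>x. \<bar>f x\<bar> * B)" using f by auto
  note [measurable] = borel_measurable_integrable[OF f]
  show "(\<lambda>x. f x * k x) \<in> borel_measurable lborel" by measurable
  show "AE x in lborel. norm (f x * k x) \<le> norm (\<bar>f x\<bar> * B)"
    using B by eventually_elim (auto simp: abs_mult intro!: mult_left_mono)
qed

lemma integrable_mult_bounded:
  fixes f k :: "'a::euclidean_space \<Rightarrow> real"
  assumes "integrable lborel f" "k \<in> borel_measurable borel" "\<And>x. \<bar>k x\<bar> \<le> B"
  shows "integrable lborel (\<lambda>x. f x * k x)"
  using assms by (intro integrable_mult_AE_bounded AE_I2)

definition mollify :: "real \<Rightarrow> (real^'n \<Rightarrow> real) \<Rightarrow> real^'n \<Rightarrow> real" where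
  "mollify \<epsilon> f x = (LINT y|lborel. f y * kern \<epsilon> (x - y))"

lemma borel_measurable_mollify:
  assumes [measurable]: "f \<in> borel_measurable borel"
  shows "mollify \<epsilon> f \<in> borel_measurable borel"
  unfolding mollify_def by measurable

lemma integral_kern_reflect:
  assumes "0 < \<epsilon>"
  shows "(LINT y|lborel. kern \<epsilon> (x - y :: real^'n)) = 1" "integrable lborel (\<lambda>y. kern \<epsilon> (x - y :: real^'n))"
proof -
  have "(LINT y|lborel. kern \<epsilon> (y :: real^'n)) = (LINT y|distr lborel borel (\<lambda>y. x - y). kern \<epsilon> y)" by (simp only: distr_lborel_reflect)
  also have "\<dots> = (LINT y|lborel. kern \<epsilon> (x - y))" by (intro integral_distr) auto
  finally show "(LINT y|lborel. kern \<epsilon> (x - y)) = 1" using integral_kern[OF assms, where 'n='n] by simp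
  have "integrable (distr lborel borel (\<lambda>y. x - y)) (kern \<epsilon>)" using kern_integrable[OF assms, where 'n='n] by (simp only: distr_lborel_reflect)
  then show "integrable lborel (\<lambda>y. kern \<epsilon> (x - y :: real^'n))" by (subst (asm) integrable_distr_eq) auto
qed

lemma L1norm_mollify_diff_le:
  fixes f :: "real^'n \<Rightarrow> real"
  assumes f: "integrable lborel f" and \<epsilon>: "0 < \<epsilon>"
    and B: "\<And>w. norm w \<le> \<epsilon> \<Longrightarrow> L1norm (\<lambda>x. f (x + w) - f x) \<le> B"
  shows "L1norm (\<lambda>x. mollify \<epsilon> f x - f x) \<le> B"
proof -
  have [measurable]: "f \<in> borel_measurable borel" using f by (simp add: integrable_iff_bounded)
  obtain b where b: "\<And>w::real^'n. \<bar>kern \<epsilon> w\<bar> \<le> b" using kern_bounded by metis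
  have "L1norm (\<lambda>x. mollify \<epsilon> f x - f x) \<le> (\<integral>\<^sup>+x. (\<integral>\<^sup>+y. ennreal \<bar>f y - f x\<bar> * ennreal (kern \<epsilon> (x - y)) \<partial>lborel) \<partial>lborel)"
    unfolding L1norm_def
  proof (intro nn_integral_mono)
    fix x
    have i: "integrable lborel (\<lambda>y. f y * kern \<epsilon> (x - y))" by (rule integrable_mult_bounded[OF f _ b]) auto
    \<comment> \<open>As the kernel has mass 1, f x is the integral of the constant f x against it,
      and only increments of f remain.\<close>
    have "mollify \<epsilon> f x - f x = (LINT y|lborel. f y * kern \<epsilon> (x - y)) - (LINT y|lborel. f x * kern \<epsilon> (x - y))"
      unfolding mollify_def using integral_kern_reflect[OF \<epsilon>, of x] by simp
    also have "\<dots> = (LINT y|lborel. f y * kern \<epsilon> (x - y) - f x * kern \<epsilon> (x - y))"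
      using i integral_kern_reflect[OF \<epsilon>, of x] by (intro Bochner_Integration.integral_diff[symmetric]) auto
    finally have "ennreal \<bar>mollify \<epsilon> f x - f x\<bar> \<le> (\<integral>\<^sup>+y. ennreal (norm (f y * kern \<epsilon> (x - y) - f x * kern \<epsilon> (x - y))) \<partial>lborel)"
      using integral_norm_bound_ennreal[of lborel "\<lambda>y. f y * kern \<epsilon> (x - y) - f x * kern \<epsilon> (x - y)"]
        i integral_kern_reflect[OF \<epsilon>, of x] by simp
    also have "\<dots> = (\<integral>\<^sup>+y. ennreal \<bar>f y - f x\<bar> * ennreal (kern \<epsilon> (x - y)) \<partial>lborel)"
      by (intro nn_integral_cong) (simp add: abs_mult abs_of_nonneg kern_nonneg[OF \<epsilon>] flip: left_diff_distrib ennreal_mult')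
    finally show "ennreal \<bar>mollify \<epsilon> f x - f x\<bar> \<le> (\<integral>\<^sup>+y. ennreal \<bar>f y - f x\<bar> * ennreal (kern \<epsilon> (x - y)) \<partial>lborel)" .
  qed
  also have "\<dots> \<le> (\<integral>\<^sup>+w. ennreal (kern \<epsilon> (w::real^'n)) \<partial>lborel) * B"
    by (intro nn_integral_kernel_le[where \<epsilon>=\<epsilon>] B) (auto simp: kern_zero[OF \<epsilon>])
  finally show ?thesis by (simp add: nn_integral_kern[OF \<epsilon>])
qed

lemma mollify_tendsto:
  fixes f :: "real^'n \<Rightarrow> real"
  assumes f: "integrable lborel f" and e: "0 < (e::real)"
  shows "\<exists>\<delta>>0. \<forall>\<epsilon>. 0 < \<epsilon> \<and> \<epsilon> \<le> \<delta> \<longrightarrow> L1norm (\<lambda>x. mollify \<epsilon> f x - f x) \<le> ennreal e"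
proof -
  obtain \<delta> where "\<delta> > 0" "\<And>w. norm w \<le> \<delta> \<Longrightarrow> L1norm (\<lambda>x. f (x + w) - f x) \<le> ennreal e"
    using L1norm_shift_continuous[OF f e] by blast
  then show ?thesis using L1norm_mollify_diff_le[OF f] by (intro exI[of _ \<delta>]) auto
qed

section \<open>Derivatives of Lipschitz functions along curves\<close>

lemma kern_reflect_lipschitz:
  assumes "0 < \<epsilon>"
  shows "\<exists>K. K-lipschitz_on UNIV (\<lambda>y. kern \<epsilon> (x - y :: real^'n))"
    and "\<And>y. y \<notin> cball x \<epsilon> \<Longrightarrow> kern \<epsilon> (x - y) = 0"
proof -
  show 0: "kern \<epsilon> (x - y) = 0" if "y \<notin> cball x \<epsilon>" for y
    using that kern_zero[OF assms, of "x - y"] by (simp add: dist_norm)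
  show "\<exists>K. K-lipschitz_on UNIV (\<lambda>y. kern \<epsilon> (x - y :: real^'n))"
    by (rule C1_compact_support_lipschitz[OF smooth_expr_C_k[OF kern_reflect_smooth] compact_cball[of x \<epsilon>]]) (rule 0)
qed

text \<open>
  The defect \<open>h\<close> below vanishes as a distribution, since for smooth functions the directional
  derivative is linear in the direction; so every mollification of \<open>h\<close> is zero.
\<close>

lemma lip_compact_dir_deriv_AE:
  fixes v :: "real^'n \<Rightarrow> real"
  assumes v: "lip_compact UNIV v"
  shows "AE x in lborel. x \<notin> non_diff v e \<and> dir_deriv v e x = (\<Sum>i\<in>UNIV. e $ i * partial_deriv i v x)"
proof -
  obtain L S where L: "L-lipschitz_on UNIV v" and S: "compact S" "\<And>x. x \<notin> S \<Longrightarrow> v x = 0"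
    using v unfolding lip_compact_def by blast
  define h where "h x = dir_deriv v e x - (\<Sum>i\<in>UNIV. e $ i * partial_deriv i v x)" for x
  \<comment> \<open>Integration by parts against the constant 1 is used only for its integrability
    claim: directional derivatives of v are integrable.\<close>
  have one: "0-lipschitz_on UNIV (\<lambda>_::real^'n. 1::real)" by (intro lipschitz_onI) auto
  have int: "integrable lborel (dir_deriv v e')" for e'
    using lipschitz_integral_by_parts(1)[OF one L S, of e'] by simp
  have inth: "integrable lborel h" unfolding h_def partial_deriv_eq_dir_deriv
    by (intro Bochner_Integration.integrable_diff Bochner_Integration.integrable_sum integrable_mult_right int)
  have moll0: "mollify \<epsilon> h x = 0" if \<epsilon>: "0 < \<epsilon>" for \<epsilon> x
  proof -
    define U where "U y = kern \<epsilon> (x - y)" for y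
    obtain K where K: "K-lipschitz_on UNIV U" using kern_reflect_lipschitz(1)[OF \<epsilon>] unfolding U_def by blast
    have U0: "U y = 0" if "y \<notin> cball x \<epsilon>" for y unfolding U_def using kern_reflect_lipschitz(2)[OF \<epsilon> that] .
    have diffU: "U differentiable (at y)" for y
      unfolding U_def by (intro smooth_expr_differentiable kern_reflect_smooth)
    note P = lipschitz_integral_by_parts[OF L K compact_cball U0]
    have "mollify \<epsilon> h x = (LINT y|lborel. U y * dir_deriv v e y - (\<Sum>i\<in>UNIV. e $ i * (U y * dir_deriv v (axis i 1) y)))"
      unfolding mollify_def h_def U_def partial_deriv_eq_dir_deriv
      by (intro Bochner_Integration.integral_cong) (auto simp: algebra_simps sum_distrib_left)
    also have "\<dots> = (LINT y|lborel. U y * dir_deriv v e y) - (\<Sum>i\<in>UNIV. e $ i * (LINT y|lborel. U y * dir_deriv v (axis i 1) y))"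
      using P(2) by (simp add: Bochner_Integration.integral_diff)
    also have "\<dots> = - (LINT y|lborel. v y * dir_deriv U e y) + (\<Sum>i\<in>UNIV. e $ i * (LINT y|lborel. v y * dir_deriv U (axis i 1) y))"
      using P(3) by (simp add: sum_negf)
    also have "(LINT y|lborel. v y * dir_deriv U e y) = (LINT y|lborel. (\<Sum>i\<in>UNIV. e $ i * (v y * dir_deriv U (axis i 1) y)))"
      by (intro Bochner_Integration.integral_cong)
         (auto simp: dir_deriv_differentiable[OF diffU, of e] partial_deriv_eq_dir_deriv sum_distrib_left mult_ac)
    also have "\<dots> = (\<Sum>i\<in>UNIV. e $ i * (LINT y|lborel. v y * dir_deriv U (axis i 1) y))"
      using P(1) by simp
    finally show ?thesis by simp
  qed
  have "L1norm h \<le> 0 + ennreal r" if r: "0 < r" for r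
  proof -
    obtain \<delta> where \<delta>: "\<delta> > 0" "\<forall>\<epsilon>. 0 < \<epsilon> \<and> \<epsilon> \<le> \<delta> \<longrightarrow> L1norm (\<lambda>x. mollify \<epsilon> h x - h x) \<le> ennreal r"
      using mollify_tendsto[OF inth r] by blast
    then have "L1norm (\<lambda>x. mollify \<delta> h x - h x) \<le> ennreal r" by blast
    then show ?thesis using moll0[OF \<delta>(1)] by (simp add: L1norm_def)
  qed
  then have "L1norm h \<le> 0" by (rule ennreal_le_epsilon)
  then have "(\<integral>\<^sup>+x. ennreal \<bar>h x\<bar> \<partial>lborel) = 0" by (simp add: L1norm_def)
  then have "AE x in lborel. h x = 0"
    using inth by (subst (asm) nn_integral_0_iff_AE) (auto simp: integrable_iff_bounded)
  then show ?thesis using AE_not_non_diff[OF L, of e]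
    by eventually_elim (simp add: h_def)
qed

text \<open>Off a null set, derivatives exist and depend linearly on the direction for countably
  many directions, dense in the space. A curve with velocity w is compared with the line in a nearby
  direction e of this kind, and Lipschitz continuity controls the error by the distance from e to w.
  The null set is fixed before the curve, as it must be when each x brings its own orbit.\<close>

lemma lip_compact_chain_rule:
  fixes v :: "real^'n \<Rightarrow> real"
  assumes v: "lip_compact UNIV v"
  shows "AE x in lborel. \<forall>c w. c 0 = x \<longrightarrow> (c has_vector_derivative w) (at 0) \<longrightarrow>
    ((\<lambda>h. (v (c h) - v x) / h) \<longlongrightarrow> (\<Sum>i\<in>UNIV. w $ i * partial_deriv i v x)) (at 0)"
proof -
  obtain L S where L: "L-lipschitz_on UNIV v" using v unfolding lip_compact_def by blast
  have L0: "0 \<le> L" using L by (rule lipschitz_on_nonneg)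
  obtain D :: "(real^'n) set" where D: "countable D" "\<And>X. open X \<Longrightarrow> X \<noteq> {} \<Longrightarrow> \<exists>d\<in>D. d \<in> X"
    using countable_dense_exists by metis
  have "AE x in lborel. \<forall>e\<in>D. x \<notin> non_diff v e \<and> dir_deriv v e x = (\<Sum>i\<in>UNIV. e $ i * partial_deriv i v x)"
    using D(1) lip_compact_dir_deriv_AE[OF v] by (simp add: AE_ball_countable)
  then show ?thesis
  proof eventually_elim
    fix x assume x: "\<forall>e\<in>D. x \<notin> non_diff v e \<and> dir_deriv v e x = (\<Sum>i\<in>UNIV. e $ i * partial_deriv i v x)"
    show "\<forall>c w. c 0 = x \<longrightarrow> (c has_vector_derivative w) (at 0) \<longrightarrow>
       ((\<lambda>h. (v (c h) - v x) / h) \<longlongrightarrow> (\<Sum>i\<in>UNIV. w $ i * partial_deriv i v x)) (at 0)"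
    proof (intro allI impI)
      fix c :: "real \<Rightarrow> real^'n" and w assume c0: "c 0 = x" and cw: "(c has_vector_derivative w) (at 0)"
      define A where "A = (\<Sum>i\<in>UNIV. \<bar>partial_deriv i v x\<bar>)"
      have A0: "0 \<le> A" unfolding A_def by (intro sum_nonneg) auto
      let ?l = "\<lambda>w::real^'n. \<Sum>i\<in>UNIV. w $ i * partial_deriv i v x"
      show "((\<lambda>h. (v (c h) - v x) / h) \<longlongrightarrow> ?l w) (at 0)"
      proof (rule tendstoI)
        fix r :: real assume r: "r > 0"
        \<comment> \<open>The curve and the line in direction e differ by at most 2 \<eta> |h|: one
          \<eta> for the differentiability of c, one for the distance of e from w. This costs 2 L
          \<eta> in the quotient; passing from e to w in the linear form costs A \<eta>. Together
          this is at most r/2, and the quotient along e adds less than r/4.\<close>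
        define \<eta> where "\<eta> = r / (4 * (L + A + 1))"
        have \<eta>: "\<eta> > 0" using r L0 A0 by (simp add: \<eta>_def)
        have Le: "(L + A) * \<eta> \<le> r / 4"
        proof -
          have "(L + A) * \<eta> \<le> (L + A + 1) * \<eta>" using \<eta> by (simp add: algebra_simps)
          also have "\<dots> = r / 4" using L0 A0 by (simp add: \<eta>_def field_simps add_eq_0_iff)
          finally show ?thesis .
        qed
        obtain e where e: "e \<in> D" "e \<in> ball w \<eta>" using D(2)[of "ball w \<eta>"] \<eta> by auto
        have ew: "norm (e - w) < \<eta>" using e(2) by (simp add: dist_norm norm_minus_commute)
        have lew: "\<bar>?l e - ?l w\<bar> \<le> A * \<eta>"
        proof -
          have "?l e - ?l w = (\<Sum>i\<in>UNIV. (e - w) $ i * partial_deriv i v x)"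
            by (simp add: sum_subtractf algebra_simps)
          also have "\<bar>\<dots>\<bar> \<le> (\<Sum>i\<in>UNIV. \<eta> * \<bar>partial_deriv i v x\<bar>)"
          proof (intro order_trans[OF sum_abs] sum_mono)
            fix i
            have "\<bar>(e - w) $ i\<bar> \<le> \<eta>" using component_le_norm_cart[of "e - w" i] ew by linarith
            then show "\<bar>(e - w) $ i * partial_deriv i v x\<bar> \<le> \<eta> * \<bar>partial_deriv i v x\<bar>"
              unfolding abs_mult by (rule mult_right_mono) simp
          qed
          also have "\<dots> = A * \<eta>" by (simp add: A_def sum_distrib_left mult.commute)
          finally show ?thesis .
        qed
        have 1: "\<forall>\<^sub>F h in at 0. \<bar>(v (x + h *\<^sub>R e) - v x) / h - ?l e\<bar> < r / 4"
        proof -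
          have "((\<lambda>h. (v (x + h *\<^sub>R e) - v x) / h) \<longlongrightarrow> ?l e) (at 0)"
            using dir_deriv_works(2)[OF L, of x e] x e(1) by auto
          from tendstoD[OF this, of "r/4"] show ?thesis using r by (simp add: dist_real_def)
        qed
        have 3: "\<forall>\<^sub>F h::real in at 0. h \<noteq> 0" by (simp add: eventually_at_filter)
        have 2: "\<forall>\<^sub>F h in at 0. norm (c h - x - h *\<^sub>R w) \<le> \<eta> * \<bar>h\<bar>"
        proof -
          have "((\<lambda>h. norm (c h - x - h *\<^sub>R w) / \<bar>h\<bar>) \<longlongrightarrow> 0) (at 0)"
            using cw unfolding has_vector_derivative_def has_derivative_at by (simp add: c0)
          from order_tendstoD(2)[OF this \<eta>] 3
          show ?thesis by eventually_elim (simp add: pos_divide_less_eq less_imp_le)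
        qed
        show "\<forall>\<^sub>F h in at 0. dist ((v (c h) - v x) / h) (?l w) < r"
          using 1 2 3
        proof eventually_elim
          case (elim h)
          have "norm (c h - (x + h *\<^sub>R e)) \<le> norm (c h - x - h *\<^sub>R w) + norm (h *\<^sub>R (w - e))"
            using norm_triangle_ineq[of "c h - x - h *\<^sub>R w" "h *\<^sub>R (w - e)"] by (simp add: algebra_simps)
          also have "\<dots> \<le> \<eta> * \<bar>h\<bar> + \<bar>h\<bar> * \<eta>"
            using elim(2) ew by (intro add_mono) (auto simp: norm_minus_commute intro!: mult_left_mono)
          finally have "L * norm (c h - (x + h *\<^sub>R e)) \<le> L * (2 * \<eta> * \<bar>h\<bar>)" using L0 by (intro mult_left_mono) auto
          moreover have "\<bar>v (c h) - v (x + h *\<^sub>R e)\<bar> \<le> L * norm (c h - (x + h *\<^sub>R e))"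
            using lipschitz_onD[OF L, of "c h" "x + h *\<^sub>R e"] by (simp add: dist_norm)
          ultimately have "\<bar>(v (c h) - v (x + h *\<^sub>R e)) / h\<bar> \<le> 2 * L * \<eta>"
            using elim(3) by (simp add: field_simps)
          moreover have "(v (c h) - v x) / h - ?l w = (v (c h) - v (x + h *\<^sub>R e)) / h + ((v (x + h *\<^sub>R e) - v x) / h - ?l e) + (?l e - ?l w)"
            by (simp add: diff_divide_distrib)
          moreover have "2 * L * \<eta> + A * \<eta> \<le> r / 2"
          proof -
            have "0 \<le> A * \<eta>" using A0 \<eta> by simp
            then show ?thesis using Le by (simp add: algebra_simps)
          qed
          ultimately show ?case using lew elim(1) r unfolding dist_real_def by linarith
        qed
      qed
    qed
  qed
qed

section \<open>The flow\<close>

locale complete_lipschitz_field =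
  fixes \<Omega> :: "(real^'n) set" and X :: "real^'n \<Rightarrow> real^'n" and L :: real
  assumes open_dom: "open \<Omega>"
    and lipschitz: "L-lipschitz_on \<Omega> X"
    and complete: "complete_vector_field X \<Omega>"
begin

lemma L_nonneg: "0 \<le> L"
  using lipschitz by (rule lipschitz_on_nonneg)

lemma dom_borel[measurable]: "\<Omega> \<in> sets borel"
  using open_dom by simp

lemma field_continuous: "continuous_on \<Omega> X"
  using lipschitz by (rule lipschitz_on_continuous_on)

text \<open>
  Gronwall's inequality in both time directions: \<open>exp (- 2 L t) \<bar>c t - d t\<bar>\<^sup>2\<close> is nonincreasing
  and \<open>exp (2 L t) \<bar>c t - d t\<bar>\<^sup>2\<close> is nondecreasing.
\<close>

lemma integral_curve_dist_le:
  assumes c: "integral_curve X \<Omega> x c" and d: "integral_curve X \<Omega> y d"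
  shows "norm (c t - d t) \<le> exp (L * \<bar>t\<bar>) * norm (x - y)"
proof -
  \<comment> \<open>The squared distance, since the norm itself is not differentiable at 0.\<close>
  define q where "q t = (c t - d t) \<bullet> (c t - d t)" for t
  define q' where "q' t = 2 * ((c t - d t) \<bullet> (X (c t) - X (d t)))" for t
  have q: "(q has_real_derivative q' t) (at t)" for t
    using c d unfolding q_def q'_def integral_curve_def has_real_derivative_iff_has_vector_derivative
    by (auto intro!: derivative_eq_intros simp: inner_commute algebra_simps has_vector_derivative_def)
  have q'_le: "\<bar>q' t\<bar> \<le> 2 * L * q t" for t
  proof -
    have "\<bar>(c t - d t) \<bullet> (X (c t) - X (d t))\<bar> \<le> norm (c t - d t) * norm (X (c t) - X (d t))"
      by (rule Cauchy_Schwarz_ineq2)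
    also have "\<dots> \<le> norm (c t - d t) * (L * norm (c t - d t))"
      using lipschitz_onD[OF lipschitz, of "c t" "d t"] c d
      by (intro mult_left_mono) (auto simp: integral_curve_def dist_norm)
    also have "\<dots> = L * q t" by (simp add: q_def power2_norm_eq_inner[symmetric] power2_eq_square)
    finally show ?thesis by (simp add: q'_def)
  qed
  have e1: "((\<lambda>t. exp (a * t) * q t) has_real_derivative exp (a * t) * (a * q t + q' t)) (at t)" for a t
    by (auto intro!: derivative_eq_intros q simp: algebra_simps)
  have "q t \<le> exp (2 * L * \<bar>t\<bar>) * q 0"
  proof (cases "0 \<le> t")
    case True
    have "exp (- 2 * L * t) * q t \<le> exp (- 2 * L * 0) * q 0"
    proof (rule DERIV_nonpos_imp_nonincreasing[OF True])
      fix s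
      have "exp (- 2 * L * s) * (- 2 * L * q s + q' s) \<le> 0"
        using q'_le[of s] by (intro mult_nonneg_nonpos) auto
      then show "\<exists>y. ((\<lambda>t. exp (- 2 * L * t) * q t) has_real_derivative y) (at s) \<and> y \<le> 0"
        using e1[of "- 2 * L" s] by blast
    qed
    then show ?thesis using True by (simp add: exp_minus field_simps)
  next
    case False
    then have t: "t \<le> 0" by simp
    have "exp (2 * L * t) * q t \<le> exp (2 * L * 0) * q 0"
    proof (rule DERIV_nonneg_imp_nondecreasing[OF t])
      fix s
      have "0 \<le> exp (2 * L * s) * (2 * L * q s + q' s)"
        using q'_le[of s] by (intro mult_nonneg_nonneg) auto
      then show "\<exists>y. ((\<lambda>t. exp (2 * L * t) * q t) has_real_derivative y) (at s) \<and> 0 \<le> y"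
        using e1[of "2 * L" s] by blast
    qed
    then show ?thesis using False by (simp add: exp_minus field_simps)
  qed
  also have "q 0 = (norm (x - y))\<^sup>2" using c d by (simp add: q_def integral_curve_def power2_norm_eq_inner)
  also have "q t = (norm (c t - d t))\<^sup>2" by (simp add: q_def power2_norm_eq_inner)
  also have "exp (2 * L * \<bar>t\<bar>) * (norm (x - y))\<^sup>2 = (exp (L * \<bar>t\<bar>) * norm (x - y))\<^sup>2"
    by (simp add: power_mult_distrib exp_double[symmetric] mult.assoc)
  finally show ?thesis by (rule power2_le_imp_le) simp
qed

text \<open>
  The flow, extended by the identity, so that \<open>L\<^sup>1(\<Omega>)\<close> can be treated as the functions in
  \<open>L\<^sup>1\<close> of the whole space that vanish off \<open>\<Omega>\<close>.
\<close>

definition Phi :: "real \<Rightarrow> real^'n \<Rightarrow> real^'n" where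
  "Phi t x = (if x \<in> \<Omega> then flow X \<Omega> t x else x)"

text \<open>The distance estimate with equal starting points gives uniqueness, so the definite
  description in \<open>flow\<close> denotes the curve provided by completeness.\<close>

lemma integral_curve_flow:
  assumes x: "x \<in> \<Omega>"
  shows "integral_curve X \<Omega> x (\<lambda>t. flow X \<Omega> t x)"
proof -
  obtain c where c: "integral_curve X \<Omega> x c" using complete x unfolding complete_vector_field_def by blast
  have "(THE c. integral_curve X \<Omega> x c) = c"
  proof (rule the_equality[of "integral_curve X \<Omega> x", OF c])
    fix d assume "integral_curve X \<Omega> x d"
    then show "d = c" using integral_curve_dist_le[OF _ c, of x d] by (intro ext) auto
  qed
  then have "(\<lambda>t. flow X \<Omega> t x) = c" by (simp add: flow_def fun_eq_iff)
  then show ?thesis using c by simp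
qed

lemma flow_unique: "integral_curve X \<Omega> x c \<Longrightarrow> c t = flow X \<Omega> t x"
proof -
  assume c: "integral_curve X \<Omega> x c"
  then have "x \<in> \<Omega>" unfolding integral_curve_def by metis
  from integral_curve_dist_le[OF c integral_curve_flow[OF this], of t] show ?thesis by simp
qed

lemma Phi_0[simp]: "Phi 0 x = x"
  using integral_curve_flow[of x] by (auto simp: Phi_def integral_curve_def)

lemma Phi_mem_iff[simp]: "Phi t x \<in> \<Omega> \<longleftrightarrow> x \<in> \<Omega>"
  using integral_curve_flow[of x] by (auto simp: Phi_def integral_curve_def)

lemma Phi_off[simp]: "x \<notin> \<Omega> \<Longrightarrow> Phi t x = x"
  by (simp add: Phi_def)

lemma Phi_has_vector_derivative:
  "x \<in> \<Omega> \<Longrightarrow> ((\<lambda>t. Phi t x) has_vector_derivative X (Phi t x)) (at t)"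
  using integral_curve_flow[of x] by (simp add: Phi_def[abs_def] integral_curve_def)

lemma Phi_add: "Phi (s + t) x = Phi s (Phi t x)"
proof (cases "x \<in> \<Omega>")
  case True
  let ?y = "flow X \<Omega> t x"
  have c: "integral_curve X \<Omega> x (\<lambda>t. flow X \<Omega> t x)" using True by (rule integral_curve_flow)
  have "integral_curve X \<Omega> ?y (\<lambda>s. flow X \<Omega> (s + t) x)"
    unfolding integral_curve_def
  proof (intro conjI allI)
    fix s
    show "flow X \<Omega> (s + t) x \<in> \<Omega>" using c by (simp add: integral_curve_def)
    have "((\<lambda>t. flow X \<Omega> t x) has_vector_derivative X (flow X \<Omega> (s + t) x)) (at (s + t))"
      using c by (simp add: integral_curve_def)
    then have "((\<lambda>t. flow X \<Omega> t x) \<circ> (\<lambda>s. s + t) has_vector_derivative 1 *\<^sub>R X (flow X \<Omega> (s + t) x)) (at s)"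
      by (intro vector_diff_chain_at) (auto intro!: derivative_eq_intros)
    then show "((\<lambda>s. flow X \<Omega> (s + t) x) has_vector_derivative X (flow X \<Omega> (s + t) x)) (at s)"
      by (simp add: o_def)
  qed simp
  from flow_unique[OF this, of s] True show ?thesis using Phi_mem_iff[of t x] by (simp add: Phi_def)
qed simp

lemma Phi_inverse[simp]: "Phi (- t) (Phi t x) = x" "Phi t (Phi (- t) x) = x"
  using Phi_add[of "-t" t x] Phi_add[of t "-t" x] by simp_all

lemma Phi_lipschitz: "(exp (L * \<bar>t\<bar>))-lipschitz_on \<Omega> (Phi t)"
proof (rule lipschitz_onI)
  fix x y assume "x \<in> \<Omega>" "y \<in> \<Omega>"
  then show "dist (Phi t x) (Phi t y) \<le> exp (L * \<bar>t\<bar>) * dist x y"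
    using integral_curve_dist_le[OF integral_curve_flow integral_curve_flow, of x y t]
    by (simp add: Phi_def dist_norm)
qed simp

lemma Phi_continuous_time: "continuous_on UNIV (\<lambda>t. Phi t x)"
proof (cases "x \<in> \<Omega>")
  case True
  then show ?thesis using Phi_has_vector_derivative
    by (meson continuous_at_imp_continuous_on has_vector_derivative_continuous)
qed simp

text \<open>The Lipschitz constant in space is locally bounded in time; together with continuity in
  time at the one point x this gives joint continuity.\<close>

lemma Phi_continuous: "continuous_on (UNIV \<times> \<Omega>) (\<lambda>(t, x). Phi t x)"
  unfolding continuous_on_def
proof (intro ballI, clarsimp)
  fix t :: real and x assume x: "x \<in> \<Omega>"
  let ?F = "at (t, x) within UNIV \<times> \<Omega>"
  have tF: "((\<lambda>p. fst p) \<longlongrightarrow> t) ?F" "((\<lambda>p. snd p) \<longlongrightarrow> x) ?F"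
    by (auto intro!: tendsto_eq_intros)
  have "((\<lambda>p. exp (L * \<bar>fst p\<bar>) * norm (snd p - x) + norm (Phi (fst p) x - Phi t x)) \<longlongrightarrow>
     exp (L * \<bar>t\<bar>) * norm (x - x) + norm (Phi t x - Phi t x)) ?F"
    by (intro tendsto_intros tF) (use continuous_on_tendsto_compose[OF Phi_continuous_time tF(1)] in auto)
  then have lim: "((\<lambda>p. exp (L * \<bar>fst p\<bar>) * norm (snd p - x) + norm (Phi (fst p) x - Phi t x)) \<longlongrightarrow> 0) ?F" by simp
  have "((\<lambda>p. Phi (fst p) (snd p) - Phi t x) \<longlongrightarrow> 0) ?F"
  proof (rule tendsto_0_le[OF lim, of _ 1])
    show "\<forall>\<^sub>F p in ?F. norm (Phi (fst p) (snd p) - Phi t x) \<le> norm (exp (L * \<bar>fst p\<bar>) * norm (snd p - x) + norm (Phi (fst p) x - Phi t x)) * 1"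
      unfolding eventually_at_filter
    proof (rule always_eventually, intro allI impI)
      fix p :: "real \<times> (real^'n)" assume "p \<in> UNIV \<times> \<Omega>"
      then have "snd p \<in> \<Omega>" by auto
      have "norm (Phi (fst p) (snd p) - Phi t x) \<le> norm (Phi (fst p) (snd p) - Phi (fst p) x) + norm (Phi (fst p) x - Phi t x)"
        by (metis dist_norm dist_triangle)
      also have "norm (Phi (fst p) (snd p) - Phi (fst p) x) \<le> exp (L * \<bar>fst p\<bar>) * norm (snd p - x)"
        using lipschitz_onD[OF Phi_lipschitz \<open>snd p \<in> \<Omega>\<close> x, of "fst p"] by (simp add: dist_norm)
      finally show "norm (Phi (fst p) (snd p) - Phi t x) \<le> norm (exp (L * \<bar>fst p\<bar>) * norm (snd p - x) + norm (Phi (fst p) x - Phi t x)) * 1"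
        by simp
    qed
  qed
  then show "((\<lambda>(t, x). Phi t x) \<longlongrightarrow> Phi t x) ?F"
    by (simp add: case_prod_unfold LIM_zero_iff)
qed

lemma Phi_measurable_pair: "(\<lambda>p. Phi (fst p) (snd p)) \<in> borel_measurable borel"
proof -
  have "(\<lambda>p. if p \<in> UNIV \<times> \<Omega> then Phi (fst p) (snd p) else snd p) \<in> borel_measurable borel"
  proof (rule borel_measurable_continuous_on_if)
    show "(UNIV :: real set) \<times> \<Omega> \<in> sets borel" using open_dom by (intro borel_open open_Times) auto
    show "continuous_on (UNIV \<times> \<Omega>) (\<lambda>p. Phi (fst p) (snd p))"
      using Phi_continuous by (simp add: case_prod_unfold)
  qed (intro continuous_intros)
  moreover have "(\<lambda>p. if p \<in> UNIV \<times> \<Omega> then Phi (fst p) (snd p) else snd p) = (\<lambda>p. Phi (fst p) (snd p))"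
    by (auto simp: fun_eq_iff)
  ultimately show ?thesis by simp
qed

lemma Phi_measurable[measurable (raw)]:
  assumes "T \<in> borel_measurable M" "Z \<in> borel_measurable M"
  shows "(\<lambda>w. Phi (T w) (Z w)) \<in> borel_measurable M"
  using measurable_compose[OF borel_measurable_Pair[OF assms] Phi_measurable_pair] by simp

section \<open>Distortion of Lebesgue measure by the flow\<close>

text \<open>The n-th power of the Lipschitz constant of \<open>Phi t\<close>, hence a bound for
  volume distortion; the absolute value makes it serve for the inverse map too.\<close>

definition growth :: "real \<Rightarrow> real" where
  "growth t = exp (L * \<bar>t\<bar>) ^ CARD('n)"

lemma growth_ge_1: "1 \<le> growth t"
  unfolding growth_def using L_nonneg by (intro one_le_power) auto

lemma growth_mono: "\<bar>s\<bar> \<le> \<bar>t\<bar> \<Longrightarrow> growth s \<le> growth t"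
  unfolding growth_def using L_nonneg by (intro power_mono) (auto intro: mult_left_mono)

text \<open>Inside \<Omega> the preimage under \<open>Phi t\<close> is the image under
  \<open>Phi (- t)\<close>, which sends a small ball about x into a ball whose radius is larger by
  the Lipschitz factor and whose volume is larger by \<open>growth t\<close>; the covering estimate
  applies. Points off \<Omega> do not move, and \<open>growth t\<close> is at least 1.\<close>

lemma emeasure_Phi_vimage_le:
  assumes N: "N \<in> sets borel"
  shows "emeasure lborel (Phi t -` N) \<le> ennreal (growth t) * emeasure lborel N"
proof -
  have pb: "Phi t -` A \<in> sets borel" if "A \<in> sets borel" for A
    using measurable_sets[of "Phi t" borel borel A] that by simp
  have im: "Phi (- t) ` (N \<inter> \<Omega>) = Phi t -` (N \<inter> \<Omega>)"
  proof (intro set_eqI iffI)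
    fix x assume "x \<in> Phi t -` (N \<inter> \<Omega>)"
    then show "x \<in> Phi (- t) ` (N \<inter> \<Omega>)" by (intro image_eqI[of _ _ "Phi t x"]) auto
  qed auto
  let ?K = "exp (L * \<bar>t\<bar>)"
  have 1: "emeasure lebesgue (Phi (- t) ` (N \<inter> \<Omega>)) \<le> ennreal (growth t) * emeasure lebesgue (N \<inter> \<Omega>)"
  proof (rule Vitali_image_emeasure_le)
    show "N \<inter> \<Omega> \<in> sets lebesgue" using N by auto
    have "Phi t -` (N \<inter> \<Omega>) \<in> sets borel" using N by (intro pb) auto
    then show "Phi (- t) ` (N \<inter> \<Omega>) \<in> sets lebesgue" unfolding im by auto
    show "0 \<le> growth t" using growth_ge_1[of t] by simp
    show "negligible (Phi (- t) ` A)" if "negligible A" "A \<subseteq> N \<inter> \<Omega>" for A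
      using that lipschitz_on_subset[OF Phi_lipschitz[of "-t"], of A] by (intro negligible_lipschitz_image[of A]) auto
    fix x :: "real^'n" and d :: real assume x: "x \<in> N \<inter> \<Omega>" and d: "0 < d"
    have sub: "Phi (- t) ` (N \<inter> \<Omega> \<inter> cball x (d/2)) \<subseteq> cball (Phi (- t) x) (?K * (d/2))"
    proof clarify
      fix y assume y: "y \<in> \<Omega>" "y \<in> cball x (d/2)"
      have "dist (Phi (- t) x) (Phi (- t) y) \<le> ?K * dist x y"
        using lipschitz_onD[OF Phi_lipschitz[of "-t"], of x y] x y by auto
      also have "\<dots> \<le> ?K * (d/2)" using y by (intro mult_left_mono) auto
      finally show "Phi (- t) y \<in> cball (Phi (- t) x) (?K * (d/2))" by simp
    qed
    have "emeasure lebesgue (cball (Phi (- t) x) (?K * (d/2))) = ennreal (growth t) * emeasure lebesgue (cball x (d/2))"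
      using d by (simp add: emeasure_cball growth_def power_mult_distrib flip: ennreal_mult') (simp add: power_mult_distrib power_divide)
    then show "\<exists>c r V. 0 < r \<and> r < d \<and> x \<in> cball c r \<and> V \<in> sets lebesgue \<and>
       Phi (- t) ` (N \<inter> \<Omega> \<inter> cball c r) \<subseteq> V \<and> emeasure lebesgue V \<le> ennreal (growth t) * emeasure lebesgue (cball c r)"
      using sub d by (intro exI[of _ x] exI[of _ "d/2"] exI[of _ "cball (Phi (- t) x) (?K * (d/2))"]) auto
  qed
  have 2: "emeasure lborel (Phi t -` (N \<inter> \<Omega>)) \<le> ennreal (growth t) * emeasure lborel (N \<inter> \<Omega>)"
    using 1 N pb[of "N \<inter> \<Omega>"] unfolding im by simp
  have "Phi t -` N = Phi t -` (N \<inter> \<Omega>) \<union> (N - \<Omega>)"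
  proof (rule set_eqI)
    show "x \<in> Phi t -` N \<longleftrightarrow> x \<in> Phi t -` (N \<inter> \<Omega>) \<union> (N - \<Omega>)" for x by (cases "x \<in> \<Omega>") auto
  qed
  then have "emeasure lborel (Phi t -` N) = emeasure lborel (Phi t -` (N \<inter> \<Omega>) \<union> (N - \<Omega>))"
    by (rule arg_cong)
  also have "\<dots> \<le> emeasure lborel (Phi t -` (N \<inter> \<Omega>)) + emeasure lborel (N - \<Omega>)"
    using N pb[of "N \<inter> \<Omega>"] by (intro emeasure_subadditive) auto
  also have "\<dots> \<le> ennreal (growth t) * emeasure lborel (N \<inter> \<Omega>) + ennreal (growth t) * emeasure lborel (N - \<Omega>)"
    using mult_right_mono[of 1 "ennreal (growth t)" "emeasure lborel (N - \<Omega>)"]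
      ennreal_leI[OF growth_ge_1[of t]] by (intro add_mono 2) simp
  also have "\<dots> = ennreal (growth t) * (emeasure lborel (N \<inter> \<Omega>) + emeasure lborel (N - \<Omega>))"
    by (simp add: distrib_left)
  also have "emeasure lborel (N \<inter> \<Omega>) + emeasure lborel (N - \<Omega>) = emeasure lborel N"
    using N by (subst plus_emeasure) (auto intro!: arg_cong[where f="emeasure lborel"])
  finally show ?thesis .
qed

lemma nn_integral_Phi_le:
  assumes [measurable]: "h \<in> borel_measurable borel"
  shows "(\<integral>\<^sup>+x. h (Phi t x) \<partial>lborel) \<le> ennreal (growth t) * (\<integral>\<^sup>+x. h x \<partial>lborel)"
proof -
  have "(\<integral>\<^sup>+x. h (Phi t x) \<partial>lborel) = (\<integral>\<^sup>+x. h x \<partial>distr lborel borel (Phi t))"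
    by (simp add: nn_integral_distr)
  also have "\<dots> \<le> (\<integral>\<^sup>+x. h x \<partial>scale_measure (ennreal (growth t)) lborel)"
  proof (rule nn_integral_mono_measure)
    show "distr lborel borel (Phi t) \<le> scale_measure (ennreal (growth t)) lborel"
      using emeasure_Phi_vimage_le by (subst le_measure) (auto simp: le_fun_def emeasure_distr emeasure_notin_sets)
  qed auto
  also have "\<dots> = ennreal (growth t) * (\<integral>\<^sup>+x. h x \<partial>lborel)" by (simp add: nn_integral_scale_measure)
  finally show ?thesis .
qed

lemma L1norm_Phi_le:
  "h \<in> borel_measurable borel \<Longrightarrow> L1norm (\<lambda>x. h (Phi t x)) \<le> ennreal (growth t) * L1norm h"
  unfolding L1norm_def using nn_integral_Phi_le[of "\<lambda>x. ennreal \<bar>h x\<bar>"] by simp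

lemma integrable_Phi:
  assumes "integrable lborel (h :: real^'n \<Rightarrow> real)"
  shows "integrable lborel (\<lambda>x. h (Phi t x))"
proof -
  have [measurable]: "h \<in> borel_measurable borel" using assms by (simp add: integrable_iff_bounded)
  have "L1norm h < \<infinity>" using assms by (simp add: L1norm_finite_iff)
  then have "ennreal (growth t) * L1norm h < \<infinity>" by (simp add: ennreal_mult_less_top)
  then have "L1norm (\<lambda>x. h (Phi t x)) < \<infinity>" using L1norm_Phi_le[of h t] by (auto intro: le_less_trans)
  then show ?thesis by (subst L1norm_finite_iff) auto
qed

text \<open>Preimages of null sets under the flow are null. Hence composition with
  \<open>Phi t\<close> is well defined on classes of functions that agree almost everywhere.\<close>

lemma AE_Phi:
  assumes "AE x in lborel. P x"
  shows "AE x in lborel. P (Phi t x)"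
proof -
  obtain N where N: "N \<in> sets borel" "emeasure lborel N = 0" "{x. \<not> P x} \<subseteq> N"
    using assms by (auto simp: eventually_ae_filter null_sets_def)
  have "emeasure lborel (Phi t -` N) \<le> 0" using emeasure_Phi_vimage_le[OF N(1), of t] N(2) by simp
  moreover have "Phi t -` N \<in> sets borel" using measurable_sets[of "Phi t" borel borel N] N(1) by simp
  ultimately have "Phi t -` N \<in> null_sets lborel" by (auto intro: null_setsI)
  from AE_not_in[OF this] show ?thesis by eventually_elim (use N(3) in auto)
qed

section \<open>Orbits of compact sets and strong continuity in time\<close>

text \<open>The time interval is symmetric, so the set contains the points reached from K as well as
  those that enter K within time T. The latter bounds the support of a function composed with the
  flow.\<close>

definition reach :: "real \<Rightarrow> (real^'n) set \<Rightarrow> (real^'n) set" where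
  "reach T K = (\<lambda>(t, x). Phi t x) ` ({-T..T} \<times> K)"

lemma compact_reach: "compact K \<Longrightarrow> K \<subseteq> \<Omega> \<Longrightarrow> compact (reach T K)"
  unfolding reach_def
  by (intro compact_continuous_image compact_Times continuous_on_subset[OF Phi_continuous]) auto

lemma reach_subset: "K \<subseteq> \<Omega> \<Longrightarrow> reach T K \<subseteq> \<Omega>"
  unfolding reach_def by auto

lemma reachI: "\<bar>t\<bar> \<le> T \<Longrightarrow> x \<in> K \<Longrightarrow> Phi t x \<in> reach T K"
  unfolding reach_def by (intro image_eqI[of _ _ "(t, x)"]) auto

lemma reachI': "\<bar>t\<bar> \<le> T \<Longrightarrow> Phi t x \<in> K \<Longrightarrow> x \<in> reach T K"
  using reachI[of "-t" T "Phi t x" K] by simp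

lemma Phi_displacement:
  assumes K: "compact K" "K \<subseteq> \<Omega>"
  shows "\<exists>B\<ge>0. \<forall>x\<in>K. \<forall>t. \<bar>t\<bar> \<le> 1 \<longrightarrow> norm (Phi t x - x) \<le> B * \<bar>t\<bar>"
proof -
  have "bounded (X ` reach 1 K)"
    by (intro compact_imp_bounded compact_continuous_image continuous_on_subset[OF field_continuous]
        compact_reach reach_subset K)
  then obtain B where B: "\<And>x. x \<in> reach 1 K \<Longrightarrow> norm (X x) \<le> B" by (auto simp: bounded_iff)
  have "norm (Phi t x - x) \<le> max B 0 * \<bar>t\<bar>" if x: "x \<in> K" and t: "\<bar>t\<bar> \<le> 1" for x t
  proof -
    have "norm (Phi t x - Phi 0 x) \<le> max B 0 * norm (t - 0)"
    proof (rule differentiable_bound[of "{-1..1}" "\<lambda>t. Phi t x" "\<lambda>t h. h *\<^sub>R X (Phi t x)"])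
      fix s :: real assume s: "s \<in> {-1..1}"
      show "((\<lambda>t. Phi t x) has_derivative (\<lambda>h. h *\<^sub>R X (Phi s x))) (at s within {-1..1})"
        using Phi_has_vector_derivative[of x s] x K(2)
        by (auto simp: has_vector_derivative_def intro: has_derivative_at_withinI)
      have "norm (X (Phi s x)) \<le> max B 0" using B[OF reachI[OF _ x, of s 1]] s by (auto simp: abs_le_iff)
      then show "onorm (\<lambda>h. h *\<^sub>R X (Phi s x)) \<le> max B 0"
        by (intro onorm_le) (simp add: mult.commute[of "max B 0"] mult_left_mono)
    qed (use t in auto)
    then show ?thesis by simp
  qed
  then show ?thesis by (intro exI[of _ "max B 0"]) auto
qed

text \<open>A point outside \<open>reach 1 S0\<close> neither lies in the support nor enters it
  within unit time; inside, the Lipschitz constant of v multiplies the displacement along the orbit.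
  The bound yields strong continuity as well as domination of the difference quotients at time
  0.\<close>

lemma lip_compact_Phi_bound:
  assumes v: "lip_compact \<Omega> v"
  shows "\<exists>S B. compact S \<and> S \<subseteq> \<Omega> \<and> 0 \<le> B \<and> (\<forall>t x. \<bar>t\<bar> \<le> 1 \<longrightarrow> \<bar>v (Phi t x) - v x\<bar> \<le> B * \<bar>t\<bar> * indicator S x)"
proof -
  obtain M S0 where M: "M-lipschitz_on UNIV v" and S0: "compact S0" "S0 \<subseteq> \<Omega>" "\<And>x. x \<notin> S0 \<Longrightarrow> v x = 0"
    using v unfolding lip_compact_def by blast
  define S where "S = reach 1 S0"
  have S: "compact S" "S \<subseteq> \<Omega>" unfolding S_def using S0 by (auto intro: compact_reach subsetD[OF reach_subset])
  obtain B where B: "0 \<le> B" "\<And>x t. x \<in> S \<Longrightarrow> \<bar>t\<bar> \<le> 1 \<Longrightarrow> norm (Phi t x - x) \<le> B * \<bar>t\<bar>"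
    using Phi_displacement[OF S] by blast
  have M0: "0 \<le> M" using M by (rule lipschitz_on_nonneg)
  have "\<bar>v (Phi t x) - v x\<bar> \<le> (M * B) * \<bar>t\<bar> * indicator S x" if t: "\<bar>t\<bar> \<le> 1" for t x
  proof (cases "x \<in> S")
    case True
    have "\<bar>v (Phi t x) - v x\<bar> \<le> M * norm (Phi t x - x)"
      using lipschitz_onD[OF M, of "Phi t x" x] by (simp add: dist_norm)
    also have "\<dots> \<le> M * (B * \<bar>t\<bar>)" using B(2)[OF True t] M0 by (rule mult_left_mono)
    finally show ?thesis using True by (simp add: mult_ac)
  next
    case False
    then have "x \<notin> S0" using reachI'[of 0 1 x S0] by (auto simp: S_def)
    moreover have "Phi t x \<notin> S0" using False reachI'[OF t, of x S0] by (auto simp: S_def)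
    ultimately show ?thesis using S0(3) False by simp
  qed
  then show ?thesis using S B(1) M0 by (intro exI[of _ S] exI[of _ "M * B"]) auto
qed

text \<open>As for translations, but composition with the flow is bounded rather than isometric.
  Times are restricted to |t| \<le> 1, where the norm is at most C = \<open>growth 1\<close>; this
  is why f is approximated up to e/(3 C).\<close>

lemma L1norm_Phi_continuous:
  assumes f: "integrable lborel f" and f0: "\<And>x. x \<notin> \<Omega> \<Longrightarrow> f x = 0" and e: "0 < (e::real)"
  shows "\<exists>\<delta>>0. \<delta> \<le> 1 \<and> (\<forall>t. \<bar>t\<bar> \<le> \<delta> \<longrightarrow> L1norm (\<lambda>x. f (Phi t x) - f x) \<le> ennreal e)"
proof -
  define C where "C = growth 1"
  have C: "1 \<le> C" unfolding C_def by (rule growth_ge_1)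
  define e' where "e' = e / (3 * C)"
  have e': "0 < e'" using e C by (simp add: e'_def)
  obtain v where v: "lip_compact \<Omega> v" "L1norm (\<lambda>x. f x - v x) \<le> ennreal e'"
    using lip_compact_dense[OF open_dom f f0 e'] by blast
  note [measurable] = lip_compact_measurable[OF v(1)] borel_measurable_integrable[OF f, simplified]
  obtain S B where S: "compact S" "0 \<le> B" and SB: "\<And>t x. \<bar>t\<bar> \<le> 1 \<Longrightarrow> \<bar>v (Phi t x) - v x\<bar> \<le> B * \<bar>t\<bar> * indicator S x"
    using lip_compact_Phi_bound[OF v(1)] by blast
  have [measurable]: "S \<in> sets borel" using S by (simp add: borel_compact)
  define m where "m = measure lborel S"
  have m: "emeasure lborel S = ennreal m" "0 \<le> m"
    using emeasure_compact_finite[OF S(1)] unfolding m_def by (auto simp: emeasure_eq_ennreal_measure)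
  define \<delta> where "\<delta> = min 1 (e / (3 * (B * m + 1)))"
  have Bm: "0 < B * m + 1" using S m by (simp add: add_nonneg_pos)
  have \<delta>: "\<delta> > 0" using e Bm by (auto simp: \<delta>_def)
  show ?thesis
  proof (intro exI[of _ \<delta>] conjI allI impI \<delta>)
    show "\<delta> \<le> 1" by (simp add: \<delta>_def)
    fix t assume t: "\<bar>t\<bar> \<le> \<delta>"
    then have t1: "\<bar>t\<bar> \<le> 1" by (simp add: \<delta>_def)
    have A: "L1norm (\<lambda>x. v (Phi t x) - v x) \<le> ennreal (e/3)"
    proof -
      have "L1norm (\<lambda>x. v (Phi t x) - v x) \<le> (\<integral>\<^sup>+x. ennreal (B * \<bar>t\<bar>) * indicator S x \<partial>lborel)"
        unfolding L1norm_def using S(2) SB[OF t1]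
        by (intro nn_integral_mono) (auto simp flip: ennreal_mult' ennreal_indicator intro!: ennreal_leI)
      also have "\<dots> = ennreal (B * \<bar>t\<bar> * m)" using m S(2) by (simp add: nn_integral_cmult ennreal_mult')
      also have "\<dots> \<le> ennreal (e/3)"
      proof (rule ennreal_leI)
        have "\<bar>t\<bar> \<le> e / (3 * (B * m + 1))" using t by (simp add: \<delta>_def)
        then have "(B * m) * \<bar>t\<bar> \<le> (B * m + 1) * (e / (3 * (B * m + 1)))" using e S m Bm by (intro mult_mono) auto
        also have "\<dots> = e / 3" using Bm by (simp add: field_simps)
        finally show "B * \<bar>t\<bar> * m \<le> e / 3" by (simp add: mult_ac)
      qed
      finally show ?thesis .
    qed
    have "L1norm (\<lambda>x. f (Phi t x) - v (Phi t x)) \<le> ennreal (growth t) * L1norm (\<lambda>x. f x - v x)"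
      using L1norm_Phi_le[of "\<lambda>x. f x - v x" t] by simp
    also have "\<dots> \<le> ennreal C * ennreal e'"
      using growth_mono[of t 1] t1 v(2) by (intro mult_mono) (auto simp: C_def intro!: ennreal_leI)
    also have "\<dots> = ennreal (e/3)" using C e' by (simp add: e'_def flip: ennreal_mult')
    finally have B1: "L1norm (\<lambda>x. f (Phi t x) - v (Phi t x)) \<le> ennreal (e/3)" .
    have B2: "L1norm (\<lambda>x. v x - f x) \<le> ennreal (e/3)"
    proof -
      have "e' \<le> e/3" using e C by (simp add: e'_def field_simps)
      then have "ennreal e' \<le> ennreal (e/3)" by (rule ennreal_leI)
      then show ?thesis using v(2) by (subst L1norm_minus_commute) (rule order_trans)
    qed
    have "L1norm (\<lambda>x. f (Phi t x) - f x) \<le> L1norm (\<lambda>x. f (Phi t x) - v (Phi t x)) + L1norm (\<lambda>x. v (Phi t x) - f x)"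
      by (intro L1norm_triangle) measurable
    also have "L1norm (\<lambda>x. v (Phi t x) - f x) \<le> L1norm (\<lambda>x. v (Phi t x) - v x) + L1norm (\<lambda>x. v x - f x)"
      by (intro L1norm_triangle) measurable
    also have "L1norm (\<lambda>x. f (Phi t x) - v (Phi t x)) + (L1norm (\<lambda>x. v (Phi t x) - v x) + L1norm (\<lambda>x. v x - f x))
      \<le> ennreal (e/3) + (ennreal (e/3) + ennreal (e/3))" by (intro add_mono A B1 B2)
    also have "\<dots> = ennreal e" using e by (simp flip: ennreal_plus)
    finally show "L1norm (\<lambda>x. f (Phi t x) - f x) \<le> ennreal e" by (simp add: add_left_mono)
  qed
qed

text \<open>The obstacle is the boundary: \<open>Phi t\<close> is known to be Lipschitz on \<Omega>
  only, and its extension by the identity may jump there. But the composite vanishes off a compact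
  S, which has positive distance from the complement of \<Omega>.\<close>

lemma lip_compact_Phi:
  assumes v: "lip_compact \<Omega> v"
  shows "lip_compact \<Omega> (\<lambda>x. v (Phi t x))"
proof -
  obtain M S0 where M: "M-lipschitz_on UNIV v" and S0: "compact S0" "S0 \<subseteq> \<Omega>" "\<And>x. x \<notin> S0 \<Longrightarrow> v x = 0"
    using v unfolding lip_compact_def by blast
  have M0: "0 \<le> M" using M by (rule lipschitz_on_nonneg)
  define w where "w x = v (Phi t x)" for x
  define S where "S = reach \<bar>t\<bar> S0"
  have S: "compact S" "S \<subseteq> \<Omega>" unfolding S_def using S0 by (auto intro: compact_reach subsetD[OF reach_subset])
  have w0: "w x = 0" if "x \<notin> S" for x
    using that reachI'[of t "\<bar>t\<bar>" x S0] S0(3) by (auto simp: w_def S_def)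
  have "bounded (v ` S0)" by (intro compact_imp_bounded compact_continuous_image S0 continuous_on_subset[OF lip_compact_continuous[OF v]]) auto
  then obtain b where b: "\<forall>x\<in>S0. \<bar>v x\<bar> \<le> b" by (auto simp: bounded_iff)
  have wb: "\<bar>w x\<bar> \<le> max b 0" for x using b S0(3)[of "Phi t x"] by (cases "Phi t x \<in> S0") (auto simp: w_def)
  obtain \<delta> where \<delta>: "\<delta> > 0" "(\<Union>x\<in>S. cball x \<delta>) \<subseteq> \<Omega>"
    using compact_subset_open_imp_cball_epsilon_subset[OF S(1) open_dom S(2)] by metis
  \<comment> \<open>The first entry serves pairs with both points in \<Omega>; the second serves
    pairs with one point in S and the other off \<Omega>, which are at least \<delta> apart, so that
    the bound on |w| is enough.\<close>
  define K where "K = max (M * exp (L * \<bar>t\<bar>)) (max b 0 / \<delta>)"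
  have K0: "0 \<le> K" using M0 unfolding K_def by (simp add: le_max_iff_disj)
  have key: "\<bar>w x - w y\<bar> \<le> K * norm (x - y)" if x: "x \<in> S" for x y
  proof (cases "y \<in> \<Omega>")
    case True
    have "\<bar>w x - w y\<bar> \<le> M * norm (Phi t x - Phi t y)"
      using lipschitz_onD[OF M, of "Phi t x" "Phi t y"] by (simp add: dist_norm w_def)
    also have "\<dots> \<le> M * (exp (L * \<bar>t\<bar>) * norm (x - y))"
      using lipschitz_onD[OF Phi_lipschitz, of x y t] True x S(2) M0 by (intro mult_left_mono) (auto simp: dist_norm)
    also have "\<dots> \<le> K * norm (x - y)" unfolding mult.assoc[symmetric] by (intro mult_right_mono) (auto simp: K_def)
    finally show ?thesis .
  next
    case False
    then have "y \<notin> cball x \<delta>" using \<delta>(2) x by blast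
    then have n: "\<delta> \<le> norm (x - y)" by (simp add: dist_norm)
    have "w y = 0" using False S(2) w0 by blast
    then have "\<bar>w x - w y\<bar> \<le> max b 0" using wb by simp
    also have "\<dots> = max b 0 / \<delta> * \<delta>" using \<delta>(1) by simp
    also have "\<dots> \<le> K * norm (x - y)" using n \<delta>(1) K0 by (intro mult_mono) (simp_all add: K_def)
    finally show ?thesis .
  qed
  have "K-lipschitz_on UNIV w"
  proof (rule lipschitz_onI)
    fix x y
    show "dist (w x) (w y) \<le> K * dist x y"
    proof (cases "x \<in> S")
      case True
      then show ?thesis using key by (simp add: dist_norm)
    next
      case F: False
      show ?thesis
      proof (cases "y \<in> S")
        case True
        then show ?thesis using key[of y x] by (simp add: dist_norm norm_minus_commute abs_minus_commute)
      next
        case False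
        then show ?thesis using F w0 K0 by simp
      qed
    qed
  qed (rule K0)
  then have "lip_compact \<Omega> w" unfolding lip_compact_def using S w0 by blast
  then show ?thesis by (simp add: w_def[abs_def])
qed

section \<open>The generator and the Lie derivative\<close>

definition time_integral :: "(real^'n \<Rightarrow> real) \<Rightarrow> real \<Rightarrow> real^'n \<Rightarrow> real" where
  "time_integral g t x = (LINT s|lborel. indicator {0..t} s * g (Phi s x))"

text \<open>Kept apart from \<open>time_integral\<close>, which is 0 by convention where the
  integrand is not integrable. For integrable g and fixed t this occurs only on a null set of
  x.\<close>

definition time_integrable :: "(real^'n \<Rightarrow> real) \<Rightarrow> real \<Rightarrow> real^'n \<Rightarrow> bool" where
  "time_integrable g t x \<longleftrightarrow> integrable lborel (\<lambda>s. indicator {0..t} s * g (Phi s x))"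

definition defect :: "(real^'n \<Rightarrow> real) \<Rightarrow> (real^'n \<Rightarrow> real) \<Rightarrow> real \<Rightarrow> real^'n \<Rightarrow> real" where
  "defect f g t x = f (Phi t x) - f x - time_integral g t x"

lemma time_integral_measurable[measurable (raw)]:
  assumes [measurable]: "g \<in> borel_measurable borel" "T \<in> borel_measurable M" "Z \<in> borel_measurable M"
  shows "(\<lambda>w. time_integral g (T w) (Z w)) \<in> borel_measurable M"
proof -
  have "(\<lambda>(w, s). indicator {0..T w} s * g (Phi s (Z w))) =
     (\<lambda>(w, s). (if 0 \<le> s \<and> s \<le> T w then 1 else 0) * g (Phi s (Z w)))"
    by (auto simp: fun_eq_iff indicator_def)
  also have "\<dots> \<in> borel_measurable (M \<Otimes>\<^sub>M lborel)" by measurable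
  finally show ?thesis unfolding time_integral_def by (rule lborel.borel_measurable_lebesgue_integral)
qed

lemma defect_measurable[measurable]:
  assumes [measurable]: "f \<in> borel_measurable borel" "g \<in> borel_measurable borel"
  shows "defect f g t \<in> borel_measurable borel"
  unfolding defect_def by measurable

text \<open>Tonelli, with a general \<open>k s x\<close>: it is applied to g along the flow and to
  the increments of g along the flow.\<close>

lemma nn_time_integral_le:
  assumes [measurable]: "(\<lambda>(x, s). k s x) \<in> borel_measurable (borel \<Otimes>\<^sub>M borel)"
    and t: "0 \<le> t" and B: "\<And>s. 0 \<le> s \<Longrightarrow> s \<le> t \<Longrightarrow> L1norm (k s) \<le> B"
  shows "(\<integral>\<^sup>+(x::real^'n). (\<integral>\<^sup>+s. ennreal \<bar>indicator {0..t} s * k s x\<bar> \<partial>lborel) \<partial>lborel) \<le> ennreal t * B"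
proof -
  have [measurable]: "k s \<in> borel_measurable borel" for s
  proof -
    have "(\<lambda>x. (\<lambda>(x, s). k s x) (x, s)) \<in> borel_measurable borel" by measurable
    then show ?thesis by simp
  qed
  have "(\<integral>\<^sup>+(x::real^'n). (\<integral>\<^sup>+s. ennreal \<bar>indicator {0..t} s * k s x\<bar> \<partial>lborel) \<partial>lborel) =
     (\<integral>\<^sup>+s. (\<integral>\<^sup>+x. ennreal \<bar>indicator {0..t} s * k s x\<bar> \<partial>lborel) \<partial>lborel)"
    by (rule lborel_pair.Fubini'[symmetric]) measurable
  also have "\<dots> \<le> (\<integral>\<^sup>+s. B * indicator {0..t} s \<partial>lborel)"
  proof (intro nn_integral_mono)
    fix s :: real
    show "(\<integral>\<^sup>+x. ennreal \<bar>indicator {0..t} s * k s x\<bar> \<partial>lborel) \<le> B * indicator {0..t} s"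
      using B[of s] by (cases "s \<in> {0..t}") (auto simp: L1norm_def)
  qed
  also have "\<dots> = ennreal t * B" using t by (simp add: nn_integral_cmult mult.commute)
  finally show ?thesis .
qed

lemma L1norm_Phi_le':
  assumes "h \<in> borel_measurable borel" "\<bar>s\<bar> \<le> \<bar>t\<bar>"
  shows "L1norm (\<lambda>x. h (Phi s x)) \<le> ennreal (growth t) * L1norm h"
  using L1norm_Phi_le[OF assms(1), of s] mult_right_mono[OF ennreal_leI[OF growth_mono[OF assms(2)]] zero_le]
  by (rule order_trans)

lemma AE_time_integrable:
  assumes g: "integrable lborel g"
  shows "AE x in lborel. time_integrable g t x"
proof (cases "0 \<le> t")
  case True
  have [measurable]: "g \<in> borel_measurable borel" using g by (simp add: integrable_iff_bounded)
  have "L1norm g < \<infinity>" using g by (simp add: L1norm_finite_iff)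
  then have fin: "ennreal t * (ennreal (growth t) * L1norm g) < \<infinity>" by (simp add: ennreal_mult_less_top)
  have "(\<integral>\<^sup>+x. (\<integral>\<^sup>+s. ennreal \<bar>indicator {0..t} s * g (Phi s x)\<bar> \<partial>lborel) \<partial>lborel) \<le> ennreal t * (ennreal (growth t) * L1norm g)"
    using True by (intro nn_time_integral_le L1norm_Phi_le') auto
  then have "(\<integral>\<^sup>+x. (\<integral>\<^sup>+s. ennreal \<bar>indicator {0..t} s * g (Phi s x)\<bar> \<partial>lborel) \<partial>lborel) \<noteq> \<infinity>" using fin by auto
  then have "AE x in lborel. (\<integral>\<^sup>+s. ennreal \<bar>indicator {0..t} s * g (Phi s x)\<bar> \<partial>lborel) \<noteq> \<infinity>"
    by (rule nn_integral_PInf_AE[rotated]) measurable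
  then show ?thesis
    by eventually_elim (simp add: time_integrable_def integrable_iff_bounded less_top)
next
  case False
  then show ?thesis by (simp add: time_integrable_def)
qed

lemma integrable_indicator_const: "integrable lborel (\<lambda>s::real. indicator {0..t} s * (c::real))"
  by (cases "0 \<le> t") auto

lemma integral_indicator_const: "0 \<le> t \<Longrightarrow> (LINT s|lborel. indicator {0..t} s * (c::real)) = t * c"
  by simp

lemma L1norm_time_integral_diff_le:
  assumes g: "integrable lborel g" and t: "0 \<le> t"
    and B: "\<And>s. 0 \<le> s \<Longrightarrow> s \<le> t \<Longrightarrow> L1norm (\<lambda>x. g (Phi s x) - g x) \<le> B"
  shows "L1norm (\<lambda>x. time_integral g t x - t * g x) \<le> ennreal t * B"
proof -
  have [measurable]: "g \<in> borel_measurable borel" using g by (simp add: integrable_iff_bounded)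
  have "L1norm (\<lambda>x. time_integral g t x - t * g x) \<le>
     (\<integral>\<^sup>+x. (\<integral>\<^sup>+s. ennreal \<bar>indicator {0..t} s * (g (Phi s x) - g x)\<bar> \<partial>lborel) \<partial>lborel)"
    unfolding L1norm_def
  proof (rule nn_integral_mono_AE)
    show "AE x in lborel. ennreal \<bar>time_integral g t x - t * g x\<bar> \<le> (\<integral>\<^sup>+s. ennreal \<bar>indicator {0..t} s * (g (Phi s x) - g x)\<bar> \<partial>lborel)"
      using AE_time_integrable[OF g, of t]
    proof eventually_elim
      case (elim x)
      then have i: "integrable lborel (\<lambda>s. indicator {0..t} s * g (Phi s x))" by (simp add: time_integrable_def)
      have "time_integral g t x - t * g x = (LINT s|lborel. indicator {0..t} s * g (Phi s x)) - (LINT s|lborel. indicator {0..t} s * g x)"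
        unfolding time_integral_def integral_indicator_const[OF t] ..
      also have "\<dots> = (LINT s|lborel. indicator {0..t} s * g (Phi s x) - indicator {0..t} s * g x)"
        by (intro Bochner_Integration.integral_diff[symmetric] i integrable_indicator_const)
      finally have "ennreal \<bar>time_integral g t x - t * g x\<bar> \<le> (\<integral>\<^sup>+s. ennreal (norm (indicator {0..t} s * g (Phi s x) - indicator {0..t} s * g x)) \<partial>lborel)"
        using integral_norm_bound_ennreal[OF Bochner_Integration.integrable_diff[OF i integrable_indicator_const[of t "g x"]]] by simp
      then show ?case by (simp add: right_diff_distrib)
    qed
  qed
  also have "\<dots> \<le> ennreal t * B" using t B by (intro nn_time_integral_le) auto
  finally show ?thesis .
qed

lemma time_integral_add:
  assumes st: "0 \<le> s" "0 \<le> t" and i: "time_integrable g (t + s) x" and [measurable]: "g \<in> borel_measurable borel"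
  shows "time_integral g (t + s) x = time_integral g t x + time_integral g s (Phi t x)"
proof -
  let ?h = "\<lambda>r. g (Phi r x)"
  have i': "integrable lborel (\<lambda>r. indicator {0..t + s} r * ?h r)" using i by (simp add: time_integrable_def)
  have i1: "integrable lborel (\<lambda>r. indicator {0..t} r * ?h r)"
    using st by (intro Bochner_Integration.integrable_bound[OF i']) (auto simp: indicator_def)
  have i2: "integrable lborel (\<lambda>r. indicator {t..t + s} r * ?h r)"
    using st by (intro Bochner_Integration.integrable_bound[OF i']) (auto simp: indicator_def)
  have "time_integral g (t + s) x = (LINT r|lborel. indicator {0..t} r * ?h r + indicator {t..t + s} r * ?h r)"
    unfolding time_integral_def
  proof (rule integral_cong_AE)
    \<comment> \<open>The two closed intervals overlap in the point t, so the integrands agree only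
      almost everywhere.\<close>
    have "AE r in lborel. r \<noteq> t" by (rule AE_lborel_singleton)
    then show "AE r in lborel. indicator {0..t + s} r * ?h r = indicator {0..t} r * ?h r + indicator {t..t + s} r * ?h r"
      by eventually_elim (use st in \<open>auto simp: indicator_def\<close>)
  qed measurable
  also have "\<dots> = time_integral g t x + (LINT r|lborel. indicator {t..t + s} r * ?h r)"
    unfolding time_integral_def by (rule Bochner_Integration.integral_add[OF i1 i2])
  also have "(LINT r|lborel. indicator {t..t + s} r * ?h r) = (LINT r|lborel. indicator {t..t + s} (r + t) * ?h (r + t))"
    by (rule integral_lborel_shift[symmetric]) measurable
  also have "\<dots> = time_integral g s (Phi t x)"
    unfolding time_integral_def by (intro Bochner_Integration.integral_cong) (auto simp: Phi_add indicator_def)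
  finally show ?thesis .
qed

lemma defect_add:
  assumes "integrable lborel g" "0 \<le> s" "0 \<le> t"
  shows "AE x in lborel. defect f g (t + s) x = defect f g t x + defect f g s (Phi t x)"
proof -
  have [measurable]: "g \<in> borel_measurable borel" using assms(1) by (simp add: integrable_iff_bounded)
  show ?thesis
    using AE_time_integrable[OF assms(1), of "t + s"]
  proof eventually_elim
    case (elim x)
    have "Phi s (Phi t x) = Phi (t + s) x" by (simp add: Phi_add[symmetric] add.commute)
    then show ?case using time_integral_add[OF assms(2,3) elim] by (simp add: defect_def)
  qed
qed

lemma L1norm_defect_add_le:
  assumes g: "integrable lborel g" and [measurable]: "f \<in> borel_measurable borel" and "0 \<le> s" "0 \<le> t"
  shows "L1norm (defect f g (t + s)) \<le> L1norm (defect f g t) + ennreal (growth t) * L1norm (defect f g s)"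
proof -
  have [measurable]: "g \<in> borel_measurable borel" using g by (simp add: integrable_iff_bounded)
  have "L1norm (defect f g (t + s)) = L1norm (\<lambda>x. defect f g t x + defect f g s (Phi t x))"
    unfolding L1norm_def by (rule nn_integral_cong_AE) (use defect_add[OF g assms(3,4), of f] in \<open>eventually_elim, simp\<close>)
  also have "\<dots> \<le> L1norm (defect f g t) + L1norm (\<lambda>x. defect f g s (Phi t x))"
    by (intro L1norm_add_le) measurable
  also have "\<dots> \<le> L1norm (defect f g t) + ennreal (growth t) * L1norm (defect f g s)"
    by (intro add_left_mono L1norm_Phi_le) measurable
  finally show ?thesis .
qed

text \<open>Each further step adds the defect of h composed with the flow at an elapsed time of at
  most t, so the single factor \<open>growth t\<close> bounds every summand.\<close>

lemma L1norm_defect_multiple_le: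
  assumes g: "integrable lborel g" and [measurable]: "f \<in> borel_measurable borel" and h: "0 \<le> h" "real k * h \<le> t"
  shows "L1norm (defect f g (real k * h)) \<le> of_nat k * (ennreal (growth t) * L1norm (defect f g h))"
  using h(2)
proof (induction k)
  case 0
  have "defect f g 0 x = 0" for x
  proof -
    have "AE s in lborel. indicator {0..0} s * g (Phi s x) = (0::real)"
      using AE_lborel_singleton[of "0::real"] by eventually_elim auto
    then have "time_integral g 0 x = 0" unfolding time_integral_def by (rule integral_eq_zero_AE)
    then show ?thesis by (simp add: defect_def)
  qed
  then show ?case by (simp add: L1norm_def)
next
  case (Suc k)
  have le: "real k * h \<le> t" using Suc.prems h(1) by (simp add: algebra_simps)
  have kh: "0 \<le> real k * h" using h(1) by simp
  have "L1norm (defect f g (real k * h + h)) \<le> L1norm (defect f g (real k * h)) + ennreal (growth (real k * h)) * L1norm (defect f g h)"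
    by (intro L1norm_defect_add_le g h kh) measurable
  also have "\<dots> \<le> of_nat k * (ennreal (growth t) * L1norm (defect f g h)) + ennreal (growth t) * L1norm (defect f g h)"
    using le kh by (intro add_mono Suc.IH mult_right_mono ennreal_leI growth_mono) auto
  finally show ?case by (simp add: algebra_simps)
qed

section \<open>The integrated identity and the generator\<close>

definition generator_limit :: "(real^'n \<Rightarrow> real) \<Rightarrow> (real^'n \<Rightarrow> real) \<Rightarrow> bool" where
  "generator_limit f g \<longleftrightarrow> ((\<lambda>t. L1norm (\<lambda>x. (f (Phi t x) - f x) / t - g x)) \<longlongrightarrow> 0) (at_right 0)"

text \<open>The exceptional null set may depend on t, in contrast to the Lie derivative with its one
  null set in space-time.\<close>

definition transported :: "(real^'n \<Rightarrow> real) \<Rightarrow> (real^'n \<Rightarrow> real) \<Rightarrow> bool" where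
  "transported f g \<longleftrightarrow> (\<forall>t\<ge>0. AE x in lborel. f (Phi t x) - f x = time_integral g t x)"

lemma L1norm_zero_iff:
  assumes [measurable]: "h \<in> borel_measurable borel"
  shows "L1norm h = 0 \<longleftrightarrow> (AE x in lborel. h x = 0)"
  unfolding L1norm_def by (subst nn_integral_0_iff_AE) auto

text \<open>By the identity, the difference quotient minus g is the time average over [0, t] of the
  increments of g along the flow, which strong continuity makes small in L^1.\<close>

lemma transported_imp_generator_limit:
  assumes [measurable]: "f \<in> borel_measurable borel"
    and g: "integrable lborel g" and g0: "\<And>x. x \<notin> \<Omega> \<Longrightarrow> g x = 0"
    and fg: "transported f g"
  shows "generator_limit f g"
  unfolding generator_limit_def
proof (rule order_tendstoI)
  have [measurable]: "g \<in> borel_measurable borel" using g by (simp add: integrable_iff_bounded)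
  fix a :: ennreal assume "0 < a"
  then obtain b where b: "0 < b" "b < a" using dense by blast
  then have "b < top" by (auto intro: less_le_trans)
  with b obtain e where e: "0 < e" "ennreal e < a" by (cases b) auto
  obtain \<delta> where \<delta>: "\<delta> > 0" "\<And>t. \<bar>t\<bar> \<le> \<delta> \<Longrightarrow> L1norm (\<lambda>x. g (Phi t x) - g x) \<le> ennreal e"
    using L1norm_Phi_continuous[OF g g0 e(1)] by blast
  have "L1norm (\<lambda>x. (f (Phi t x) - f x) / t - g x) \<le> ennreal e" if t: "0 < t" "t < \<delta>" for t
  proof -
    have "AE x in lborel. f (Phi t x) - f x = time_integral g t x" using fg t by (simp add: transported_def)
    then have "AE x in lborel. (f (Phi t x) - f x) / t - g x = (1/t) * (time_integral g t x - t * g x)"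
      by eventually_elim (use t in \<open>simp add: field_simps\<close>)
    then have "L1norm (\<lambda>x. (f (Phi t x) - f x) / t - g x) = L1norm (\<lambda>x. (1/t) * (time_integral g t x - t * g x))"
      unfolding L1norm_def by (intro nn_integral_cong_AE) auto
    also have "\<dots> = ennreal (1/t) * L1norm (\<lambda>x. time_integral g t x - t * g x)" using t by (subst L1norm_cmult) auto
    also have "\<dots> \<le> ennreal (1/t) * (ennreal t * ennreal e)"
      using t by (intro mult_left_mono L1norm_time_integral_diff_le g \<delta>(2)) auto
    also have "\<dots> = ennreal e" using t by (simp flip: mult.assoc ennreal_mult')
    finally show ?thesis .
  qed
  then show "\<forall>\<^sub>F t in at_right 0. L1norm (\<lambda>x. (f (Phi t x) - f x) / t - g x) < a"
    unfolding eventually_at_right_field using \<delta>(1) e(2) by (meson le_less_trans)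
qed simp

text \<open>
  The defect is additive along the flow and \<open>o(h)\<close> for a time step \<open>h\<close>; subdividing \<open>[0, t]\<close>
  into \<open>k\<close> equal steps bounds it by \<open>k o(t / k)\<close>.
\<close>

lemma generator_limit_imp_transported:
  assumes [measurable]: "f \<in> borel_measurable borel"
    and g: "integrable lborel g" and g0: "\<And>x. x \<notin> \<Omega> \<Longrightarrow> g x = 0"
    and fg: "generator_limit f g"
  shows "transported f g"
  unfolding transported_def
proof (intro allI impI)
  fix t :: real assume t0: "0 \<le> t"
  have [measurable]: "g \<in> borel_measurable borel" using g by (simp add: integrable_iff_bounded)
  define C where "C = t * growth t"
  have C: "0 \<le> C" using t0 growth_ge_1[of t] by (simp add: C_def)
  have "L1norm (defect f g t) \<le> 0 + ennreal r" if r: "0 < r" for r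
  proof -
    \<comment> \<open>One step h has a defect of at most 2 h e: h e from the generator limit and h e
      from replacing the time integral of g by h g. Since k h = t, all k steps with the factor
      \<open>growth t\<close> give 2 C e.\<close>
    define e where "e = r / (2 * (C + 1))"
    have e: "0 < e" using r C by (simp add: e_def)
    obtain \<delta> where \<delta>: "\<delta> > 0" "\<And>t. \<bar>t\<bar> \<le> \<delta> \<Longrightarrow> L1norm (\<lambda>x. g (Phi t x) - g x) \<le> ennreal e"
      using L1norm_Phi_continuous[OF g g0 e] by blast
    have "\<forall>\<^sub>F t in at_right 0. L1norm (\<lambda>x. (f (Phi t x) - f x) / t - g x) < ennreal e"
      using fg e unfolding generator_limit_def by (intro order_tendstoD(2)) auto
    then obtain \<eta> where \<eta>: "\<eta> > 0" "\<And>t. 0 < t \<Longrightarrow> t < \<eta> \<Longrightarrow> L1norm (\<lambda>x. (f (Phi t x) - f x) / t - g x) < ennreal e"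
      unfolding eventually_at_right_field by auto
    show ?thesis
    proof (cases "t = 0")
      case True
      then show ?thesis using L1norm_defect_multiple_le[OF g assms(1), of 0 0 0] by simp
    next
      case False
      then have t: "0 < t" using t0 by simp
      obtain k :: nat where "max (t / \<delta>) (t / \<eta>) < real k" using reals_Archimedean2 by blast
      then have k: "t / \<delta> < real k" "t / \<eta> < real k" by auto
      have k0: "0 < real k" using k(1) t \<delta>(1) by (meson divide_pos_pos less_trans)
      define h where "h = t / real k"
      have h: "0 < h" "h < \<delta>" "h < \<eta>" using k k0 t \<delta>(1) \<eta>(1) unfolding h_def
        by (auto simp: field_simps)
      have kh: "real k * h = t" using k0 by (simp add: h_def)
      have "L1norm (defect f g h) \<le> L1norm (\<lambda>x. f (Phi h x) - f x - h * g x) + L1norm (\<lambda>x. h * g x - time_integral g h x)"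
        using L1norm_triangle[of "\<lambda>x. f (Phi h x) - f x" "\<lambda>x. h * g x" "time_integral g h"]
        by (simp add: defect_def[abs_def])
      also have "L1norm (\<lambda>x. f (Phi h x) - f x - h * g x) = L1norm (\<lambda>x. h * ((f (Phi h x) - f x) / h - g x))"
      proof -
        have "f (Phi h x) - f x - h * g x = h * ((f (Phi h x) - f x) / h - g x)" for x
          using h(1) by (simp add: field_simps)
        then show ?thesis by simp
      qed
      also have "\<dots> = ennreal h * L1norm (\<lambda>x. (f (Phi h x) - f x) / h - g x)" using h by (subst L1norm_cmult) auto
      also have "\<dots> \<le> ennreal h * ennreal e" using \<eta>(2)[of h] h by (intro mult_left_mono) auto
      also have "L1norm (\<lambda>x. h * g x - time_integral g h x) \<le> ennreal h * ennreal e"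
        using h by (subst L1norm_minus_commute) (intro L1norm_time_integral_diff_le g \<delta>(2), auto)
      finally have "L1norm (defect f g h) \<le> ennreal (2 * h * e)"
        using h e by (simp add: add_mono mult_ac flip: ennreal_mult' ennreal_plus)
      then have "of_nat k * (ennreal (growth t) * L1norm (defect f g h)) \<le> of_nat k * (ennreal (growth t) * ennreal (2 * h * e))"
        by (intro mult_left_mono) auto
      also have "\<dots> = ennreal (real k * (growth t * (2 * h * e)))"
        using h e growth_ge_1[of t] by (simp add: ennreal_of_nat_eq_real_of_nat ennreal_mult)
      also have "real k * (growth t * (2 * h * e)) = 2 * C * e" unfolding C_def kh[symmetric] by (simp only: mult_ac)
      also have "ennreal (2 * C * e) \<le> ennreal r"
        using C r by (intro ennreal_leI) (simp add: e_def field_simps)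
      finally show ?thesis
        using L1norm_defect_multiple_le[OF g assms(1), of h k t] h kh by (auto intro: order_trans)
    qed
  qed
  then have "L1norm (defect f g t) \<le> 0" by (rule ennreal_le_epsilon)
  then have "L1norm (defect f g t) = 0" by simp
  then have "AE x in lborel. defect f g t x = 0" by (subst (asm) L1norm_zero_iff) auto
  then show "AE x in lborel. f (Phi t x) - f x = time_integral g t x"
    by eventually_elim (simp add: defect_def)
qed

text \<open>Every \<open>t > 0\<close> is a sum of two times outside a given null set.\<close>

lemma transported_if_AE:
  assumes g: "integrable lborel g"
    and ae: "AE t in lborel. 0 < t \<longrightarrow> (AE x in lborel. f (Phi t x) - f x = time_integral g t x)"
  shows "transported f g"
  unfolding transported_def
proof (intro allI impI)
  fix t :: real assume t0: "0 \<le> t"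
  let ?Q = "\<lambda>t. 0 < t \<longrightarrow> (AE x in lborel. defect f g t x = 0)"
  have Q: "AE s in lborel. ?Q s"
    using ae by (simp add: defect_def)
  have "AE x in lborel. defect f g t x = 0"
  proof (cases "t = 0")
    case True
    have "AE s in lborel. indicator {0..0} s * g (Phi s x) = (0::real)" for x
      using AE_lborel_singleton[of "0::real"] by eventually_elim auto
    then have "time_integral g 0 x = 0" for x unfolding time_integral_def by (rule integral_eq_zero_AE)
    then show ?thesis using True by (simp add: defect_def)
  next
    case False
    then have t: "0 < t" using t0 by simp
    \<comment> \<open>The reflection of s to t - s preserves null sets, so for almost every s in the
      interval from 0 to t both s and t - s are admissible times.\<close>
    obtain N where N: "N \<in> null_sets lborel" "{s. \<not> ?Q s} \<subseteq> N"
      using Q by (auto simp: eventually_ae_filter)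
    have Nb[measurable]: "N \<in> sets borel" using N(1) by auto
    have "(\<integral>\<^sup>+s. indicator N (t - s) \<partial>lborel) = (\<integral>\<^sup>+s. indicator N s \<partial>lborel)"
      by (rule nn_integral_lborel_reflect) measurable
    also have "\<dots> = 0" using N(1) by (simp add: nn_integral_indicator null_sets_def)
    finally have "AE s in lborel. indicator N (t - s) = (0::ennreal)"
      by (subst (asm) nn_integral_0_iff_AE) auto
    then have "AE s in lborel. ?Q (t - s)"
    proof eventually_elim
      case (elim s)
      then have "t - s \<notin> N" by (auto simp: indicator_def)
      then show ?case using N(2) by blast
    qed
    then have "AE s in lborel. ?Q s \<and> ?Q (t - s)" using Q by eventually_elim blast
    then obtain M where M: "M \<in> null_sets lborel" "{s. \<not> (?Q s \<and> ?Q (t - s))} \<subseteq> M"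
      by (auto simp: eventually_ae_filter)
    have "\<not> {0<..<t} \<subseteq> M"
    proof
      assume "{0<..<t} \<subseteq> M"
      then have "{0<..<t} \<in> null_sets lborel" using M(1) by (auto intro: null_sets_subset)
      then show False using t by (simp add: null_sets_def)
    qed
    then obtain s where s: "0 < s" "s < t" "s \<notin> M" by (metis greaterThanLessThan_iff subsetI)
    then have "?Q s \<and> ?Q (t - s)" using M(2) by blast
    have "AE x in lborel. defect f g (t - s) x = 0" "AE x in lborel. defect f g s x = 0"
      using s \<open>?Q s \<and> ?Q (t - s)\<close> by auto
    note * = AE_Phi[OF this(1), of s] this(2) defect_add[OF g, of "t - s" s f]
    show ?thesis using *(1,2) *(3) s
      by (auto elim: eventually_elim2)
  qed
  then show "AE x in lborel. f (Phi t x) - f x = time_integral g t x"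
    by eventually_elim (simp add: defect_def)
qed

end

section \<open>The commutator of mollification with the field\<close>

text \<open>McShane's construction: the infimum of the cones of slope L over the points of the
  graph.\<close>

lemma lipschitz_extend_real:
  fixes u :: "'a::metric_space \<Rightarrow> real"
  assumes u: "L-lipschitz_on S u"
  shows "\<exists>w. L-lipschitz_on UNIV w \<and> (\<forall>x\<in>S. w x = u x)"
proof (cases "S = {}")
  case True
  have "L-lipschitz_on UNIV (\<lambda>_::'a. 0::real)" using lipschitz_on_nonneg[OF u] by (intro lipschitz_onI) auto
  then show ?thesis using True by blast
next
  case False
  then obtain z where z: "z \<in> S" by blast
  have L: "0 \<le> L" using u by (rule lipschitz_on_nonneg)
  define w where "w x = (INF y\<in>S. u y + L * dist x y)" for x
  have low: "u z - L * dist x z \<le> u y + L * dist x y" if "y \<in> S" "z \<in> S" for x y z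
  proof -
    have "u z - u y \<le> L * dist z y" using lipschitz_onD[OF u that(2,1)] by (simp add: dist_real_def abs_le_iff)
    also have "\<dots> \<le> L * (dist x z + dist x y)" using L by (intro mult_left_mono) (auto simp: dist_triangle3)
    finally show ?thesis by (simp add: algebra_simps)
  qed
  have bdd: "bdd_below ((\<lambda>y. u y + L * dist x y) ` S)" for x
    using low[OF _ z] by (intro bdd_belowI2)
  have upper: "w x \<le> u y + L * dist x y" if "y \<in> S" for x y
    unfolding w_def using that by (intro cINF_lower bdd)
  have eq: "w x = u x" if "x \<in> S" for x
  proof (rule antisym)
    show "w x \<le> u x" using upper[OF that, of x] by simp
    show "u x \<le> w x" unfolding w_def using low[OF _ that, of _ x] False by (intro cINF_greatest) auto
  qed
  have half: "w x - w x' \<le> L * dist x x'" for x x'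
  proof -
    have "w x - L * dist x x' \<le> u y + L * dist x' y" if "y \<in> S" for y
    proof -
      have "L * dist x y \<le> L * (dist x x' + dist x' y)" using L by (intro mult_left_mono dist_triangle)
      then show ?thesis using upper[OF that, of x] by (simp add: algebra_simps)
    qed
    then have "w x - L * dist x x' \<le> w x'" unfolding w_def[of x'] using False by (intro cINF_greatest) auto
    then show ?thesis by simp
  qed
  have "L-lipschitz_on UNIV w"
  proof (rule lipschitz_onI)
    show "dist (w x) (w y) \<le> L * dist x y" for x y
      using half[of x y] half[of y x] by (simp add: dist_real_def abs_le_iff dist_commute)
  qed (rule L)
  then show ?thesis using eq by blast
qed

lemma partial_deriv_reflect:
  fixes \<kappa> :: "real^'n \<Rightarrow> real"
  assumes "\<kappa> differentiable (at (x - y))"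
  shows "partial_deriv i (\<lambda>y. \<kappa> (x - y)) y = - partial_deriv i \<kappa> (x - y)"
proof -
  obtain D where D: "(\<kappa> has_derivative D) (at (x - y))" using assms by (auto simp: differentiable_def)
  have "((\<lambda>y. \<kappa> (x - y)) has_derivative (\<lambda>h. D (- h))) (at y)"
    by (rule has_derivative_compose[of "\<lambda>y. x - y" "\<lambda>h. - h" y UNIV \<kappa> D])
       (use D in \<open>auto intro!: derivative_eq_intros\<close>)
  then have "partial_deriv i (\<lambda>y. \<kappa> (x - y)) y = D (- axis i 1)"
    unfolding partial_deriv_eq_dir_deriv by (rule has_derivative_dir_deriv(2))
  also have "\<dots> = - D (axis i 1)" by (rule linear_neg[OF has_derivative_linear[OF D]])
  finally show ?thesis by (simp add: partial_deriv_eq_dir_deriv has_derivative_dir_deriv(2)[OF D])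
qed

lemma norm_axis_1: "norm (axis i 1 :: real^'n) = 1"
  using axis_in_Basis_iff[of i "1::real"] by (intro norm_Basis) auto

context complete_lipschitz_field
begin

text \<open>With a Lipschitz extension of \<open>X\<close>, integration by parts can be done on the whole space.\<close>

definition field_ext :: "'n \<Rightarrow> real^'n \<Rightarrow> real" where
  "field_ext i = (SOME w. L-lipschitz_on UNIV w \<and> (\<forall>x\<in>\<Omega>. w x = X x $ i))"

lemma field_ext: "L-lipschitz_on UNIV (field_ext i)" "x \<in> \<Omega> \<Longrightarrow> field_ext i x = X x $ i"
proof -
  have "L-lipschitz_on \<Omega> (\<lambda>x. X x $ i)"
  proof (rule lipschitz_onI)
    fix x y assume "x \<in> \<Omega>" "y \<in> \<Omega>"
    have "dist (X x $ i) (X y $ i) \<le> dist (X x) (X y)" by (rule dist_vec_nth_le)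
    also have "\<dots> \<le> L * dist x y" using lipschitz \<open>x \<in> \<Omega>\<close> \<open>y \<in> \<Omega>\<close> by (rule lipschitz_onD)
    finally show "dist (X x $ i) (X y $ i) \<le> L * dist x y" .
  qed (rule L_nonneg)
  from someI_ex[OF lipschitz_extend_real[OF this]]
  show "L-lipschitz_on UNIV (field_ext i)" "x \<in> \<Omega> \<Longrightarrow> field_ext i x = X x $ i"
    unfolding field_ext_def by auto
qed

lemma field_ext_continuous: "continuous_on UNIV (field_ext i)"
  using field_ext(1) by (rule lipschitz_on_continuous_on)

lemma field_ext_measurable[measurable]: "field_ext i \<in> borel_measurable borel"
  by (intro borel_measurable_continuous_onI field_ext_continuous)

abbreviation field_deriv :: "(real^'n \<Rightarrow> real) \<Rightarrow> real^'n \<Rightarrow> real" where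
  "field_deriv u x \<equiv> \<Sum>i\<in>UNIV. field_ext i x * partial_deriv i u x"

definition Div :: "real^'n \<Rightarrow> real" where
  "Div x = (\<Sum>i\<in>UNIV. dir_deriv (field_ext i) (axis i 1) x)"

lemma Div_measurable[measurable]: "Div \<in> borel_measurable borel"
proof -
  note [measurable] = borel_measurable_dir_deriv[OF field_ext(1)]
  show ?thesis unfolding Div_def[abs_def] by measurable
qed

lemma Div_AE_bounded: "AE x in lborel. \<bar>Div x\<bar> \<le> CARD('n) * L"
proof -
  have "AE x in lborel. \<forall>i::'n\<in>UNIV. x \<notin> non_diff (field_ext i) (axis i 1)"
    by (rule AE_finite_allI) (auto intro: AE_not_non_diff[OF field_ext(1)])
  then show ?thesis
  proof eventually_elim
    case (elim x)
    have "\<bar>Div x\<bar> \<le> (\<Sum>i\<in>(UNIV::'n set). L * norm (axis i 1 :: real^'n))"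
      unfolding Div_def using elim
      by (intro order_trans[OF sum_abs] sum_mono dir_deriv_works(3)[OF field_ext(1)]) auto
    then show ?case by (simp add: norm_axis_1)
  qed
qed

text \<open>The extension agrees with X near x because \<Omega> is open, and \<open>deriv\<close>
  depends only on the germ. So the values coincide at every point of \<Omega>, even where a partial
  derivative fails to exist.\<close>

lemma Div_eq: "x \<in> \<Omega> \<Longrightarrow> divergence X x = Div x"
  unfolding divergence_def Div_def partial_deriv_def dir_deriv_def
proof (intro sum.cong refl deriv_cong_ev)
  fix i :: 'n assume x: "x \<in> \<Omega>"
  have "open ((\<lambda>h::real. x + h *\<^sub>R axis i 1) -` \<Omega>)"
    using open_dom by (intro continuous_open_vimage) (auto intro!: continuous_intros)
  then have "\<forall>\<^sub>F h in nhds (0::real). h \<in> (\<lambda>h::real. x + h *\<^sub>R axis i 1) -` \<Omega>"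
    using x by (intro eventually_nhds_in_open) auto
  then show "\<forall>\<^sub>F h in nhds 0. X (x + h *\<^sub>R axis i 1) $ i = field_ext i (x + h *\<^sub>R axis i 1)"
    by eventually_elim (simp add: field_ext(2))
qed

section \<open>The commutator kernel\<close>

definition distributional :: "(real^'n \<Rightarrow> real) \<Rightarrow> (real^'n \<Rightarrow> real) \<Rightarrow> bool" where
  "distributional f g \<longleftrightarrow> (\<forall>u. test_function \<Omega> u \<longrightarrow>
     (LINT x|lborel. g x * u x) =
       - (LINT x|lborel. f x * field_deriv u x)
       - (LINT x|lborel. f x * (u x * Div x)))"

text \<open>The derivative of \<open>mollify \<epsilon> f\<close> along the field, with the
  differentiation carried out on the kernel. The field stands at the point x of evaluation and not
  at the integration variable.\<close>

definition moll_deriv :: "real \<Rightarrow> (real^'n \<Rightarrow> real) \<Rightarrow> real^'n \<Rightarrow> real" where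
  "moll_deriv \<epsilon> f x = (LINT y|lborel. f y * (\<Sum>i\<in>UNIV. field_ext i x * partial_deriv i (kern \<epsilon>) (x - y)))"

text \<open>Testing the weak equation with the kernel at x - y, as a function of y, produces the
  field at y and a divergence term; differentiating the mollification produces the field at x. Their
  difference is integration of f against this kernel, the reflection accounting for the sign of the
  gradient.\<close>

definition commutator_kern :: "real \<Rightarrow> real^'n \<Rightarrow> real^'n \<Rightarrow> real" where
  "commutator_kern \<epsilon> x y = (\<Sum>i\<in>UNIV. (field_ext i x - field_ext i y) * partial_deriv i (kern \<epsilon>) (x - y)) + kern \<epsilon> (x - y) * Div y"

text \<open>Depends on x - y alone, so that the convolution estimate applies. The factor
  \<open>L * \<epsilon>\<close> replaces the difference of the field at x and y, which is legitimate
  because the gradient of the kernel vanishes beyond distance \<epsilon>.\<close>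

definition commutator_kern_bound :: "real \<Rightarrow> real^'n \<Rightarrow> real" where
  "commutator_kern_bound \<epsilon> w = (\<Sum>i\<in>UNIV. L * \<epsilon> * \<bar>partial_deriv i (kern \<epsilon>) w\<bar>) + kern \<epsilon> w * (CARD('n) * L)"

lemma partial_kern_measurable[measurable]: "partial_deriv i (kern \<epsilon> :: real^'n \<Rightarrow> real) \<in> borel_measurable borel"
  by (intro borel_measurable_continuous_onI smooth_expr_continuous smooth_expr_partial_deriv kern_smooth)

lemma commutator_kern_measurable[measurable]: "commutator_kern \<epsilon> x \<in> borel_measurable borel"
  unfolding commutator_kern_def[abs_def] by measurable

lemma commutator_kern_bound_measurable[measurable]: "commutator_kern_bound \<epsilon> \<in> borel_measurable borel"
  unfolding commutator_kern_bound_def[abs_def] by measurable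

lemma moll_deriv_measurable[measurable]:
  assumes [measurable]: "f \<in> borel_measurable borel"
  shows "moll_deriv \<epsilon> f \<in> borel_measurable borel"
  unfolding moll_deriv_def[abs_def] by measurable

lemma partial_kern_zero: "0 < \<epsilon> \<Longrightarrow> \<epsilon> < norm w \<Longrightarrow> partial_deriv i (kern \<epsilon>) (w :: real^'n) = 0"
proof -
  assume \<epsilon>: "0 < \<epsilon>" "\<epsilon> < norm w"
  have "kern \<epsilon> z = 0" if "z \<notin> cball 0 \<epsilon>" for z :: "real^'n" using kern_zero[OF \<epsilon>(1), of z] that by auto
  then show ?thesis using \<epsilon>(2) by (intro partial_deriv_zero_off[of "cball 0 \<epsilon>"]) auto
qed

lemma commutator_kern_le:
  assumes \<epsilon>: "0 < \<epsilon>"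
  shows "AE y in lborel. \<bar>commutator_kern \<epsilon> x y\<bar> \<le> commutator_kern_bound \<epsilon> (x - y)"
  using Div_AE_bounded
proof eventually_elim
  case (elim y)
  have "\<bar>(field_ext i x - field_ext i y) * partial_deriv i (kern \<epsilon>) (x - y)\<bar> \<le> L * \<epsilon> * \<bar>partial_deriv i (kern \<epsilon>) (x - y)\<bar>" for i
  proof (cases "\<epsilon> < norm (x - y)")
    case True
    then show ?thesis using partial_kern_zero[OF \<epsilon>, of "x - y"] by simp
  next
    case False
    have "\<bar>field_ext i x - field_ext i y\<bar> \<le> L * norm (x - y)"
      using lipschitz_onD[OF field_ext(1), of x y i] by (simp add: dist_norm)
    also have "\<dots> \<le> L * \<epsilon>" using False L_nonneg by (intro mult_left_mono) auto
    finally show ?thesis unfolding abs_mult by (rule mult_right_mono) simp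
  qed
  then have "\<bar>\<Sum>i\<in>UNIV. (field_ext i x - field_ext i y) * partial_deriv i (kern \<epsilon>) (x - y)\<bar> \<le> (\<Sum>i\<in>UNIV. L * \<epsilon> * \<bar>partial_deriv i (kern \<epsilon>) (x - y)\<bar>)"
    by (intro order_trans[OF sum_abs] sum_mono)
  moreover have "\<bar>kern \<epsilon> (x - y) * Div y\<bar> \<le> kern \<epsilon> (x - y) * (CARD('n) * L)"
    using elim kern_nonneg[OF \<epsilon>, of "x - y"] by (simp add: abs_mult mult_left_mono)
  ultimately show ?case unfolding commutator_kern_def commutator_kern_bound_def by linarith
qed

lemma commutator_kern_bound_bounded: "0 < \<epsilon> \<Longrightarrow> \<exists>B. \<forall>w. commutator_kern_bound \<epsilon> w \<le> B"
proof -
  assume \<epsilon>: "0 < \<epsilon>"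
  obtain b where b: "\<And>w::real^'n. \<bar>kern \<epsilon> w\<bar> \<le> b" using kern_bounded by metis
  have "\<forall>i. \<exists>B. \<forall>w. \<bar>partial_deriv i (kern \<epsilon>) (w :: real^'n)\<bar> \<le> B" using partial_deriv_kern_bounded[OF \<epsilon>] by blast
  then obtain B where B: "\<And>i w. \<bar>partial_deriv i (kern \<epsilon>) (w :: real^'n)\<bar> \<le> B i" by metis
  have "commutator_kern_bound \<epsilon> w \<le> (\<Sum>i\<in>UNIV. L * \<epsilon> * B i) + b * (CARD('n) * L)" for w
    unfolding commutator_kern_bound_def using L_nonneg \<epsilon> b[of w]
    by (intro add_mono sum_mono mult_left_mono B mult_right_mono) (auto simp: abs_le_iff)
  then show ?thesis by blast
qed

text \<open>The factor \<epsilon> from the Lipschitz field cancels the 1/\<epsilon> in the L^1 norm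
  of the gradient of the kernel, so C is the same for all \<epsilon>.\<close>

lemma nn_integral_commutator_kern_bound:
  "\<exists>C\<ge>0. \<forall>\<epsilon>>0. (\<integral>\<^sup>+w. ennreal (commutator_kern_bound \<epsilon> w) \<partial>lborel) \<le> ennreal C"
proof -
  obtain c where c: "0 \<le> c" "\<And>\<epsilon> i. 0 < \<epsilon> \<Longrightarrow> L1norm (partial_deriv i (kern \<epsilon> :: real^'n \<Rightarrow> real)) \<le> ennreal (c / \<epsilon>)"
    using L1norm_partial_deriv_kern by blast
  define C where "C = CARD('n) * (L * c) + CARD('n) * L"
  have "(\<integral>\<^sup>+w. ennreal (commutator_kern_bound \<epsilon> w) \<partial>lborel) \<le> ennreal C" if \<epsilon>: "0 < \<epsilon>" for \<epsilon>
  proof -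
    have "(\<integral>\<^sup>+w. ennreal (commutator_kern_bound \<epsilon> w) \<partial>lborel) =
      (\<integral>\<^sup>+w. (\<Sum>i\<in>(UNIV::'n set). ennreal (L * \<epsilon>) * ennreal \<bar>partial_deriv i (kern \<epsilon>) w\<bar>) + ennreal (kern \<epsilon> w) * ennreal (CARD('n) * L) \<partial>lborel)"
    proof (intro nn_integral_cong)
      fix w :: "real^'n"
      have "ennreal (commutator_kern_bound \<epsilon> w) = ennreal (\<Sum>i\<in>UNIV. L * \<epsilon> * \<bar>partial_deriv i (kern \<epsilon>) w\<bar>) + ennreal (kern \<epsilon> w * (CARD('n) * L))"
        unfolding commutator_kern_bound_def using L_nonneg \<epsilon> kern_nonneg[OF \<epsilon>, of w] by (intro ennreal_plus sum_nonneg) auto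
      also have "ennreal (\<Sum>i\<in>UNIV. L * \<epsilon> * \<bar>partial_deriv i (kern \<epsilon>) w\<bar>) = (\<Sum>i\<in>UNIV. ennreal (L * \<epsilon> * \<bar>partial_deriv i (kern \<epsilon>) w\<bar>))"
        using L_nonneg \<epsilon> by (intro sum_ennreal[symmetric]) auto
      finally show "ennreal (commutator_kern_bound \<epsilon> w) = (\<Sum>i\<in>UNIV. ennreal (L * \<epsilon>) * ennreal \<bar>partial_deriv i (kern \<epsilon>) w\<bar>) + ennreal (kern \<epsilon> w) * ennreal (CARD('n) * L)"
        using L_nonneg \<epsilon> kern_nonneg[OF \<epsilon>, of w] by (simp add: ennreal_mult)
    qed
    also have "\<dots> = (\<Sum>i\<in>(UNIV::'n set). ennreal (L * \<epsilon>) * L1norm (partial_deriv i (kern \<epsilon> :: real^'n \<Rightarrow> real))) + ennreal (CARD('n) * L)"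
      by (simp add: nn_integral_add nn_integral_sum nn_integral_cmult nn_integral_multc nn_integral_kern[OF \<epsilon>] L1norm_def)
    also have "\<dots> \<le> (\<Sum>i\<in>(UNIV::'n set). ennreal (L * \<epsilon>) * ennreal (c / \<epsilon>)) + ennreal (CARD('n) * L)"
      by (intro add_right_mono sum_mono mult_left_mono c(2) \<epsilon>) auto
    also have "\<dots> = (\<Sum>i\<in>(UNIV::'n set). ennreal (L * c)) + ennreal (CARD('n) * L)"
      using \<epsilon> L_nonneg c(1) by (simp flip: ennreal_mult)
    also have "\<dots> = ennreal C"
      using L_nonneg c(1) by (simp add: C_def ennreal_mult ennreal_plus ennreal_of_nat_eq_real_of_nat)
    finally show ?thesis .
  qed
  moreover have "0 \<le> C" using L_nonneg c(1) by (simp add: C_def)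
  ultimately show ?thesis by blast
qed

text \<open>The weak equation is used on these test functions only; this is where points near the
  boundary have to be excluded.\<close>

lemma test_function_kern:
  assumes \<epsilon>: "0 < \<epsilon>" and x: "cball x \<epsilon> \<subseteq> \<Omega>"
  shows "test_function \<Omega> (\<lambda>y. kern \<epsilon> (x - y))"
proof -
  have "{y. kern \<epsilon> (x - y) \<noteq> 0} \<subseteq> cball x \<epsilon>" using kern_reflect_lipschitz(2)[OF \<epsilon>, of _ x] by blast
  then have sub: "closure {y. kern \<epsilon> (x - y) \<noteq> 0} \<subseteq> cball x \<epsilon>" by (intro closure_minimal) auto
  then have "compact (closure {y. kern \<epsilon> (x - y) \<noteq> 0})"
    by (auto simp: compact_eq_bounded_closed intro: bounded_subset)
  then show ?thesis unfolding test_function_def using sub x smooth_expr_C_k[OF kern_reflect_smooth] by blast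
qed

lemma partial_kern_reflect: "partial_deriv i (\<lambda>y. kern \<epsilon> (x - y)) y = - partial_deriv i (kern \<epsilon>) (x - y :: real^'n)"
  by (intro partial_deriv_reflect smooth_expr_differentiable kern_smooth)

text \<open>Integration by parts in y. The part with the field at x integrates to 0, since that
  coefficient is constant in y; the part with the field at y cancels the divergence term.\<close>

lemma integral_commutator_kern:
  assumes \<epsilon>: "0 < \<epsilon>"
  shows "integrable lborel (commutator_kern \<epsilon> x)" "(LINT y|lborel. commutator_kern \<epsilon> x y) = 0"
proof -
  let ?U = "\<lambda>y. kern \<epsilon> (x - y)"
  obtain K where K: "K-lipschitz_on UNIV ?U" using kern_reflect_lipschitz(1)[OF \<epsilon>] by blast
  note U0 = kern_reflect_lipschitz(2)[OF \<epsilon>, of _ x]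
  note P = lipschitz_integral_by_parts[OF _ K compact_cball[of x \<epsilon>] U0]
  have cl: "0-lipschitz_on UNIV (\<lambda>_::real^'n. field_ext i x)" for i by (intro lipschitz_onI) auto
  have dU: "dir_deriv ?U (axis i 1) y = - partial_deriv i (kern \<epsilon>) (x - y)" for i y
    using partial_kern_reflect[of i \<epsilon> x y] by (simp add: partial_deriv_eq_dir_deriv)
  have P1: "integrable lborel (\<lambda>y. field_ext i y * partial_deriv i (kern \<epsilon>) (x - y))" for i
    using P(1)[OF field_ext(1)[of i], where e="axis i 1"] by (simp add: dU)
  have Q1: "integrable lborel (\<lambda>y. field_ext i x * partial_deriv i (kern \<epsilon>) (x - y))" for i
    using P(1)[OF cl[of i], where e="axis i 1"] by (simp add: dU)
  have P3: "(LINT y|lborel. field_ext i y * partial_deriv i (kern \<epsilon>) (x - y)) = (LINT y|lborel. ?U y * dir_deriv (field_ext i) (axis i 1) y)" for i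
    using P(3)[OF field_ext(1)[of i], where e="axis i 1"] by (simp add: dU)
  have "dir_deriv (\<lambda>_. field_ext i x) e y = 0" for i and e y :: "real^'n" by (simp add: dir_deriv_def)
  then have Q3: "(LINT y|lborel. field_ext i x * partial_deriv i (kern \<epsilon>) (x - y)) = 0" for i
    using P(3)[OF cl[of i], where e="axis i 1"] by (simp add: dU)
  have eq: "commutator_kern \<epsilon> x = (\<lambda>y. (\<Sum>i\<in>UNIV. (field_ext i x * partial_deriv i (kern \<epsilon>) (x - y) - field_ext i y * partial_deriv i (kern \<epsilon>) (x - y))
       + ?U y * dir_deriv (field_ext i) (axis i 1) y))"
    by (simp add: commutator_kern_def fun_eq_iff Div_def sum_distrib_left left_diff_distrib sum.distrib)
  show "integrable lborel (commutator_kern \<epsilon> x)" unfolding eq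
    by (intro Bochner_Integration.integrable_sum Bochner_Integration.integrable_add Bochner_Integration.integrable_diff P1 Q1 P(2)[OF field_ext(1)])
  have "(LINT y|lborel. commutator_kern \<epsilon> x y) = (\<Sum>i\<in>UNIV. (LINT y|lborel. field_ext i x * partial_deriv i (kern \<epsilon>) (x - y)) - (LINT y|lborel. field_ext i y * partial_deriv i (kern \<epsilon>) (x - y))
       + (LINT y|lborel. ?U y * dir_deriv (field_ext i) (axis i 1) y))"
    unfolding eq using P1 Q1 P(2)[OF field_ext(1)] by (simp add: Bochner_Integration.integral_sum)
  then show "(LINT y|lborel. commutator_kern \<epsilon> x y) = 0" by (simp add: P3 Q3 del: integral_mult_right_zero)
qed

text \<open>
  The commutator of mollification with \<open>X\<close>. Since its kernel has mean zero, it acts on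
  the increments \<open>f y - f x\<close>; since \<open>X\<close> is Lipschitz, the kernel is bounded in \<open>L\<^sup>1\<close> uniformly in \<open>\<epsilon>\<close>.
\<close>

lemma commutator_le:
  assumes f: "integrable lborel f" and g: "integrable lborel g" and fg: "distributional f g"
    and \<epsilon>: "0 < \<epsilon>" and x: "cball x \<epsilon> \<subseteq> \<Omega>"
  shows "ennreal \<bar>moll_deriv \<epsilon> f x - mollify \<epsilon> g x\<bar> \<le> (\<integral>\<^sup>+y. ennreal \<bar>f y - f x\<bar> * ennreal (commutator_kern_bound \<epsilon> (x - y)) \<partial>lborel)"
proof -
  have [measurable]: "f \<in> borel_measurable borel" "g \<in> borel_measurable borel"
    using f g by (auto simp: integrable_iff_bounded)
  let ?U = "\<lambda>y. kern \<epsilon> (x - y)"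
  obtain B where B: "\<And>w. commutator_kern_bound \<epsilon> w \<le> B" using commutator_kern_bound_bounded[OF \<epsilon>] by blast
  have "AE y in lborel. \<bar>commutator_kern \<epsilon> x y\<bar> \<le> B" using commutator_kern_le[OF \<epsilon>, of x] by eventually_elim (use B order_trans in blast)
  then have if1: "integrable lborel (\<lambda>y. f y * commutator_kern \<epsilon> x y)" by (intro integrable_mult_AE_bounded f) auto
  obtain b where b: "\<And>w::real^'n. \<bar>kern \<epsilon> w\<bar> \<le> b" using kern_bounded by metis
  have "AE y in lborel. \<bar>?U y * Div y\<bar> \<le> b * (CARD('n) * L)"
    using Div_AE_bounded by eventually_elim (auto simp: abs_mult intro!: mult_mono b order_trans[OF abs_ge_zero b])
  then have if2: "integrable lborel (\<lambda>y. f y * (?U y * Div y))" by (intro integrable_mult_AE_bounded f) auto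
  have "\<forall>i. \<exists>B. \<forall>w. \<bar>partial_deriv i (kern \<epsilon>) (w :: real^'n)\<bar> \<le> B" using partial_deriv_kern_bounded[OF \<epsilon>] by blast
  then obtain P where P: "\<And>i w. \<bar>partial_deriv i (kern \<epsilon>) (w :: real^'n)\<bar> \<le> P i" by metis
  have "\<bar>\<Sum>i\<in>UNIV. field_ext i x * partial_deriv i (kern \<epsilon>) (x - y)\<bar> \<le> (\<Sum>i\<in>UNIV. \<bar>field_ext i x\<bar> * P i)" for y
    by (intro order_trans[OF sum_abs] sum_mono) (auto simp: abs_mult intro!: mult_left_mono P)
  then have if3: "integrable lborel (\<lambda>y. f y * (\<Sum>i\<in>UNIV. field_ext i x * partial_deriv i (kern \<epsilon>) (x - y)))"
    by (intro integrable_mult_bounded f) auto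
  have split: "commutator_kern \<epsilon> x y = (\<Sum>i\<in>UNIV. field_ext i x * partial_deriv i (kern \<epsilon>) (x - y)) - (\<Sum>i\<in>UNIV. field_ext i y * partial_deriv i (kern \<epsilon>) (x - y)) + ?U y * Div y" for y
    by (simp add: commutator_kern_def left_diff_distrib sum_subtractf)
  \<comment> \<open>Read off from the other three terms, without a bound on the field at y.\<close>
  have if4: "integrable lborel (\<lambda>y. f y * (\<Sum>i\<in>UNIV. field_ext i y * partial_deriv i (kern \<epsilon>) (x - y)))"
  proof -
    have "(\<lambda>y. f y * (\<Sum>i\<in>UNIV. field_ext i y * partial_deriv i (kern \<epsilon>) (x - y))) =
       (\<lambda>y. f y * (\<Sum>i\<in>UNIV. field_ext i x * partial_deriv i (kern \<epsilon>) (x - y)) + f y * (?U y * Div y) - f y * commutator_kern \<epsilon> x y)"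
      by (simp add: split algebra_simps)
    then show ?thesis using if1 if2 if3 by simp
  qed
  have "mollify \<epsilon> g x = (LINT y|lborel. g y * ?U y)" by (simp add: mollify_def)
  also have "\<dots> = - (LINT y|lborel. f y * (\<Sum>i\<in>UNIV. field_ext i y * partial_deriv i ?U y)) - (LINT y|lborel. f y * (?U y * Div y))"
    using fg test_function_kern[OF \<epsilon> x] unfolding distributional_def by blast
  also have "\<dots> = (LINT y|lborel. f y * (\<Sum>i\<in>UNIV. field_ext i y * partial_deriv i (kern \<epsilon>) (x - y))) - (LINT y|lborel. f y * (?U y * Div y))"
    by (simp add: partial_kern_reflect sum_negf)
  finally have "moll_deriv \<epsilon> f x - mollify \<epsilon> g x = (LINT y|lborel. f y * (\<Sum>i\<in>UNIV. field_ext i x * partial_deriv i (kern \<epsilon>) (x - y))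
      - f y * (\<Sum>i\<in>UNIV. field_ext i y * partial_deriv i (kern \<epsilon>) (x - y)) + f y * (?U y * Div y))"
    unfolding moll_deriv_def using if2 if3 if4 by simp
  also have "\<dots> = (LINT y|lborel. f y * commutator_kern \<epsilon> x y)"
    by (intro Bochner_Integration.integral_cong) (auto simp: split algebra_simps)
  also have "\<dots> = (LINT y|lborel. f y * commutator_kern \<epsilon> x y) - (LINT y|lborel. f x * commutator_kern \<epsilon> x y)"
    using integral_commutator_kern[OF \<epsilon>, of x] by simp
  also have "\<dots> = (LINT y|lborel. f y * commutator_kern \<epsilon> x y - f x * commutator_kern \<epsilon> x y)"
    using if1 integral_commutator_kern(1)[OF \<epsilon>, of x] by (intro Bochner_Integration.integral_diff[symmetric]) auto
  finally have "ennreal \<bar>moll_deriv \<epsilon> f x - mollify \<epsilon> g x\<bar> \<le> (\<integral>\<^sup>+y. ennreal (norm (f y * commutator_kern \<epsilon> x y - f x * commutator_kern \<epsilon> x y)) \<partial>lborel)"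
    using integral_norm_bound_ennreal[of lborel "\<lambda>y. f y * commutator_kern \<epsilon> x y - f x * commutator_kern \<epsilon> x y"] if1 integral_commutator_kern(1)[OF \<epsilon>, of x] by simp
  also have "\<dots> \<le> (\<integral>\<^sup>+y. ennreal \<bar>f y - f x\<bar> * ennreal (commutator_kern_bound \<epsilon> (x - y)) \<partial>lborel)"
  proof (rule nn_integral_mono_AE)
    show "AE y in lborel. ennreal (norm (f y * commutator_kern \<epsilon> x y - f x * commutator_kern \<epsilon> x y)) \<le> ennreal \<bar>f y - f x\<bar> * ennreal (commutator_kern_bound \<epsilon> (x - y))"
      using commutator_kern_le[OF \<epsilon>, of x]
    proof eventually_elim
      case (elim y)
      have "norm (f y * commutator_kern \<epsilon> x y - f x * commutator_kern \<epsilon> x y) = \<bar>f y - f x\<bar> * \<bar>commutator_kern \<epsilon> x y\<bar>" by (simp add: abs_mult flip: left_diff_distrib)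
      also have "\<dots> \<le> \<bar>f y - f x\<bar> * commutator_kern_bound \<epsilon> (x - y)" using elim by (intro mult_left_mono) auto
      finally show ?case by (simp add: ennreal_leI flip: ennreal_mult')
    qed
  qed
  finally show ?thesis .
qed

section \<open>From the weak equation to the integrated identity\<close>

lemma kern_along_flow:
  assumes x: "x \<in> \<Omega>" and t: "0 \<le> t"
  shows "kern \<epsilon> (Phi t x - y) - kern \<epsilon> (x - y) =
     (LINT s|lborel. indicator {0..t} s * (\<Sum>i\<in>UNIV. field_ext i (Phi s x) * partial_deriv i (kern \<epsilon>) (Phi s x - y)))"
proof -
  define k' where "k' s = (\<Sum>i\<in>UNIV. field_ext i (Phi s x) * partial_deriv i (kern \<epsilon>) (Phi s x - y))" for s
  have der: "((\<lambda>s. kern \<epsilon> (Phi s x - y)) has_vector_derivative k' s) (at s)" for s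
  proof -
    have 1: "(kern \<epsilon> has_derivative (\<lambda>h. \<Sum>i\<in>UNIV. h $ i * partial_deriv i (kern \<epsilon>) (Phi s x - y))) (at (Phi s x - y))"
      by (intro has_derivative_partial_derivs smooth_expr_differentiable kern_smooth)
    have 2: "((\<lambda>s. Phi s x - y) has_derivative (\<lambda>h. h *\<^sub>R X (Phi s x))) (at s)"
      using Phi_has_vector_derivative[OF x, of s] unfolding has_vector_derivative_def
      by (auto intro!: derivative_eq_intros)
    have "((\<lambda>s. kern \<epsilon> (Phi s x - y)) has_derivative (\<lambda>h. \<Sum>i\<in>UNIV. (h *\<^sub>R X (Phi s x)) $ i * partial_deriv i (kern \<epsilon>) (Phi s x - y))) (at s)"
      by (rule has_derivative_compose[OF 2 1])
    then show ?thesis unfolding has_vector_derivative_def k'_def using x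
      by (simp add: sum_distrib_left mult.assoc field_ext(2))
  qed
  have cont: "continuous_on {0..t} k'" unfolding k'_def
  proof (intro continuous_on_sum continuous_on_mult)
    show "continuous_on {0..t} (\<lambda>s. field_ext i (Phi s x))" for i
      by (rule continuous_on_compose2[OF field_ext_continuous]) (auto intro: continuous_on_subset[OF Phi_continuous_time])
    show "continuous_on {0..t} (\<lambda>s. partial_deriv i (kern \<epsilon>) (Phi s x - y))" for i
      by (rule continuous_on_compose2[OF smooth_expr_continuous[OF smooth_expr_partial_deriv[OF kern_smooth]]])
         (auto intro!: continuous_intros continuous_on_subset[OF Phi_continuous_time])
  qed
  have "has_bochner_integral lborel (\<lambda>s. indicator {0..t} s *\<^sub>R k' s) (kern \<epsilon> (Phi t x - y) - kern \<epsilon> (Phi 0 x - y))"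
    by (rule has_bochner_integral_FTC_Icc[OF t has_vector_derivative_at_within[OF der] cont])
  then show ?thesis by (simp add: has_bochner_integral_integral_eq k'_def)
qed

text \<open>The fundamental theorem of calculus for the kernel along one orbit, integrated against
  f. Fubini applies because the field is bounded along the orbit over a compact time interval. The
  identity holds at every x of \<Omega>, as only the smooth kernel is differentiated.\<close>

lemma mollify_along_flow:
  assumes f: "integrable lborel f" and x: "x \<in> \<Omega>" and t: "0 \<le> t" and \<epsilon>: "0 < \<epsilon>"
  shows "mollify \<epsilon> f (Phi t x) - mollify \<epsilon> f x = time_integral (moll_deriv \<epsilon> f) t x"
proof -
  have [measurable]: "f \<in> borel_measurable borel" using f by (auto simp: integrable_iff_bounded)
  define k' where "k' s y = (\<Sum>i\<in>UNIV. field_ext i (Phi s x) * partial_deriv i (kern \<epsilon>) (Phi s x - y))" for s y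
  obtain b where b: "\<And>w::real^'n. \<bar>kern \<epsilon> w\<bar> \<le> b" using kern_bounded by metis
  have i: "integrable lborel (\<lambda>y. f y * kern \<epsilon> (z - y))" for z by (rule integrable_mult_bounded[OF f _ b]) auto
  have "\<forall>i. \<exists>B. \<forall>w. \<bar>partial_deriv i (kern \<epsilon>) (w :: real^'n)\<bar> \<le> B" using partial_deriv_kern_bounded[OF \<epsilon>] by blast
  then obtain P where P: "\<And>i w. \<bar>partial_deriv i (kern \<epsilon>) (w :: real^'n)\<bar> \<le> P i" by metis
  have "\<exists>B. \<forall>s\<in>{0..t}. \<bar>field_ext i (Phi s x)\<bar> \<le> B" for i
  proof -
    have "bounded ((\<lambda>s. field_ext i (Phi s x)) ` {0..t})"
      by (intro compact_imp_bounded compact_continuous_image compact_Icc continuous_on_compose2[OF field_ext_continuous])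
         (auto intro: continuous_on_subset[OF Phi_continuous_time])
    then show ?thesis by (auto simp: bounded_iff)
  qed
  then obtain E where E: "\<And>i s. s \<in> {0..t} \<Longrightarrow> \<bar>field_ext i (Phi s x)\<bar> \<le> E i" by metis
  define B where "B = (\<Sum>i\<in>UNIV. E i * P i)"
  have B: "\<bar>k' s y\<bar> \<le> B" if "s \<in> {0..t}" for s y
    unfolding k'_def B_def using E[OF that] P
    by (intro order_trans[OF sum_abs] sum_mono) (auto simp: abs_mult intro!: mult_mono order_trans[OF abs_ge_zero E[OF that]])
  have [measurable]: "(\<lambda>(s, y). k' s y) \<in> borel_measurable (lborel \<Otimes>\<^sub>M lborel)" unfolding k'_def by measurable
  have int2: "integrable (lborel \<Otimes>\<^sub>M lborel) (\<lambda>(s, y). f y * (indicator {0..t} s * k' s y))"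
  proof (rule integrableI_bounded)
    show "(\<lambda>(s, y). f y * (indicator {0..t} s * k' s y)) \<in> borel_measurable (lborel \<Otimes>\<^sub>M lborel)" by measurable
    have "(\<integral>\<^sup>+p. ennreal (norm (case p of (s, y) \<Rightarrow> f y * (indicator {0..t} s * k' s y))) \<partial>(lborel \<Otimes>\<^sub>M lborel)) =
       (\<integral>\<^sup>+s. (\<integral>\<^sup>+y. ennreal (norm (f y * (indicator {0..t} s * k' s y))) \<partial>lborel) \<partial>lborel)"
      by (subst lborel.nn_integral_fst[symmetric]) auto
    also have "\<dots> \<le> (\<integral>\<^sup>+s. (ennreal \<bar>B\<bar> * L1norm f) * indicator {0..t} s \<partial>lborel)"
    proof (rule nn_integral_mono)
      fix s
      show "(\<integral>\<^sup>+y. ennreal (norm (f y * (indicator {0..t} s * k' s y))) \<partial>lborel) \<le> (ennreal \<bar>B\<bar> * L1norm f) * indicator {0..t} s"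
      proof (cases "s \<in> {0..t}")
        case True
        have "\<bar>f y * (indicator {0..t} s * k' s y)\<bar> \<le> \<bar>B\<bar> * \<bar>f y\<bar>" for y
          using True order_trans[OF B[OF True, of y] abs_ge_self] mult_left_mono[of "\<bar>k' s y\<bar>" "\<bar>B\<bar>" "\<bar>f y\<bar>"]
          by (simp add: abs_mult mult.commute[of "\<bar>B\<bar>"])
        then have "ennreal (norm (f y * (indicator {0..t} s * k' s y))) \<le> ennreal \<bar>B\<bar> * ennreal \<bar>f y\<bar>" for y
          by (simp add: ennreal_leI flip: ennreal_mult')
        then have "(\<integral>\<^sup>+y. ennreal (norm (f y * (indicator {0..t} s * k' s y))) \<partial>lborel) \<le> (\<integral>\<^sup>+y. ennreal \<bar>B\<bar> * ennreal \<bar>f y\<bar> \<partial>lborel)"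
          by (rule nn_integral_mono)
        then show ?thesis using True by (simp add: L1norm_def nn_integral_cmult)
      qed auto
    qed
    also have "\<dots> = ennreal \<bar>B\<bar> * L1norm f * ennreal t" using t by (simp add: nn_integral_cmult)
    also have "\<dots> < \<infinity>" using f by (simp add: L1norm_finite_iff ennreal_mult_less_top)
    finally show "(\<integral>\<^sup>+p. ennreal (norm (case p of (s, y) \<Rightarrow> f y * (indicator {0..t} s * k' s y))) \<partial>(lborel \<Otimes>\<^sub>M lborel)) < \<infinity>" .
  qed
  have "mollify \<epsilon> f (Phi t x) - mollify \<epsilon> f x = (LINT y|lborel. f y * kern \<epsilon> (Phi t x - y) - f y * kern \<epsilon> (x - y))"
    unfolding mollify_def by (intro Bochner_Integration.integral_diff[symmetric] i)
  also have "\<dots> = (LINT y|lborel. f y * (LINT s|lborel. indicator {0..t} s * k' s y))"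
    using kern_along_flow[OF x t, of \<epsilon>] by (intro Bochner_Integration.integral_cong) (auto simp: k'_def simp flip: right_diff_distrib)
  also have "\<dots> = (LINT y|lborel. (LINT s|lborel. f y * (indicator {0..t} s * k' s y)))" by simp
  also have "\<dots> = (LINT s|lborel. (LINT y|lborel. f y * (indicator {0..t} s * k' s y)))"
    by (rule lborel_pair.Fubini_integral[OF int2])
  also have "\<dots> = (LINT s|lborel. indicator {0..t} s * (LINT y|lborel. f y * k' s y))"
    by (intro Bochner_Integration.integral_cong refl, subst integral_mult_right_zero[symmetric])
       (auto intro!: Bochner_Integration.integral_cong simp: mult_ac)
  finally show ?thesis by (simp add: time_integral_def moll_deriv_def k'_def)
qed

lemma L1norm_time_integral_le:
  assumes h: "integrable lborel h" and t: "0 \<le> t"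
  shows "L1norm (time_integral h t) \<le> ennreal t * (ennreal (growth t) * L1norm h)"
proof -
  have [measurable]: "h \<in> borel_measurable borel" using h by (simp add: integrable_iff_bounded)
  have "L1norm (time_integral h t) \<le> (\<integral>\<^sup>+x. (\<integral>\<^sup>+s. ennreal \<bar>indicator {0..t} s * h (Phi s x)\<bar> \<partial>lborel) \<partial>lborel)"
    unfolding L1norm_def
  proof (rule nn_integral_mono_AE)
    show "AE x in lborel. ennreal \<bar>time_integral h t x\<bar> \<le> (\<integral>\<^sup>+s. ennreal \<bar>indicator {0..t} s * h (Phi s x)\<bar> \<partial>lborel)"
      using AE_time_integrable[OF h, of t]
    proof eventually_elim
      case (elim x)
      then have "integrable lborel (\<lambda>s. indicator {0..t} s * h (Phi s x))" by (simp add: time_integrable_def)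
      from integral_norm_bound_ennreal[OF this] show ?case by (simp add: time_integral_def)
    qed
  qed
  also have "\<dots> \<le> ennreal t * (ennreal (growth t) * L1norm h)"
    using t by (intro nn_time_integral_le L1norm_Phi_le') auto
  finally show ?thesis .
qed

lemma commutator_kern_bound_zero: "0 < \<epsilon> \<Longrightarrow> \<epsilon> < norm w \<Longrightarrow> commutator_kern_bound \<epsilon> w = 0"
  unfolding commutator_kern_bound_def using partial_kern_zero[of \<epsilon> w] kern_zero[of \<epsilon> w] by simp

text \<open>The commutator is controlled only at distance at least \<epsilon> from the complement of
  \<Omega>, hence the restriction to a compact K. Orbits starting in K remain in the compact
  \<open>reach t K\<close> up to time t, where all sufficiently small \<epsilon> are allowed. Since
  c does not depend on r, the defect vanishes almost everywhere on K.\<close>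

lemma distributional_imp_defect_small:
  assumes f: "integrable lborel f" and g: "integrable lborel g"
    and fg: "distributional f g" and t: "0 \<le> t" and K: "compact K" "K \<subseteq> \<Omega>"
  shows "\<exists>c\<ge>0. \<forall>r>0. L1norm (\<lambda>x. indicator K x * defect f g t x) \<le> ennreal (c * r)"
proof -
  have [measurable]: "f \<in> borel_measurable borel" "g \<in> borel_measurable borel"
    using f g by (auto simp: integrable_iff_bounded)
  have [measurable]: "K \<in> sets borel" using K by (simp add: borel_compact)
  define K' where "K' = reach t K"
  have K': "compact K'" "K' \<subseteq> \<Omega>" unfolding K'_def using K by (auto intro: compact_reach subsetD[OF reach_subset])
  have [measurable]: "K' \<in> sets borel" using K' by (simp add: borel_compact)
  obtain \<delta>0 where \<delta>0: "\<delta>0 > 0" "(\<Union>x\<in>K'. cball x \<delta>0) \<subseteq> \<Omega>"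
    using compact_subset_open_imp_cball_epsilon_subset[OF K'(1) open_dom K'(2)] by metis
  obtain C where C: "0 \<le> C" "\<And>\<epsilon>. 0 < \<epsilon> \<Longrightarrow> (\<integral>\<^sup>+w. ennreal (commutator_kern_bound \<epsilon> w) \<partial>lborel) \<le> ennreal C"
    using nn_integral_commutator_kern_bound by blast
  \<comment> \<open>The first bracket accounts for replacing f by its mollification at time t and at
    time 0. The rest is the time integral of the error in g, whose L^1 norm is at most (C + 1) r: C
    r from the commutator and r from mollifying g.\<close>
  define c where "c = (growth t + 1) + t * (growth t * (C + 1))"
  have G: "1 \<le> growth t" by (rule growth_ge_1)
  have "L1norm (\<lambda>x. indicator K x * defect f g t x) \<le> ennreal (c * r)" if r: "0 < r" for r
  proof -
    obtain \<delta>1 where \<delta>1: "\<delta>1 > 0" "\<forall>\<epsilon>. 0 < \<epsilon> \<and> \<epsilon> \<le> \<delta>1 \<longrightarrow> L1norm (\<lambda>x. mollify \<epsilon> f x - f x) \<le> ennreal r"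
      using mollify_tendsto[OF f r] by blast
    obtain \<delta>2 where \<delta>2: "\<delta>2 > 0" "\<forall>\<epsilon>. 0 < \<epsilon> \<and> \<epsilon> \<le> \<delta>2 \<longrightarrow> L1norm (\<lambda>x. mollify \<epsilon> g x - g x) \<le> ennreal r"
      using mollify_tendsto[OF g r] by blast
    obtain \<delta>3 where \<delta>3: "\<delta>3 > 0" "\<And>w. norm w \<le> \<delta>3 \<Longrightarrow> L1norm (\<lambda>x. f (x + w) - f x) \<le> ennreal r"
      using L1norm_shift_continuous[OF f r] by blast
    define \<epsilon> where "\<epsilon> = min (min \<delta>0 \<delta>1) (min \<delta>2 \<delta>3)"
    have \<epsilon>: "0 < \<epsilon>" "\<epsilon> \<le> \<delta>0" "\<epsilon> \<le> \<delta>1" "\<epsilon> \<le> \<delta>2" "\<epsilon> \<le> \<delta>3" using \<delta>0 \<delta>1 \<delta>2 \<delta>3 by (auto simp: \<epsilon>_def)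
    note [measurable] = borel_measurable_mollify
    let ?q = "moll_deriv \<epsilon> f" and ?mf = "mollify \<epsilon> f" and ?mg = "mollify \<epsilon> g"
    have mf: "L1norm (\<lambda>x. ?mf x - f x) \<le> ennreal r" and mg: "L1norm (\<lambda>x. ?mg x - g x) \<le> ennreal r"
      using \<delta>1 \<delta>2 \<epsilon> by auto
    \<comment> \<open>The cut-off to K' makes the error integrable over the whole space, and orbits
      from K do not notice it up to time t.\<close>
    define h where "h x = indicator K' x * (?q x - g x)" for x
    have [measurable]: "h \<in> borel_measurable borel" unfolding h_def by measurable
    have "L1norm (\<lambda>x. indicator K' x * (?q x - ?mg x)) \<le>
       (\<integral>\<^sup>+x. (\<integral>\<^sup>+y. ennreal \<bar>f y - f x\<bar> * ennreal (commutator_kern_bound \<epsilon> (x - y)) \<partial>lborel) \<partial>lborel)"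
      unfolding L1norm_def
    proof (rule nn_integral_mono)
      fix x
      show "ennreal \<bar>indicator K' x * (?q x - ?mg x)\<bar> \<le> (\<integral>\<^sup>+y. ennreal \<bar>f y - f x\<bar> * ennreal (commutator_kern_bound \<epsilon> (x - y)) \<partial>lborel)"
      proof (cases "x \<in> K'")
        case True
        have "cball x \<epsilon> \<subseteq> cball x \<delta>0" using \<epsilon>(2) by (rule subset_cball)
        then have "cball x \<epsilon> \<subseteq> \<Omega>" using \<delta>0(2) True by blast
        then show ?thesis using commutator_le[OF f g fg \<epsilon>(1), of x] True by simp
      qed simp
    qed
    also have "\<dots> \<le> (\<integral>\<^sup>+w. ennreal (commutator_kern_bound \<epsilon> w) \<partial>lborel) * ennreal r"
      using \<epsilon> by (intro nn_integral_kernel_le[where \<epsilon>=\<epsilon>] \<delta>3(2)) (auto simp: commutator_kern_bound_zero)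
    also have "\<dots> \<le> ennreal C * ennreal r" by (intro mult_right_mono C \<epsilon>) auto
    also have "\<dots> = ennreal (C * r)" using C(1) r by (simp add: ennreal_mult)
    finally have h1: "L1norm (\<lambda>x. indicator K' x * (?q x - ?mg x)) \<le> ennreal (C * r)" .
    have "L1norm h \<le> L1norm (\<lambda>x. indicator K' x * (?q x - ?mg x) + indicator K' x * (?mg x - g x))"
      by (simp add: h_def[abs_def] flip: distrib_left)
    also have "\<dots> \<le> L1norm (\<lambda>x. indicator K' x * (?q x - ?mg x)) + L1norm (\<lambda>x. indicator K' x * (?mg x - g x))"
      by (intro L1norm_add_le) measurable
    also have "\<dots> \<le> ennreal (C * r) + ennreal r"
      by (intro add_mono h1 order_trans[OF L1norm_mono mg]) (auto simp: indicator_def)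
    also have "\<dots> = ennreal ((C + 1) * r)" using C(1) r by (simp add: algebra_simps flip: ennreal_plus)
    finally have hle: "L1norm h \<le> ennreal ((C + 1) * r)" .
    have hint: "integrable lborel h" using hle by (subst L1norm_finite_iff) (auto intro: le_less_trans)
    define A where "A x = f (Phi t x) - ?mf (Phi t x)" for x
    define B where "B x = ?mf x - f x" for x
    have [measurable]: "A \<in> borel_measurable borel" "B \<in> borel_measurable borel" unfolding A_def B_def by measurable
    have "AE x in lborel. \<bar>indicator K x * defect f g t x\<bar> \<le> \<bar>A x + (B x + time_integral h t x)\<bar>"
      using AE_time_integrable[OF hint, of t] AE_time_integrable[OF g, of t]
    proof eventually_elim
      case (elim x)
      show ?case
      proof (cases "x \<in> K")
        case True
        then have x: "x \<in> \<Omega>" using K by auto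
        have "indicator {0..t} s * ?q (Phi s x) = indicator {0..t} s * h (Phi s x) + indicator {0..t} s * g (Phi s x)" for s
        proof (cases "s \<in> {0..t}")
          case s: True
          then have "Phi s x \<in> K'" unfolding K'_def using True by (intro reachI) auto
          then show ?thesis by (simp add: h_def right_diff_distrib)
        qed simp
        then have "time_integral ?q t x = time_integral h t x + time_integral g t x"
          unfolding time_integral_def using elim by (simp add: time_integrable_def)
        then have "defect f g t x = A x + (B x + time_integral h t x)"
          using mollify_along_flow[OF f x t \<epsilon>(1)] by (simp add: defect_def A_def B_def)
        then show ?thesis using True by simp
      qed simp
    qed
    then have "L1norm (\<lambda>x. indicator K x * defect f g t x) \<le> L1norm (\<lambda>x. A x + (B x + time_integral h t x))"
      unfolding L1norm_def by (intro nn_integral_mono_AE) (auto elim!: eventually_mono intro: ennreal_leI)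
    also have "\<dots> \<le> L1norm A + L1norm (\<lambda>x. B x + time_integral h t x)" by (intro L1norm_add_le) measurable
    also have "\<dots> \<le> L1norm A + (L1norm B + L1norm (time_integral h t))" by (intro add_left_mono L1norm_add_le) measurable
    also have "\<dots> \<le> ennreal (growth t) * ennreal r + (ennreal r + ennreal t * (ennreal (growth t) * ennreal ((C + 1) * r)))"
    proof (intro add_mono)
      have "L1norm A \<le> ennreal (growth t) * L1norm (\<lambda>x. f x - ?mf x)"
        unfolding A_def by (rule L1norm_Phi_le) measurable
      also have "\<dots> \<le> ennreal (growth t) * ennreal r"
        using mf by (intro mult_left_mono) (subst L1norm_minus_commute, auto)
      finally show "L1norm A \<le> ennreal (growth t) * ennreal r" .
      show "L1norm B \<le> ennreal r" using mf by (simp add: B_def[abs_def])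
      show "L1norm (time_integral h t) \<le> ennreal t * (ennreal (growth t) * ennreal ((C + 1) * r))"
        by (rule order_trans[OF L1norm_time_integral_le[OF hint t] mult_left_mono[OF mult_left_mono[OF hle zero_le] zero_le]])
    qed
    also have "\<dots> = ennreal (growth t * r + (r + t * (growth t * ((C + 1) * r))))"
      using r t C(1) G by (simp add: ennreal_mult ennreal_plus)
    also have "growth t * r + (r + t * (growth t * ((C + 1) * r))) = c * r" by (simp add: c_def algebra_simps)
    finally show ?thesis .
  qed
  moreover have "0 \<le> c" using t C(1) G by (simp add: c_def)
  ultimately show ?thesis by blast
qed

lemma distributional_imp_transported:
  assumes f: "integrable lborel f" and g: "integrable lborel g"
    and f0: "\<And>x. x \<notin> \<Omega> \<Longrightarrow> f x = 0" and g0: "\<And>x. x \<notin> \<Omega> \<Longrightarrow> g x = 0"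
    and fg: "distributional f g"
  shows "transported f g"
  unfolding transported_def
proof (intro allI impI)
  fix t :: real assume t: "0 \<le> t"
  have [measurable]: "f \<in> borel_measurable borel" "g \<in> borel_measurable borel"
    using f g by (auto simp: integrable_iff_bounded)
  obtain K :: "nat \<Rightarrow> (real^'n) set" where K: "\<And>n. compact (K n)" "\<And>n. K n \<subseteq> \<Omega>" "\<Union> (range K) = \<Omega>"
    using open_Union_compact_subsets[OF open_dom] by metis
  have "AE x in lborel. indicator (K n) x * defect f g t x = 0" for n
  proof -
    have [measurable]: "K n \<in> sets borel" using K by (simp add: borel_compact)
    obtain c where c: "0 \<le> c" "\<And>r. 0 < r \<Longrightarrow> L1norm (\<lambda>x. indicator (K n) x * defect f g t x) \<le> ennreal (c * r)"
      using distributional_imp_defect_small[OF f g fg t K(1,2)] by blast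
    have "L1norm (\<lambda>x. indicator (K n) x * defect f g t x) \<le> 0 + ennreal r" if r: "0 < r" for r
    proof -
      have "L1norm (\<lambda>x. indicator (K n) x * defect f g t x) \<le> ennreal (c * (r / (c + 1)))"
        using c r by (intro c(2)) auto
      also have "\<dots> \<le> ennreal r" using c r by (intro ennreal_leI) (simp add: field_simps)
      finally show ?thesis by simp
    qed
    then have "L1norm (\<lambda>x. indicator (K n) x * defect f g t x) \<le> 0" by (rule ennreal_le_epsilon)
    then have "L1norm (\<lambda>x. indicator (K n) x * defect f g t x) = 0" by simp
    then show ?thesis by (subst (asm) L1norm_zero_iff) auto
  qed
  then have "AE x in lborel. \<forall>n. indicator (K n) x * defect f g t x = 0" by (subst AE_all_countable) blast
  then show "AE x in lborel. f (Phi t x) - f x = time_integral g t x"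
  proof eventually_elim
    case (elim x)
    show ?case
    proof (cases "x \<in> \<Omega>")
      case True
      then obtain n where "x \<in> K n" using K(3) by blast
      then show ?thesis using elim[rule_format, of n] by (simp add: defect_def)
    next
      case False
      then show ?thesis by (simp add: f0 g0 time_integral_def)
    qed
  qed
qed

end

section \<open>The adjoint of the field\<close>

lemma integral_mult_AE_bounded_le:
  fixes h k :: "'a::euclidean_space \<Rightarrow> real"
  assumes h: "integrable lborel h" and k: "k \<in> borel_measurable borel" and B: "AE x in lborel. \<bar>k x\<bar> \<le> B" and "0 \<le> B"
  shows "ennreal \<bar>LINT x|lborel. h x * k x\<bar> \<le> ennreal B * L1norm h"
proof -
  have [measurable]: "h \<in> borel_measurable borel" using h by (simp add: integrable_iff_bounded)
  have "ennreal \<bar>LINT x|lborel. h x * k x\<bar> \<le> (\<integral>\<^sup>+x. ennreal (norm (h x * k x)) \<partial>lborel)"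
    using integral_norm_bound_ennreal[OF integrable_mult_AE_bounded[OF h k B]] by simp
  also have "\<dots> \<le> (\<integral>\<^sup>+x. ennreal B * ennreal \<bar>h x\<bar> \<partial>lborel)"
  proof (rule nn_integral_mono_AE)
    show "AE x in lborel. ennreal (norm (h x * k x)) \<le> ennreal B * ennreal \<bar>h x\<bar>"
      using B
    proof eventually_elim
      case (elim x)
      have "\<bar>h x * k x\<bar> \<le> B * \<bar>h x\<bar>" using mult_left_mono[OF elim, of "\<bar>h x\<bar>"] by (simp add: abs_mult mult.commute)
      then show ?case using \<open>0 \<le> B\<close> by (simp add: ennreal_leI flip: ennreal_mult')
    qed
  qed
  also have "\<dots> = ennreal B * L1norm h" unfolding L1norm_def by (intro nn_integral_cmult) auto
  finally show ?thesis .
qed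

lemma lip_compact_bounded:
  assumes "lip_compact \<Omega> v"
  shows "\<exists>b\<ge>0. \<forall>x. \<bar>v x\<bar> \<le> b"
proof -
  obtain S where S: "compact S" "\<And>x. x \<notin> S \<Longrightarrow> v x = 0" using assms unfolding lip_compact_def by blast
  have "bounded (v ` S)"
    by (intro compact_imp_bounded compact_continuous_image S continuous_on_subset[OF lip_compact_continuous[OF assms]]) auto
  then obtain b where b: "\<forall>x\<in>S. \<bar>v x\<bar> \<le> b" by (auto simp: bounded_iff)
  have "\<bar>v x\<bar> \<le> max b 0" for x using b S(2)[of x] by (cases "x \<in> S") auto
  then show ?thesis by (intro exI[of _ "max b 0"]) auto
qed

lemma lip_compact_mult:
  assumes v: "lip_compact \<Omega> v" and u: "lip_compact \<Omega>' u"
  shows "lip_compact \<Omega> (\<lambda>x. v x * u x)"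
proof -
  obtain K S where K: "K-lipschitz_on UNIV v" and S: "compact S" "S \<subseteq> \<Omega>" "\<And>x. x \<notin> S \<Longrightarrow> v x = 0"
    using v unfolding lip_compact_def by blast
  obtain M where M: "M-lipschitz_on UNIV u" using u unfolding lip_compact_def by blast
  obtain a where a: "a \<ge> 0" "\<And>x. \<bar>v x\<bar> \<le> a" using lip_compact_bounded[OF v] by blast
  obtain b where b: "b \<ge> 0" "\<And>x. \<bar>u x\<bar> \<le> b" using lip_compact_bounded[OF u] by blast
  have "(a * M + K * b)-lipschitz_on UNIV (\<lambda>x. v x * u x)"
  proof (rule lipschitz_onI)
    fix x y
    have "\<bar>v x * (u x - u y)\<bar> \<le> a * (M * dist x y)"
      unfolding abs_mult using a lipschitz_onD[OF M, of x y] by (intro mult_mono) (auto simp: dist_real_def)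
    moreover have "\<bar>(v x - v y) * u y\<bar> \<le> (K * dist x y) * b"
      unfolding abs_mult using b lipschitz_onD[OF K, of x y] lipschitz_on_nonneg[OF K] by (intro mult_mono) (auto simp: dist_real_def)
    moreover have "v x * u x - v y * u y = v x * (u x - u y) + (v x - v y) * u y" by (simp add: algebra_simps)
    moreover have "a * (M * dist x y) + (K * dist x y) * b = (a * M + K * b) * dist x y" by (simp add: algebra_simps)
    ultimately show "dist (v x * u x) (v y * u y) \<le> (a * M + K * b) * dist x y"
      unfolding dist_real_def by linarith
  next
    show "0 \<le> a * M + K * b" using a(1) b(1) lipschitz_on_nonneg[OF M] lipschitz_on_nonneg[OF K] by simp
  qed
  then show ?thesis unfolding lip_compact_def using S by (intro conjI exI[of _ S]) auto
qed

lemma test_function_lip_compact: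
  assumes "test_function \<Omega> u"
  shows "lip_compact \<Omega> u"
proof -
  have S: "compact (closure {x. u x \<noteq> 0})" "closure {x. u x \<noteq> 0} \<subseteq> \<Omega>" "C_k 1 u"
    using assms by (auto simp: test_function_def)
  have "u x = 0" if "x \<notin> closure {x. u x \<noteq> 0}" for x using that closure_subset[of "{x. u x \<noteq> 0}"] by blast
  then show ?thesis unfolding lip_compact_def
    using S C1_compact_support_lipschitz[OF S(3,1)] by blast
qed

context complete_lipschitz_field
begin

text \<open>The formal adjoint of differentiation along X; the weak equation says that g tested with
  u equals f tested with \<open>adjoint u\<close>.\<close>

definition adjoint :: "(real^'n \<Rightarrow> real) \<Rightarrow> real^'n \<Rightarrow> real" where
  "adjoint u x = - field_deriv u x - u x * Div x"

context
  fixes u assumes u: "test_function \<Omega> u"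
begin

lemma test_lip_compact: "lip_compact \<Omega> u"
  using u by (rule test_function_lip_compact)

lemma test_differentiable: "u differentiable (at x)"
  using u unfolding test_function_def by (metis C_k.simps(2))

lemma partial_test_continuous: "continuous_on UNIV (partial_deriv i u)"
proof -
  have "C_k (Suc 0) u" using u unfolding test_function_def by blast
  then show ?thesis by simp
qed

lemma test_support: "\<exists>S. compact S \<and> S \<subseteq> \<Omega> \<and> (\<forall>x. x \<notin> S \<longrightarrow> u x = 0) \<and> (\<forall>x i. x \<notin> S \<longrightarrow> partial_deriv i u x = 0)"
proof -
  obtain S where S: "compact S" "S \<subseteq> \<Omega>" "\<And>x. x \<notin> S \<Longrightarrow> u x = 0" using test_lip_compact unfolding lip_compact_def by blast
  have "partial_deriv i u x = 0" if "x \<notin> S" for i x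
    by (rule partial_deriv_zero_off[OF compact_imp_closed[OF S(1)] S(3) that])
  then show ?thesis using S by blast
qed

lemma test_measurable[measurable]: "u \<in> borel_measurable borel"
  by (rule lip_compact_measurable[OF test_lip_compact])

lemma partial_test_measurable[measurable]: "partial_deriv i u \<in> borel_measurable borel"
  by (rule borel_measurable_continuous_onI[OF partial_test_continuous])

lemma adjoint_measurable[measurable]: "adjoint u \<in> borel_measurable borel"
  unfolding adjoint_def[abs_def] by measurable

lemma field_deriv_test_bounded: "\<exists>b\<ge>0. \<forall>x. \<bar>field_deriv u x\<bar> \<le> b"
proof -
  obtain S where S: "compact S" "\<And>x i. x \<notin> S \<Longrightarrow> partial_deriv i u x = 0" using test_support by blast
  have "bounded ((\<lambda>x. field_deriv u x) ` S)"
    by (intro compact_imp_bounded compact_continuous_image S continuous_on_sum continuous_on_mult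
        continuous_on_subset[OF field_ext_continuous] continuous_on_subset[OF partial_test_continuous]) auto
  then obtain b where b: "\<forall>x\<in>S. \<bar>field_deriv u x\<bar> \<le> b" by (auto simp: bounded_iff)
  have "\<bar>field_deriv u x\<bar> \<le> max b 0" for x
    using b S(2)[of x] by (cases "x \<in> S") auto
  then show ?thesis by (intro exI[of _ "max b 0"]) auto
qed

lemma test_Div_bounded: "\<exists>b\<ge>0. AE x in lborel. \<bar>u x * Div x\<bar> \<le> b"
proof -
  obtain b where b: "b \<ge> 0" "\<And>x. \<bar>u x\<bar> \<le> b" using lip_compact_bounded[OF test_lip_compact] by blast
  have "AE x in lborel. \<bar>u x * Div x\<bar> \<le> b * (CARD('n) * L)"
    using Div_AE_bounded by eventually_elim (auto simp: abs_mult b intro!: mult_mono)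
  then show ?thesis using b(1) L_nonneg by (intro exI[of _ "b * (CARD('n) * L)"]) auto
qed

lemma adjoint_bounded: "\<exists>b\<ge>0. AE x in lborel. \<bar>adjoint u x\<bar> \<le> b"
proof -
  obtain a where a: "a \<ge> 0" "\<And>x. \<bar>field_deriv u x\<bar> \<le> a" using field_deriv_test_bounded by blast
  obtain b where b: "b \<ge> 0" "AE x in lborel. \<bar>u x * Div x\<bar> \<le> b" using test_Div_bounded by blast
  from b(2) have "AE x in lborel. \<bar>adjoint u x\<bar> \<le> a + b"
  proof eventually_elim
    case (elim x)
    then show ?case using a(2)[of x] unfolding adjoint_def by linarith
  qed
  then show ?thesis using a(1) b(1) by (intro exI[of _ "a + b"]) auto
qed

lemma integral_adjoint:
  assumes f: "integrable lborel f"
  shows "(LINT x|lborel. f x * adjoint u x) = - (LINT x|lborel. f x * field_deriv u x) - (LINT x|lborel. f x * (u x * Div x))"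
proof -
  obtain a where a: "\<And>x. \<bar>field_deriv u x\<bar> \<le> a" using field_deriv_test_bounded by blast
  obtain b where b: "AE x in lborel. \<bar>u x * Div x\<bar> \<le> b" using test_Div_bounded by blast
  have 1: "integrable lborel (\<lambda>x. f x * field_deriv u x)"
    by (rule integrable_mult_bounded[OF f _ a]) measurable
  have 2: "integrable lborel (\<lambda>x. f x * (u x * Div x))"
    by (rule integrable_mult_AE_bounded[OF f _ b]) measurable
  have "(LINT x|lborel. f x * adjoint u x) = (LINT x|lborel. - (f x * field_deriv u x) - f x * (u x * Div x))"
    by (intro Bochner_Integration.integral_cong) (auto simp: adjoint_def right_diff_distrib)
  then show ?thesis using 1 2 by simp
qed

section \<open>Differentiating tested Lipschitz functions along the flow\<close>

text \<open>Each component of the extended field is integrated by parts against the compactly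
  supported product v u. The product rule, valid almost everywhere, splits the derivative of v u,
  and the derivatives falling on the field add up to the divergence term.\<close>

lemma lip_compact_by_parts:
  assumes v: "lip_compact \<Omega> v"
  shows "(LINT x|lborel. field_deriv v x * u x) = (LINT x|lborel. v x * adjoint u x)"
proof -
  have vu: "lip_compact \<Omega> (\<lambda>x. v x * u x)" using v test_lip_compact by (rule lip_compact_mult)
  obtain K S where K: "K-lipschitz_on UNIV (\<lambda>x. v x * u x)" and S: "compact S" "\<And>x. x \<notin> S \<Longrightarrow> v x * u x = 0"
    using vu unfolding lip_compact_def by blast
  obtain M where M: "M-lipschitz_on UNIV v" using v unfolding lip_compact_def by blast
  note [measurable] = lip_compact_measurable[OF v] borel_measurable_dir_deriv[OF M] borel_measurable_dir_deriv[OF K]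
  note P = lipschitz_integral_by_parts[OF field_ext(1) K S]
  have prod: "AE x in lborel. \<forall>i::'n. dir_deriv (\<lambda>x. v x * u x) (axis i 1) x = partial_deriv i v x * u x + v x * partial_deriv i u x"
  proof -
    have "AE x in lborel. \<forall>i::'n\<in>UNIV. x \<notin> non_diff v (axis i 1)"
      by (rule AE_finite_allI) (auto intro: AE_not_non_diff[OF M])
    then show ?thesis
    proof eventually_elim
      case (elim x)
      show ?case
      proof
        fix i :: 'n
        have 1: "((\<lambda>h. v (x + h *\<^sub>R axis i 1)) has_field_derivative partial_deriv i v x) (at 0)"
          unfolding partial_deriv_eq_dir_deriv using elim by (intro dir_deriv_works(1)[OF M]) auto
        have 2: "((\<lambda>h. u (x + h *\<^sub>R axis i 1)) has_field_derivative partial_deriv i u x) (at 0)"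
          using has_derivative_dir_deriv(1)[OF has_derivative_partial_derivs[OF test_differentiable], of x "axis i 1"]
            dir_deriv_differentiable[OF test_differentiable, of "axis i 1" x] by (simp add: partial_deriv_eq_dir_deriv)
        have "((\<lambda>h. v (x + h *\<^sub>R axis i 1) * u (x + h *\<^sub>R axis i 1)) has_field_derivative (partial_deriv i v x * u x + v x * partial_deriv i u x)) (at 0)"
          using DERIV_mult[OF 1 2] by (simp add: algebra_simps)
        then show "dir_deriv (\<lambda>x. v x * u x) (axis i 1) x = partial_deriv i v x * u x + v x * partial_deriv i u x"
          unfolding dir_deriv_def by (rule DERIV_imp_deriv)
      qed
    qed
  qed
  have i2: "integrable lborel (\<lambda>x. v x * field_deriv u x)"
  proof -
    obtain a where a: "\<And>x. \<bar>field_deriv u x\<bar> \<le> a" using field_deriv_test_bounded by blast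
    show ?thesis by (rule integrable_mult_bounded[OF lip_compact_integrable[OF v] _ a]) measurable
  qed
  have i1: "integrable lborel (\<lambda>x. \<Sum>i\<in>UNIV. field_ext i x * dir_deriv (\<lambda>x. v x * u x) (axis i 1) x)"
    by (intro Bochner_Integration.integrable_sum P(1))
  have [measurable]: "partial_deriv i v \<in> borel_measurable borel" for i
    unfolding partial_deriv_eq_dir_deriv by measurable
  have "(LINT x|lborel. field_deriv v x * u x) =
     (LINT x|lborel. (\<Sum>i\<in>UNIV. field_ext i x * dir_deriv (\<lambda>x. v x * u x) (axis i 1) x) - v x * field_deriv u x)"
  proof (rule integral_cong_AE)
    show "AE x in lborel. field_deriv v x * u x =
      (\<Sum>i\<in>UNIV. field_ext i x * dir_deriv (\<lambda>x. v x * u x) (axis i 1) x) - v x * field_deriv u x"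
      using prod by eventually_elim (simp add: algebra_simps sum.distrib sum_distrib_left sum_distrib_right)
  qed measurable
  also have "\<dots> = (\<Sum>i\<in>UNIV. (LINT x|lborel. field_ext i x * dir_deriv (\<lambda>x. v x * u x) (axis i 1) x)) - (LINT x|lborel. v x * field_deriv u x)"
    using i1 i2 P(1) by (simp add: Bochner_Integration.integral_sum)
  also have "(\<Sum>i\<in>UNIV. (LINT x|lborel. field_ext i x * dir_deriv (\<lambda>x. v x * u x) (axis i 1) x)) =
     - (\<Sum>i\<in>UNIV. (LINT x|lborel. v x * u x * dir_deriv (field_ext i) (axis i 1) x))"
    unfolding sum_negf[symmetric] by (intro sum.cong refl P(3))
  also have "(\<Sum>i\<in>UNIV. (LINT x|lborel. v x * u x * dir_deriv (field_ext i) (axis i 1) x)) = (LINT x|lborel. (\<Sum>i\<in>UNIV. v x * u x * dir_deriv (field_ext i) (axis i 1) x))"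
    by (rule Bochner_Integration.integral_sum[symmetric]) (rule P(2))
  also have "\<dots> = (LINT x|lborel. v x * (u x * Div x))"
    by (simp add: Div_def mult.assoc sum_distrib_left)
  finally show ?thesis using integral_adjoint[OF lip_compact_integrable[OF v]] by simp
qed

text \<open>Dominated convergence: the chain rule along orbits gives the limit of the quotients at
  almost every point of \<Omega>, and u vanishes elsewhere. Integration by parts then moves the
  derivative onto u.\<close>

lemma lip_compact_flow_derivative:
  assumes v: "lip_compact \<Omega> v"
  shows "((\<lambda>h. (LINT x|lborel. (v (Phi h x) - v x) / h * u x)) \<longlongrightarrow> (LINT x|lborel. v x * adjoint u x)) (at 0)"
  unfolding tendsto_at_iff_sequentially comp_def
proof (intro allI impI)
  fix X' :: "nat \<Rightarrow> real" assume X': "\<forall>i. X' i \<in> UNIV - {0}" "X' \<longlonglongrightarrow> 0"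
  obtain M where M: "M-lipschitz_on UNIV v" using v unfolding lip_compact_def by blast
  note [measurable] = lip_compact_measurable[OF v] borel_measurable_dir_deriv[OF M]
  have [measurable]: "partial_deriv i v \<in> borel_measurable borel" for i
    unfolding partial_deriv_eq_dir_deriv by measurable
  obtain S B where S: "compact S" "0 \<le> B" and SB: "\<And>t x. \<bar>t\<bar> \<le> 1 \<Longrightarrow> \<bar>v (Phi t x) - v x\<bar> \<le> B * \<bar>t\<bar> * indicator S x"
    using lip_compact_Phi_bound[OF v] by blast
  obtain b where b: "b \<ge> 0" "\<And>x. \<bar>v x\<bar> \<le> b" using lip_compact_bounded[OF v] by blast
  have q: "\<bar>(v (Phi t x) - v x) / t\<bar> \<le> B + 2 * b" for t x
  proof (cases "\<bar>t\<bar> \<le> 1")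
    case True
    have "\<bar>v (Phi t x) - v x\<bar> \<le> B * \<bar>t\<bar>" using SB[OF True, of x] S(2) by (cases "x \<in> S") (auto intro: order_trans)
    then have "\<bar>(v (Phi t x) - v x) / t\<bar> \<le> B" using S(2) by (cases "t = 0") (auto simp: field_simps)
    then show ?thesis using b(1) by linarith
  next
    case False
    have "\<bar>(v (Phi t x) - v x) / t\<bar> \<le> \<bar>v (Phi t x) - v x\<bar> / 1"
      unfolding abs_divide using False by (intro divide_left_mono) auto
    also have "\<dots> \<le> 2 * b" using b(2)[of x] b(2)[of "Phi t x"] by simp
    also have "\<dots> \<le> B + 2 * b" using S(2) by simp
    finally show ?thesis .
  qed
  have "(\<lambda>n. (LINT x|lborel. (v (Phi (X' n) x) - v x) / X' n * u x)) \<longlonglongrightarrow> (LINT x|lborel. field_deriv v x * u x)"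
  proof (rule integral_dominated_convergence[where w="\<lambda>x. (B + 2 * b) * \<bar>u x\<bar>"])
    show "integrable lborel (\<lambda>x. (B + 2 * b) * \<bar>u x\<bar>)"
      using lip_compact_integrable[OF test_lip_compact] by auto
    show "AE x in lborel. norm ((v (Phi (X' n) x) - v x) / X' n * u x) \<le> (B + 2 * b) * \<bar>u x\<bar>" for n
      using q[of "X' n"] by (intro AE_I2) (simp only: real_norm_def abs_mult, rule mult_right_mono, auto)
    show "AE x in lborel. (\<lambda>n. (v (Phi (X' n) x) - v x) / X' n * u x) \<longlonglongrightarrow> field_deriv v x * u x"
    proof -
      have "lip_compact UNIV v" using v unfolding lip_compact_def by blast
      from lip_compact_chain_rule[OF this] show ?thesis
      proof eventually_elim
        case (elim x)
        show ?case
        proof (cases "x \<in> \<Omega>")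
          case True
          have "((\<lambda>h. (v (Phi h x) - v x) / h) \<longlongrightarrow> (\<Sum>i\<in>UNIV. X x $ i * partial_deriv i v x)) (at 0)"
            using elim[rule_format, of "\<lambda>h. Phi h x" "X x"] Phi_has_vector_derivative[OF True, of 0] by simp
          then have "(\<lambda>n. (v (Phi (X' n) x) - v x) / X' n) \<longlonglongrightarrow> (\<Sum>i\<in>UNIV. X x $ i * partial_deriv i v x)"
            using X' unfolding tendsto_at_iff_sequentially comp_def by blast
          then show ?thesis using True by (intro tendsto_mult tendsto_const) (simp add: field_ext(2))
        next
          case False
          then have "u x = 0" using test_lip_compact unfolding lip_compact_def by blast
          then show ?thesis by simp
        qed
      qed
    qed
  qed measurable
  then show "(\<lambda>n. (LINT x|lborel. (v (Phi (X' n) x) - v x) / X' n * u x)) \<longlonglongrightarrow> (LINT x|lborel. v x * adjoint u x)"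
    unfolding lip_compact_by_parts[OF v] .
qed

text \<open>
  The Lipschitz functions with compact support are invariant under the flow, so the derivative at
  time \<open>0\<close> gives the derivative at all times.
\<close>

lemma lip_compact_flow_mean_value:
  assumes v: "lip_compact \<Omega> v" and t: "0 < t"
  shows "\<exists>s. 0 < s \<and> s < t \<and> (LINT x|lborel. (v (Phi t x) - v x) * u x) = t * (LINT x|lborel. v (Phi s x) * adjoint u x)"
proof -
  define \<psi> where "\<psi> t = (LINT x|lborel. v (Phi t x) * u x)" for t
  obtain b where b: "\<And>x. \<bar>u x\<bar> \<le> b" using lip_compact_bounded[OF test_lip_compact] by blast
  have i: "integrable lborel (\<lambda>x. v (Phi t x) * u x)" for t
    by (rule integrable_mult_bounded[OF integrable_Phi[OF lip_compact_integrable[OF v]] _ b]) measurable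
  have "(\<psi> has_real_derivative (LINT x|lborel. v (Phi s x) * adjoint u x)) (at s)" for s
  proof -
    have "((\<lambda>h. (LINT x|lborel. (v (Phi s (Phi h x)) - v (Phi s x)) / h * u x)) \<longlongrightarrow> (LINT x|lborel. v (Phi s x) * adjoint u x)) (at 0)"
      by (rule lip_compact_flow_derivative[OF lip_compact_Phi[OF v]])
    moreover have "(\<lambda>h. (LINT x|lborel. (v (Phi s (Phi h x)) - v (Phi s x)) / h * u x)) = (\<lambda>h. (\<psi> (s + h) - \<psi> s) / h)"
    proof
      fix h
      have "(LINT x|lborel. (v (Phi s (Phi h x)) - v (Phi s x)) / h * u x) = (LINT x|lborel. (v (Phi (s + h) x) * u x - v (Phi s x) * u x) / h)"
        by (intro Bochner_Integration.integral_cong) (auto simp: Phi_add left_diff_distrib)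
      then show "(LINT x|lborel. (v (Phi s (Phi h x)) - v (Phi s x)) / h * u x) = (\<psi> (s + h) - \<psi> s) / h"
        using i by (simp add: \<psi>_def)
    qed
    ultimately show ?thesis unfolding DERIV_def by (simp only:)
  qed
  from MVT2[OF t this] obtain s where s: "0 < s" "s < t" "\<psi> t - \<psi> 0 = (t - 0) * (LINT x|lborel. v (Phi s x) * adjoint u x)" by blast
  have "(LINT x|lborel. (v (Phi t x) - v x) * u x) = \<psi> t - \<psi> 0"
    using i[of t] i[of 0] by (simp add: \<psi>_def left_diff_distrib)
  then show ?thesis using s by auto
qed

section \<open>From the generator to the weak equation\<close>

text \<open>A Lipschitz approximation v of f satisfies the mean value identity at some intermediate
  time s, and the distance of v at time s from v is controlled by e and by the approximation error.
  That error enters partly without a factor t, but t is fixed while it is sent to 0, so only t b e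
  survives.\<close>

lemma flow_difference_le:
  assumes f: "integrable lborel f" and f0: "\<And>x. x \<notin> \<Omega> \<Longrightarrow> f x = 0" and t: "0 < t"
    and b: "0 \<le> b" "AE x in lborel. \<bar>adjoint u x\<bar> \<le> b"
    and e: "0 \<le> e" "\<And>s. \<bar>s\<bar> \<le> t \<Longrightarrow> L1norm (\<lambda>x. f (Phi s x) - f x) \<le> ennreal e"
  shows "\<bar>(LINT x|lborel. (f (Phi t x) - f x) * u x) - t * (LINT x|lborel. f x * adjoint u x)\<bar> \<le> t * b * e"
proof -
  note [measurable] = borel_measurable_integrable[OF f, simplified]
  obtain a where a: "0 \<le> a" "\<And>x. \<bar>u x\<bar> \<le> a" using lip_compact_bounded[OF test_lip_compact] by blast
  have aAE: "AE x in lborel. \<bar>u x\<bar> \<le> a" using a(2) by simp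
  define G where "G = growth t"
  have G: "1 \<le> G" unfolding G_def by (rule growth_ge_1)
  \<comment> \<open>The coefficients of \<eta>: a (G + 1) from \<open>I1\<close>, t b from
    \<open>I2\<close>, and t b (G + 1) from \<open>I3\<close>.\<close>
  define c where "c = a * (G + 1) + 2 * t * b + t * b * G"
  have c: "0 \<le> c" using a G t b by (simp add: c_def)
  have "\<bar>(LINT x|lborel. (f (Phi t x) - f x) * u x) - t * (LINT x|lborel. f x * adjoint u x)\<bar> \<le> t * b * e + r" if r: "0 < r" for r
  proof -
    define \<eta> where "\<eta> = r / (c + 1)"
    have \<eta>: "0 < \<eta>" "c * \<eta> \<le> r" using r c by (auto simp: \<eta>_def field_simps)
    obtain v where v: "lip_compact \<Omega> v" "L1norm (\<lambda>x. f x - v x) \<le> ennreal \<eta>"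
      using lip_compact_dense[OF open_dom f f0 \<eta>(1)] by blast
    note [measurable] = lip_compact_measurable[OF v(1)]
    have vi: "integrable lborel v" by (rule lip_compact_integrable[OF v(1)])
    define d where "d x = f x - v x" for x
    have [measurable]: "d \<in> borel_measurable borel" unfolding d_def by measurable
    have di: "integrable lborel d" unfolding d_def using f vi by simp
    have dn: "L1norm d \<le> ennreal \<eta>" using v(2) by (simp add: d_def[abs_def])
    have dP: "L1norm (\<lambda>x. d (Phi s x)) \<le> ennreal (G * \<eta>)" if "0 \<le> s" "s \<le> t" for s
    proof -
      have "L1norm (\<lambda>x. d (Phi s x)) \<le> ennreal (growth t) * L1norm d" using that by (intro L1norm_Phi_le') auto
      also have "\<dots> \<le> ennreal G * ennreal \<eta>" unfolding G_def by (intro mult_left_mono dn) auto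
      finally show ?thesis using G \<eta> by (simp add: ennreal_mult)
    qed
    obtain s where s: "0 < s" "s < t" "(LINT x|lborel. (v (Phi t x) - v x) * u x) = t * (LINT x|lborel. v (Phi s x) * adjoint u x)"
      using lip_compact_flow_mean_value[OF v(1) t] by blast
    \<comment> \<open>The quantity to be estimated is I1 + t I3 - t I2. Here \<open>I1\<close> and
      \<open>I2\<close> contain only the error f - v, and \<open>I3\<close> the change of v between
      times 0 and s.\<close>
    define I1 where "I1 = (LINT x|lborel. (d (Phi t x) - d x) * u x)"
    define I2 where "I2 = (LINT x|lborel. d x * adjoint u x)"
    define I3 where "I3 = (LINT x|lborel. (v (Phi s x) - v x) * adjoint u x)"
    have I1: "\<bar>I1\<bar> \<le> a * (G + 1) * \<eta>"
    proof -
      have "ennreal \<bar>I1\<bar> \<le> ennreal a * L1norm (\<lambda>x. d (Phi t x) - d x)" unfolding I1_def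
        using di by (intro integral_mult_AE_bounded_le aAE a integrable_Phi Bochner_Integration.integrable_diff) auto
      also have "L1norm (\<lambda>x. d (Phi t x) - d x) \<le> L1norm (\<lambda>x. d (Phi t x) - 0) + L1norm (\<lambda>x. 0 - d x)"
        by (rule L1norm_triangle) measurable
      also have "\<dots> \<le> ennreal (G * \<eta>) + ennreal \<eta>"
        using dP[of t] dn t by (intro add_mono) (auto simp: L1norm_def)
      also have "ennreal a * (ennreal (G * \<eta>) + ennreal \<eta>) = ennreal (a * (G + 1) * \<eta>)"
        using a G \<eta> by (simp add: algebra_simps flip: ennreal_mult ennreal_plus)
      finally show ?thesis using a G \<eta> by (simp add: ennreal_le_iff mult_left_mono)
    qed
    have I2: "\<bar>I2\<bar> \<le> b * \<eta>"
    proof -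
      have "ennreal \<bar>I2\<bar> \<le> ennreal b * L1norm d" unfolding I2_def
        by (intro integral_mult_AE_bounded_le b di) auto
      also have "\<dots> \<le> ennreal b * ennreal \<eta>" by (intro mult_left_mono dn) auto
      finally show ?thesis using b \<eta> by (simp flip: ennreal_mult)
    qed
    have I3: "\<bar>I3\<bar> \<le> b * (G * \<eta> + (e + \<eta>))"
    proof -
      have "ennreal \<bar>I3\<bar> \<le> ennreal b * L1norm (\<lambda>x. v (Phi s x) - v x)" unfolding I3_def
        using vi by (intro integral_mult_AE_bounded_le b integrable_Phi Bochner_Integration.integrable_diff) auto
      also have "L1norm (\<lambda>x. v (Phi s x) - v x) \<le> L1norm (\<lambda>x. v (Phi s x) - f (Phi s x)) + L1norm (\<lambda>x. f (Phi s x) - v x)"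
        by (rule L1norm_triangle) measurable
      also have "L1norm (\<lambda>x. f (Phi s x) - v x) \<le> L1norm (\<lambda>x. f (Phi s x) - f x) + L1norm (\<lambda>x. f x - v x)"
        by (rule L1norm_triangle) measurable
      also have "L1norm (\<lambda>x. v (Phi s x) - f (Phi s x)) = L1norm (\<lambda>x. d (Phi s x))"
        unfolding d_def by (rule L1norm_minus_commute)
      also have "L1norm (\<lambda>x. d (Phi s x)) + (L1norm (\<lambda>x. f (Phi s x) - f x) + L1norm (\<lambda>x. f x - v x)) \<le> ennreal (G * \<eta>) + (ennreal e + ennreal \<eta>)"
        using s by (intro add_mono dP e(2) v(2)) auto
      also have "ennreal b * (ennreal (G * \<eta>) + (ennreal e + ennreal \<eta>)) = ennreal (b * (G * \<eta> + (e + \<eta>)))"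
        using b G \<eta> e(1) by (simp flip: ennreal_mult ennreal_plus)
      finally show ?thesis using b G \<eta> e(1) by (simp add: ennreal_le_iff add_left_mono mult_left_mono)
    qed
    have ifP: "integrable lborel (\<lambda>x. (h (Phi s x) - h x) * k x)" if "integrable lborel h" "k \<in> borel_measurable borel" "AE x in lborel. \<bar>k x\<bar> \<le> B"
      for h k :: "real^'n \<Rightarrow> real" and B s
      by (rule integrable_mult_AE_bounded[OF _ that(2,3)])
         (intro that(1) integrable_Phi Bochner_Integration.integrable_diff)
    have im: "integrable lborel (\<lambda>x. h x * adjoint u x)" if "integrable lborel h" for h
      using that b(2) by (intro integrable_mult_AE_bounded) auto
    have e1: "(LINT x|lborel. (f (Phi t x) - f x) * u x) = I1 + (LINT x|lborel. (v (Phi t x) - v x) * u x)"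
    proof -
      have "(LINT x|lborel. (f (Phi t x) - f x) * u x) = (LINT x|lborel. (d (Phi t x) - d x) * u x + (v (Phi t x) - v x) * u x)"
        by (intro Bochner_Integration.integral_cong) (auto simp: d_def algebra_simps)
      also have "\<dots> = I1 + (LINT x|lborel. (v (Phi t x) - v x) * u x)"
        unfolding I1_def by (intro Bochner_Integration.integral_add ifP[OF _ _ aAE] di vi) auto
      finally show ?thesis .
    qed
    have e2: "(LINT x|lborel. f x * adjoint u x) = I2 + (LINT x|lborel. v x * adjoint u x)"
    proof -
      have "(LINT x|lborel. f x * adjoint u x) = (LINT x|lborel. d x * adjoint u x + v x * adjoint u x)"
        by (intro Bochner_Integration.integral_cong) (auto simp: d_def algebra_simps)
      also have "\<dots> = I2 + (LINT x|lborel. v x * adjoint u x)"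
        unfolding I2_def by (intro Bochner_Integration.integral_add im di vi)
      finally show ?thesis .
    qed
    have e3: "(LINT x|lborel. v (Phi s x) * adjoint u x) = I3 + (LINT x|lborel. v x * adjoint u x)"
    proof -
      have "(LINT x|lborel. v (Phi s x) * adjoint u x) = (LINT x|lborel. (v (Phi s x) - v x) * adjoint u x + v x * adjoint u x)"
        by (intro Bochner_Integration.integral_cong) (auto simp: algebra_simps)
      also have "\<dots> = I3 + (LINT x|lborel. v x * adjoint u x)"
        unfolding I3_def by (intro Bochner_Integration.integral_add im vi ifP[OF _ _ b(2)]) auto
      finally show ?thesis .
    qed
    have "(LINT x|lborel. (f (Phi t x) - f x) * u x) - t * (LINT x|lborel. f x * adjoint u x) = I1 + t * I3 - t * I2"
      unfolding e1 s(3) e2 e3 by (simp add: algebra_simps)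
    then have "\<bar>(LINT x|lborel. (f (Phi t x) - f x) * u x) - t * (LINT x|lborel. f x * adjoint u x)\<bar> \<le> \<bar>I1\<bar> + t * \<bar>I3\<bar> + t * \<bar>I2\<bar>"
      using t abs_triangle_ineq[of "I1 + t * I3" "- (t * I2)"] abs_triangle_ineq[of I1 "t * I3"] by (simp add: abs_mult)
    also have "\<dots> \<le> a * (G + 1) * \<eta> + t * (b * (G * \<eta> + (e + \<eta>))) + t * (b * \<eta>)"
      using t by (intro add_mono mult_left_mono I1 I2 I3) auto
    also have "\<dots> = t * b * e + c * \<eta>" by (simp add: c_def algebra_simps)
    also have "\<dots> \<le> t * b * e + r" using \<eta>(2) by simp
    finally show ?thesis .
  qed
  then show ?thesis by (rule field_le_epsilon)
qed

end

text \<open>Strong continuity supplies the e of \<open>flow_difference_le\<close>, so division by t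
  leaves an error b e. Testing the generator limit with u, bounded by a, leaves a e.\<close>

lemma generator_limit_imp_distributional:
  assumes f: "integrable lborel f" and g: "integrable lborel g" and f0: "\<And>x. x \<notin> \<Omega> \<Longrightarrow> f x = 0"
    and fg: "generator_limit f g"
  shows "distributional f g"
  unfolding distributional_def
proof (intro allI impI)
  fix u assume u: "test_function \<Omega> u"
  note [measurable] = borel_measurable_integrable[OF f, simplified] borel_measurable_integrable[OF g, simplified] test_measurable[OF u]
  obtain a where a: "0 \<le> a" "\<And>x. \<bar>u x\<bar> \<le> a" using lip_compact_bounded[OF test_lip_compact[OF u]] by blast
  have aAE: "AE x in lborel. \<bar>u x\<bar> \<le> a" using a(2) by simp
  obtain b where b: "0 \<le> b" "AE x in lborel. \<bar>adjoint u x\<bar> \<le> b" using adjoint_bounded[OF u] by blast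
  have "\<bar>(LINT x|lborel. g x * u x) - (LINT x|lborel. f x * adjoint u x)\<bar> \<le> 0 + r" if r: "0 < r" for r
  proof -
    define e where "e = r / (a + b + 1)"
    have e: "0 < e" "(a + b) * e \<le> r" using r a(1) b(1) by (auto simp: e_def field_simps)
    obtain \<delta> where \<delta>: "\<delta> > 0" "\<And>t. \<bar>t\<bar> \<le> \<delta> \<Longrightarrow> L1norm (\<lambda>x. f (Phi t x) - f x) \<le> ennreal e"
      using L1norm_Phi_continuous[OF f f0 e(1)] by blast
    have "\<forall>\<^sub>F t in at_right 0. L1norm (\<lambda>x. (f (Phi t x) - f x) / t - g x) < ennreal e"
      using fg e(1) unfolding generator_limit_def by (intro order_tendstoD(2)) auto
    then obtain \<eta> where \<eta>: "\<eta> > 0" "\<And>t. 0 < t \<Longrightarrow> t < \<eta> \<Longrightarrow> L1norm (\<lambda>x. (f (Phi t x) - f x) / t - g x) < ennreal e"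
      unfolding eventually_at_right_field by auto
    define t where "t = min \<delta> \<eta> / 2"
    have t: "0 < t" "t \<le> \<delta>" "t < \<eta>" using \<delta>(1) \<eta>(1) by (auto simp: t_def)
    let ?A = "LINT x|lborel. (f (Phi t x) - f x) * u x" and ?B = "LINT x|lborel. f x * adjoint u x"
    have "\<bar>?A - t * ?B\<bar> \<le> t * b * e"
      using t e by (intro flow_difference_le[OF u f f0] b \<delta>(2)) auto
    then have 1: "\<bar>?A / t - ?B\<bar> \<le> b * e"
    proof -
      have "\<bar>?A / t - ?B\<bar> = \<bar>?A - t * ?B\<bar> / t" using t(1) by (simp add: abs_div_pos[symmetric] field_simps)
      also have "\<dots> \<le> (t * b * e) / t" using \<open>\<bar>?A - t * ?B\<bar> \<le> t * b * e\<close> t(1) by (intro divide_right_mono) auto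
      finally show ?thesis using t(1) by simp
    qed
    have di: "integrable lborel (\<lambda>x. (f (Phi t x) - f x) / t - g x)"
      using f g integrable_Phi[OF f, of t] by simp
    have "ennreal \<bar>LINT x|lborel. ((f (Phi t x) - f x) / t - g x) * u x\<bar> \<le> ennreal a * L1norm (\<lambda>x. (f (Phi t x) - f x) / t - g x)"
      by (intro integral_mult_AE_bounded_le di aAE a) auto
    also have "\<dots> \<le> ennreal a * ennreal e" using \<eta>(2)[OF t(1,3)] by (intro mult_left_mono) auto
    finally have 2: "\<bar>LINT x|lborel. ((f (Phi t x) - f x) / t - g x) * u x\<bar> \<le> a * e"
      using a(1) e(1) by (simp flip: ennreal_mult)
    have "(LINT x|lborel. ((f (Phi t x) - f x) / t - g x) * u x) = (LINT x|lborel. (f (Phi t x) - f x) * u x / t - g x * u x)"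
      by (intro Bochner_Integration.integral_cong) (auto simp: left_diff_distrib)
    also have "\<dots> = ?A / t - (LINT x|lborel. g x * u x)"
    proof -
      have "integrable lborel (\<lambda>x. (f (Phi t x) - f x) * u x)"
        using f by (intro integrable_mult_bounded[OF _ _ a(2)] Bochner_Integration.integrable_diff integrable_Phi) auto
      moreover have "integrable lborel (\<lambda>x. g x * u x)" by (intro integrable_mult_bounded[OF g _ a(2)]) auto
      ultimately show ?thesis by simp
    qed
    finally have "\<bar>?A / t - (LINT x|lborel. g x * u x)\<bar> \<le> a * e" using 2 by simp
    then have "\<bar>(LINT x|lborel. g x * u x) - ?B\<bar> \<le> a * e + b * e" using 1 by linarith
    then show ?thesis using e(2) by (simp add: algebra_simps)
  qed
  then have "\<bar>(LINT x|lborel. g x * u x) - (LINT x|lborel. f x * adjoint u x)\<bar> \<le> 0" by (rule field_le_epsilon)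
  then show "(LINT x|lborel. g x * u x) =
       - (LINT x|lborel. f x * field_deriv u x)
       - (LINT x|lborel. f x * (u x * Div x))"
    using integral_adjoint[OF u f] by simp
qed

end

section \<open>Borel representatives\<close>

lemma AE_lebesgue_on_iff:
  fixes \<Omega> :: "'a::euclidean_space set"
  assumes "\<Omega> \<in> sets borel"
  shows "(AE x in lebesgue_on \<Omega>. P x) \<longleftrightarrow> (AE x in lborel. x \<in> \<Omega> \<longrightarrow> P x)"
proof -
  have "\<Omega> \<inter> space lebesgue \<in> sets lebesgue" using assms by auto
  then show ?thesis by (simp add: AE_restrict_space_iff AE_completion_iff)
qed

text \<open>Completeness of Lebesgue measure: a preimage under h differs from the one under k only
  inside a null set, all of whose subsets are measurable.\<close>

lemma borel_measurable_lebesgue_AE: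
  fixes h k :: "'a::euclidean_space \<Rightarrow> real"
  assumes k: "k \<in> borel_measurable borel" and hk: "AE x in lborel. h x = k x"
  shows "h \<in> borel_measurable lebesgue"
proof -
  obtain N where N: "N \<in> null_sets lborel" "{x. h x \<noteq> k x} \<subseteq> N"
    using hk by (auto simp: eventually_ae_filter)
  have Nl: "N \<in> sets lebesgue" using N(1) by (auto simp: null_sets_def)
  show ?thesis
  proof (rule measurableI)
    fix A :: "real set" assume A: "A \<in> sets borel"
    have "h -` A \<inter> N \<in> null_sets lebesgue"
      by (rule null_sets_completion_subset[OF _ null_sets_completionI[OF N(1)]]) simp
    then have 1: "h -` A \<inter> N \<in> sets lebesgue" by auto
    have "k -` A \<in> sets borel" using measurable_sets[OF k A] by simp
    then have 2: "k -` A - N \<in> sets lebesgue" using Nl by auto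
    have eq: "h -` A \<inter> space lebesgue = (k -` A - N) \<union> (h -` A \<inter> N)" using N(2) by auto
    show "h -` A \<inter> space lebesgue \<in> sets lebesgue" unfolding eq by (rule sets.Un[OF 2 1])
  qed auto
qed

lemma integrable_lebesgue_AE_iff:
  fixes h k :: "'a::euclidean_space \<Rightarrow> real"
  assumes k: "k \<in> borel_measurable borel" and hk: "AE x in lborel. h x = k x"
  shows "integrable lebesgue h \<longleftrightarrow> integrable lborel k" "integral\<^sup>L lebesgue h = integral\<^sup>L lborel k"
proof -
  have m: "h \<in> borel_measurable lebesgue" "k \<in> borel_measurable lebesgue"
    using borel_measurable_lebesgue_AE[OF k hk] k by (auto intro: measurable_completion)
  have AE: "AE x in lebesgue. h x = k x" using hk by (rule AE_completion)
  have "integrable lebesgue h \<longleftrightarrow> integrable lebesgue k" by (rule integrable_cong_AE[OF m AE])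
  then show "integrable lebesgue h \<longleftrightarrow> integrable lborel k" using k by (simp add: integrable_completion)
  have "integral\<^sup>L lebesgue h = integral\<^sup>L lebesgue k" by (rule integral_cong_AE[OF m AE])
  then show "integral\<^sup>L lebesgue h = integral\<^sup>L lborel k" using k by (simp add: integral_completion)
qed

lemma lebesgue_on_AE_iff:
  fixes h k :: "'a::euclidean_space \<Rightarrow> real"
  assumes \<Omega>: "\<Omega> \<in> sets borel" and k: "k \<in> borel_measurable borel"
    and hk: "AE x in lborel. x \<in> \<Omega> \<longrightarrow> h x = k x" and k0: "\<And>x. x \<notin> \<Omega> \<Longrightarrow> k x = 0"
  shows "integrable (lebesgue_on \<Omega>) h \<longleftrightarrow> integrable lborel k"
    and "integral\<^sup>L (lebesgue_on \<Omega>) h = integral\<^sup>L lborel k"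
    and "(\<integral>\<^sup>+x. ennreal \<bar>h x\<bar> \<partial>lebesgue_on \<Omega>) = L1norm k"
proof -
  have \<Omega>': "\<Omega> \<inter> space lebesgue \<in> sets lebesgue" using \<Omega> by auto
  have AE: "AE x in lborel. indicator \<Omega> x *\<^sub>R h x = k x"
    using hk by eventually_elim (use k0 in \<open>auto simp: indicator_def\<close>)
  show "integrable (lebesgue_on \<Omega>) h \<longleftrightarrow> integrable lborel k"
    using integrable_lebesgue_AE_iff(1)[OF k AE] by (simp only: integrable_restrict_space[OF \<Omega>'])
  show "integral\<^sup>L (lebesgue_on \<Omega>) h = integral\<^sup>L lborel k"
    using integrable_lebesgue_AE_iff(2)[OF k AE] by (simp only: integral_restrict_space[OF \<Omega>'])
  have "(\<integral>\<^sup>+x. ennreal \<bar>h x\<bar> \<partial>lebesgue_on \<Omega>) = (\<integral>\<^sup>+x. ennreal \<bar>h x\<bar> * indicator \<Omega> x \<partial>lebesgue)"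
    by (rule nn_integral_restrict_space[OF \<Omega>'])
  also have "\<dots> = (\<integral>\<^sup>+x. ennreal \<bar>h x\<bar> * indicator \<Omega> x \<partial>lborel)" by (rule nn_integral_completion)
  also have "\<dots> = L1norm k" unfolding L1norm_def
  proof (rule nn_integral_cong_AE)
    show "AE x in lborel. ennreal \<bar>h x\<bar> * indicator \<Omega> x = ennreal \<bar>k x\<bar>"
      using hk by eventually_elim (use k0 in \<open>auto simp: indicator_def\<close>)
  qed
  finally show "(\<integral>\<^sup>+x. ennreal \<bar>h x\<bar> \<partial>lebesgue_on \<Omega>) = L1norm k" .
qed

text \<open>Borel measurability makes composites with the flow jointly measurable in time and space;
  vanishing off \<Omega> turns integrals over \<Omega> into integrals over the whole space.\<close>

definition borel_version :: "'a::euclidean_space set \<Rightarrow> ('a \<Rightarrow> real) \<Rightarrow> ('a \<Rightarrow> real) \<Rightarrow> bool" where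
  "borel_version \<Omega> f f0 \<longleftrightarrow> integrable lborel f0 \<and> (\<forall>x. x \<notin> \<Omega> \<longrightarrow> f0 x = 0) \<and> (AE x in lborel. x \<in> \<Omega> \<longrightarrow> f x = f0 x)"

lemma borel_versionD:
  assumes "borel_version \<Omega> f f0"
  shows "integrable lborel f0" "x \<notin> \<Omega> \<Longrightarrow> f0 x = 0" "AE x in lborel. x \<in> \<Omega> \<longrightarrow> f x = f0 x"
    "f0 \<in> borel_measurable borel"
  using assms by (auto simp: borel_version_def integrable_iff_bounded)

lemma borel_version_exists:
  fixes f :: "'a::euclidean_space \<Rightarrow> real"
  assumes \<Omega>: "\<Omega> \<in> sets borel" and f: "integrable (lebesgue_on \<Omega>) f"
  shows "\<exists>f0. borel_version \<Omega> f f0"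
proof -
  have \<Omega>': "\<Omega> \<inter> space lebesgue \<in> sets lebesgue" using \<Omega> by auto
  have i: "integrable lebesgue (\<lambda>x. indicator \<Omega> x *\<^sub>R f x)"
    using f by (simp only: integrable_restrict_space[OF \<Omega>'])
  then obtain g where g: "g \<in> borel_measurable lborel" "AE x in lborel. indicator \<Omega> x *\<^sub>R f x = g x"
    using completion_ex_borel_measurable_real[OF borel_measurable_integrable[OF i]] by auto
  define f0 where "f0 x = indicator \<Omega> x * g x" for x
  have m: "f0 \<in> borel_measurable borel" unfolding f0_def using \<Omega> g(1) by auto
  have AE: "AE x in lborel. x \<in> \<Omega> \<longrightarrow> f x = f0 x"
    using g(2) by eventually_elim (auto simp: f0_def)
  have "f0 x = 0" if "x \<notin> \<Omega>" for x using that by (simp add: f0_def)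
  from lebesgue_on_AE_iff(1)[OF \<Omega> m AE this] f have "integrable lborel f0" by blast
  then show ?thesis using AE unfolding borel_version_def by (intro exI[of _ f0]) (auto simp: f0_def)
qed

lemma AE_lborel_snd:
  fixes Q :: "'b::euclidean_space \<Rightarrow> bool"
  assumes "AE x in lborel. Q x"
  shows "AE p in (lborel :: ('a::euclidean_space \<times> 'b) measure). Q (snd p)"
proof -
  obtain N where N: "N \<in> null_sets lborel" "{x. \<not> Q x} \<subseteq> N" using assms by (auto simp: eventually_ae_filter)
  have [measurable]: "N \<in> sets borel" using N(1) by (auto simp: null_sets_def)
  have "AE p in (lborel :: 'a measure) \<Otimes>\<^sub>M (lborel :: 'b measure). snd p \<notin> N"
    by (rule lborel_pair.AE_pair_measure) (measurable, use AE_not_in[OF N(1)] in simp)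
  then have "AE p in (lborel :: ('a \<times> 'b) measure). snd p \<notin> N" by (simp only: lborel_prod)
  then show ?thesis by eventually_elim (use N(2) in auto)
qed

context complete_lipschitz_field
begin

text \<open>At each fixed time the preimage of the exceptional set is null, and Fubini passes to
  space-time and to almost every orbit. The second form permits replacing g by its Borel version
  inside the time integral along an orbit.\<close>

lemma AE_Phi_pair:
  assumes "AE x in lborel. Q x"
  shows "AE p in (lborel :: (real \<times> (real^'n)) measure). Q (Phi (fst p) (snd p))"
    and "AE x in lborel. AE s in lborel. Q (Phi s x)"
proof -
  obtain N where N: "N \<in> null_sets lborel" "{x. \<not> Q x} \<subseteq> N" using assms by (auto simp: eventually_ae_filter)
  have [measurable]: "N \<in> sets borel" using N(1) by (auto simp: null_sets_def)
  have 0: "AE s in lborel. AE x in lborel. Phi s x \<notin> N" using AE_Phi[OF AE_not_in[OF N(1)]] by simp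
  have "AE p in (lborel :: real measure) \<Otimes>\<^sub>M (lborel :: (real^'n) measure). Phi (fst p) (snd p) \<notin> N"
    by (rule lborel_pair.AE_pair_measure) (measurable, use 0 in simp)
  then have "AE p in (lborel :: (real \<times> (real^'n)) measure). Phi (fst p) (snd p) \<notin> N" by (simp only: lborel_prod)
  then show "AE p in (lborel :: (real \<times> (real^'n)) measure). Q (Phi (fst p) (snd p))"
    by eventually_elim (use N(2) in auto)
  have "AE x in lborel. AE s in lborel. Phi s x \<notin> N"
    using 0 by (subst (asm) lborel_pair.AE_commute) measurable
  then show "AE x in lborel. AE s in lborel. Q (Phi s x)"
  proof eventually_elim
    case (elim x)
    then show ?case by eventually_elim (use N(2) in auto)
  qed
qed

section \<open>The three conditions in terms of Borel versions\<close>

lemma flow_eq_Phi: "x \<in> \<Omega> \<Longrightarrow> flow X \<Omega> t x = Phi t x"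
  by (simp add: Phi_def)

lemma is_distributional_derivative_iff:
  assumes f: "borel_version \<Omega> f f0" and g: "borel_version \<Omega> g g0"
  shows "is_distributional_derivative X \<Omega> f g \<longleftrightarrow> distributional f0 g0"
  unfolding is_distributional_derivative_def distributional_def
proof (intro all_cong)
  fix u assume u: "test_function \<Omega> u"
  note [measurable] = borel_versionD(4)[OF f] borel_versionD(4)[OF g] test_measurable[OF u] partial_test_measurable[OF u]
  have 1: "(LINT x|lebesgue_on \<Omega>. g x * u x) = (LINT x|lborel. g0 x * u x)"
    using borel_versionD(3)[OF g] by (intro lebesgue_on_AE_iff) (auto elim!: eventually_mono simp: borel_versionD(2)[OF g])
  have 2: "(LINT x|lebesgue_on \<Omega>. f x * apply_field X u x) = (LINT x|lborel. f0 x * field_deriv u x)"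
    using borel_versionD(3)[OF f]
    by (intro lebesgue_on_AE_iff) (auto elim!: eventually_mono simp: borel_versionD(2)[OF f] apply_field_def field_ext(2))
  have 3: "(LINT x|lebesgue_on \<Omega>. f x * u x * divergence X x) = (LINT x|lborel. f0 x * (u x * Div x))"
    using borel_versionD(3)[OF f]
    by (intro lebesgue_on_AE_iff) (auto elim!: eventually_mono simp: borel_versionD(2)[OF f] Div_eq)
  show "((LINT x|lebesgue_on \<Omega>. g x * u x) = - (LINT x|lebesgue_on \<Omega>. f x * apply_field X u x) - (LINT x|lebesgue_on \<Omega>. f x * u x * divergence X x)) \<longleftrightarrow>
    ((LINT x|lborel. g0 x * u x) = - (LINT x|lborel. f0 x * field_deriv u x) - (LINT x|lborel. f0 x * (u x * Div x)))"
    unfolding 1 2 3 ..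
qed

lemma has_generator_value_iff:
  assumes f: "borel_version \<Omega> f f0" and g: "borel_version \<Omega> g g0"
  shows "has_generator_value \<Omega> (flow_group X \<Omega>) f g \<longleftrightarrow> generator_limit f0 g0"
proof -
  note [measurable] = borel_versionD(4)[OF f] borel_versionD(4)[OF g]
  have gi: "integrable (lebesgue_on \<Omega>) g"
    using lebesgue_on_AE_iff(1)[OF dom_borel borel_versionD(4,3,2)[OF g]] borel_versionD(1)[OF g] by simp
  have eq: "(\<integral>\<^sup>+x. ennreal \<bar>(flow_group X \<Omega> t f x - f x) / t - g x\<bar> \<partial>lebesgue_on \<Omega>) = L1norm (\<lambda>x. (f0 (Phi t x) - f0 x) / t - g0 x)" for t
  proof (rule lebesgue_on_AE_iff(3))
    show "AE x in lborel. x \<in> \<Omega> \<longrightarrow> (flow_group X \<Omega> t f x - f x) / t - g x = (f0 (Phi t x) - f0 x) / t - g0 x"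
      using borel_versionD(3)[OF f] borel_versionD(3)[OF g] AE_Phi[OF borel_versionD(3)[OF f], of t]
      by eventually_elim (simp add: flow_group_def flow_eq_Phi)
  qed (auto simp: borel_versionD(2)[OF f] borel_versionD(2)[OF g])
  show ?thesis unfolding has_generator_value_def generator_limit_def eq using gi by simp
qed

text \<open>Needed because \<open>generator\<close> selects some limit: uniqueness up to null sets
  identifies the selected function with g.\<close>

lemma generator_limit_unique:
  assumes [measurable]: "f \<in> borel_measurable borel" "g \<in> borel_measurable borel" "h \<in> borel_measurable borel"
    and g: "generator_limit f g" and h: "generator_limit f h"
  shows "AE x in lborel. g x = h x"
proof -
  let ?q = "\<lambda>t x. (f (Phi t x) - f x) / t"
  have "L1norm (\<lambda>x. g x - h x) \<le> 0 + 0"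
  proof (rule tendsto_lowerbound)
    show "((\<lambda>t. L1norm (\<lambda>x. ?q t x - g x) + L1norm (\<lambda>x. ?q t x - h x)) \<longlongrightarrow> 0 + 0) (at_right 0)"
      using g h unfolding generator_limit_def by (rule tendsto_add)
    have "L1norm (\<lambda>x. g x - h x) \<le> L1norm (\<lambda>x. ?q t x - g x) + L1norm (\<lambda>x. ?q t x - h x)" for t
      using L1norm_triangle[of g "?q t" h] L1norm_minus_commute[of g "?q t"] by simp
    then show "\<forall>\<^sub>F t in at_right 0. L1norm (\<lambda>x. g x - h x) \<le> L1norm (\<lambda>x. ?q t x - g x) + L1norm (\<lambda>x. ?q t x - h x)"
      by simp
  qed simp
  then have "L1norm (\<lambda>x. g x - h x) = 0" by simp
  then have "AE x in lborel. g x - h x = 0" by (subst (asm) L1norm_zero_iff) auto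
  then show ?thesis by simp
qed

lemma generator_iff:
  assumes f: "borel_version \<Omega> f f0" and g: "borel_version \<Omega> g g0"
  shows "f \<in> generator_domain \<Omega> (flow_group X \<Omega>) \<and> (AE x in lebesgue_on \<Omega>. generator \<Omega> (flow_group X \<Omega>) f x = g x)
    \<longleftrightarrow> generator_limit f0 g0"
proof -
  let ?h = "generator \<Omega> (flow_group X \<Omega>) f"
  have hv: "has_generator_value \<Omega> (flow_group X \<Omega>) f ?h" if "has_generator_value \<Omega> (flow_group X \<Omega>) f h" for h
    using that unfolding generator_def by (rule someI[of "has_generator_value \<Omega> (flow_group X \<Omega>) f" h])
  have h0: "\<exists>h0. borel_version \<Omega> ?h h0" if "has_generator_value \<Omega> (flow_group X \<Omega>) f h" for h
    using hv[OF that] unfolding has_generator_value_def by (intro borel_version_exists) auto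
  show ?thesis
  proof
    assume *: "f \<in> generator_domain \<Omega> (flow_group X \<Omega>) \<and> (AE x in lebesgue_on \<Omega>. ?h x = g x)"
    then obtain h where h: "has_generator_value \<Omega> (flow_group X \<Omega>) f h" by (auto simp: generator_domain_def)
    have "AE x in lborel. x \<in> \<Omega> \<longrightarrow> ?h x = g x" using * by (simp add: AE_lebesgue_on_iff)
    then have "AE x in lborel. x \<in> \<Omega> \<longrightarrow> ?h x = g0 x" using borel_versionD(3)[OF g] by eventually_elim simp
    then have "borel_version \<Omega> ?h g0" using g by (simp add: borel_version_def)
    from has_generator_value_iff[OF f this] show "generator_limit f0 g0" using hv[OF h] by simp
  next
    assume gl: "generator_limit f0 g0"
    then have v: "has_generator_value \<Omega> (flow_group X \<Omega>) f g" using has_generator_value_iff[OF f g] by simp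
    obtain h0 where h0: "borel_version \<Omega> ?h h0" using h0[OF v] by blast
    have "generator_limit f0 h0" using has_generator_value_iff[OF f h0] hv[OF v] by simp
    from generator_limit_unique[OF borel_versionD(4)[OF f] borel_versionD(4)[OF h0] borel_versionD(4)[OF g] this gl]
    have "AE x in lborel. x \<in> \<Omega> \<longrightarrow> ?h x = g x"
      using borel_versionD(3)[OF g] borel_versionD(3)[OF h0] by eventually_elim simp
    moreover have "integrable (lebesgue_on \<Omega>) f"
      using lebesgue_on_AE_iff(1)[OF dom_borel borel_versionD(4,3,2)[OF f]] borel_versionD(1)[OF f] by simp
    ultimately show "f \<in> generator_domain \<Omega> (flow_group X \<Omega>) \<and> (AE x in lebesgue_on \<Omega>. ?h x = g x)"
      using v by (auto simp: generator_domain_def AE_lebesgue_on_iff)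
  qed
qed

text \<open>For almost every x the integrability clause is supplied by
  \<open>AE_time_integrable\<close>; what is left is the identity for the Borel versions almost
  everywhere in space-time. Fubini gives it for almost every t, and additivity in time for every
  t.\<close>

lemma is_Lie_derivative_iff:
  assumes f: "borel_version \<Omega> f f0" and g: "borel_version \<Omega> g g0"
  shows "is_Lie_derivative X \<Omega> f g \<longleftrightarrow> transported f0 g0"
proof -
  note [measurable] = borel_versionD(4)[OF f] borel_versionD(4)[OF g]
  define P where "P t x \<longleftrightarrow> integrable (lebesgue_on {0..t}) (\<lambda>s. g (flow X \<Omega> s x)) \<and>
        f (flow X \<Omega> t x) - f x = (LINT s|lebesgue_on {0..t}. g (flow X \<Omega> s x))" for t x
  define D where "D = ({0<..} :: real set) \<times> \<Omega>"
  have D[measurable]: "D \<in> sets borel" unfolding D_def using open_dom by (intro borel_open open_Times) auto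
  have PP: "AE p in (lborel :: (real \<times> (real^'n)) measure). p \<in> D \<longrightarrow>
      (P (fst p) (snd p) \<longleftrightarrow> f0 (Phi (fst p) (snd p)) - f0 (snd p) = time_integral g0 (fst p) (snd p))"
  proof -
    \<comment> \<open>Integer times give one null set of x that serves all t, since integrability
      over [0, k] restricts to [0, t].\<close>
    have ti: "AE x in lborel. \<forall>k::nat. time_integrable g0 (real k) x"
      using AE_time_integrable[OF borel_versionD(1)[OF g]] by (simp add: AE_all_countable)
    have ti': "AE p in (lborel :: (real \<times> (real^'n)) measure). \<forall>k::nat. time_integrable g0 (real k) (snd p)"
      by (rule AE_lborel_snd[OF ti])
    note AE_lborel_snd[OF borel_versionD(3)[OF f]] AE_Phi_pair(1)[OF borel_versionD(3)[OF f]]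
      AE_lborel_snd[OF AE_Phi_pair(2)[OF borel_versionD(3)[OF g]]] ti'
    then show ?thesis
    proof eventually_elim
      case (elim p)
      obtain t x where p: "p = (t, x)" by (cases p)
      show ?case
      proof
        assume "p \<in> D"
        then have x: "x \<in> \<Omega>" and t: "0 < t" by (auto simp: p D_def)
        have [measurable]: "(\<lambda>s. indicator {0..t} s * g0 (Phi s x)) \<in> borel_measurable borel" by measurable
        have AE: "AE s in lborel. s \<in> {0..t} \<longrightarrow> g (flow X \<Omega> s x) = indicator {0..t} s * g0 (Phi s x)"
          using elim(3) unfolding p snd_conv by eventually_elim (use x in \<open>simp add: flow_eq_Phi\<close>)
        obtain k :: nat where k: "t \<le> real k" using real_arch_simple by blast
        have "integrable lborel (\<lambda>s. indicator {0..real k} s * g0 (Phi s x))"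
          using elim(4) by (simp add: p time_integrable_def)
        then have i: "integrable lborel (\<lambda>s. indicator {0..t} s * g0 (Phi s x))"
          by (rule Bochner_Integration.integrable_bound) (use k in \<open>auto simp: indicator_def\<close>)
        have "integrable (lebesgue_on {0..t}) (\<lambda>s. g (flow X \<Omega> s x))"
          using lebesgue_on_AE_iff(1)[OF _ _ AE] i by simp
        moreover have "(LINT s|lebesgue_on {0..t}. g (flow X \<Omega> s x)) = time_integral g0 t x"
          unfolding time_integral_def by (rule lebesgue_on_AE_iff(2)[OF _ _ AE]) auto
        moreover have "f (flow X \<Omega> t x) = f0 (Phi t x)" "f x = f0 x"
          using elim(1,2) x by (simp_all add: p flow_eq_Phi)
        ultimately show "P (fst p) (snd p) \<longleftrightarrow> f0 (Phi (fst p) (snd p)) - f0 (snd p) = time_integral g0 (fst p) (snd p)"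
          by (simp add: P_def p)
      qed
    qed
  qed
  let ?E = "\<lambda>t x. 0 < t \<longrightarrow> f0 (Phi t x) - f0 x = time_integral g0 t x"
  have off: "f0 (Phi t x) - f0 x = time_integral g0 t x" if "x \<notin> \<Omega>" for t x
    using that by (simp add: borel_versionD(2)[OF f] borel_versionD(2)[OF g] time_integral_def)
  have "is_Lie_derivative X \<Omega> f g \<longleftrightarrow> (AE p in lborel. p \<in> D \<longrightarrow> P (fst p) (snd p))"
    unfolding is_Lie_derivative_def P_def D_def[symmetric] by (simp only: AE_lebesgue_on_iff[OF D] case_prod_unfold)
  also have "\<dots> \<longleftrightarrow> (AE p in lborel. p \<in> D \<longrightarrow> f0 (Phi (fst p) (snd p)) - f0 (snd p) = time_integral g0 (fst p) (snd p))"
    by (rule eventually_cong[OF PP]) auto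
  also have "\<dots> \<longleftrightarrow> (AE p in lborel. ?E (fst p) (snd p))"
  proof (intro arg_cong2[where f=eventually] ext refl)
    fix p
    show "(p \<in> D \<longrightarrow> f0 (Phi (fst p) (snd p)) - f0 (snd p) = time_integral g0 (fst p) (snd p)) = ?E (fst p) (snd p)"
      using off[of "snd p" "fst p"] by (cases "snd p \<in> \<Omega>") (auto simp: D_def mem_Times_iff)
  qed
  also have "\<dots> \<longleftrightarrow> (AE p in (lborel :: real measure) \<Otimes>\<^sub>M (lborel :: (real^'n) measure). ?E (fst p) (snd p))"
    by (simp only: lborel_prod)
  also have "\<dots> \<longleftrightarrow> (AE t in lborel. AE x in lborel. ?E t x)"
    by (rule lborel_pair.AE_pair_iff[symmetric]) measurable
  also have "\<dots> \<longleftrightarrow> (AE t in lborel. 0 < t \<longrightarrow> (AE x in lborel. f0 (Phi t x) - f0 x = time_integral g0 t x))"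
    by (intro arg_cong2[where f=eventually] ext refl) auto
  also have "\<dots> \<longleftrightarrow> transported f0 g0"
  proof
    assume "transported f0 g0"
    then show "AE t in lborel. 0 < t \<longrightarrow> (AE x in lborel. f0 (Phi t x) - f0 x = time_integral g0 t x)"
      unfolding transported_def by - (rule AE_I2, simp)
  qed (rule transported_if_AE[OF borel_versionD(1)[OF g]])
  finally show ?thesis .
qed

end

theorem theorem4p6:
  fixes \<Omega> :: "(real^'n) set" and X :: "real^'n \<Rightarrow> real^'n" and f g :: "real^'n \<Rightarrow> real"
  assumes "open \<Omega>"
    and "\<exists>L. L-lipschitz_on \<Omega> X"
    and "complete_vector_field X \<Omega>"
    and "integrable (lebesgue_on \<Omega>) f"
    and "integrable (lebesgue_on \<Omega>) g"
  shows "(is_distributional_derivative X \<Omega> f g \<longleftrightarrow> is_Lie_derivative X \<Omega> f g) \<and>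
         (is_Lie_derivative X \<Omega> f g \<longleftrightarrow>
            f \<in> generator_domain \<Omega> (flow_group X \<Omega>) \<and>
            (AE x in lebesgue_on \<Omega>. generator \<Omega> (flow_group X \<Omega>) f x = g x))"
proof -
  obtain L where "L-lipschitz_on \<Omega> X" using assms(2) by blast
  then interpret complete_lipschitz_field \<Omega> X L
    using assms(1,3) by unfold_locales
  obtain f0 g0 where f: "borel_version \<Omega> f f0" and g: "borel_version \<Omega> g g0"
    using borel_version_exists[OF dom_borel assms(4)] borel_version_exists[OF dom_borel assms(5)] by blast
  note f0 = borel_versionD[OF f] and g0 = borel_versionD[OF g]
  have "distributional f0 g0 \<Longrightarrow> transported f0 g0"
    by (rule distributional_imp_transported[OF f0(1) g0(1) f0(2) g0(2)])
  moreover have "transported f0 g0 \<Longrightarrow> generator_limit f0 g0"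
    by (rule transported_imp_generator_limit[OF f0(4) g0(1) g0(2)])
  moreover have "generator_limit f0 g0 \<Longrightarrow> transported f0 g0"
    by (rule generator_limit_imp_transported[OF f0(4) g0(1) g0(2)])
  moreover have "generator_limit f0 g0 \<Longrightarrow> distributional f0 g0"
    by (rule generator_limit_imp_distributional[OF f0(1) g0(1) f0(2)])
  ultimately show ?thesis
    unfolding is_distributional_derivative_iff[OF f g] is_Lie_derivative_iff[OF f g] generator_iff[OF f g]
    by blast
qed

end
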